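(* Let $D:f=0$ be a reduced surface of degree $d$ in $\mathbb{P}^3$ over $\mathbb{C}$, not a cone over a plane curve and with one-dimensional singular subscheme $\Sigma$, tame with respect to the pair of syzygies $\rho_1,\rho_2$ of degrees $e_1=\deg\rho_1\le e_2=\deg\rho_2$. Set $e_3=d-1-e_1-e_2$, $s_1=e_1+e_2+e_3$, $s_2=e_1e_2+e_1e_3+e_2e_3$. Assume $e_3\ge e_2$ and that $D$ is not free. Then $$\deg\Sigma\le s_1^2-s_2-1,$$ and equality holds if the surface $D$ is nearly free with exponents $e_1,e_2,e_3+1$. Conversely, if this equality holds and if the syzygy module $AR(f)$ is generated by $\rho_1,\rho_2$ and two other syzygies $\rho_3$ and $\rho_4$, then $D$ is a nearly free surface with exponents $e_1,e_2,e_3+1$.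
   Context: Let $S=\mathbb{C}[x,y,z,w]$ with the standard grading, $f\in S$ homogeneous of degree $d$, with partial derivatives $f_x,f_y,f_z,f_w$, Jacobian ideal $J_f=(f_x,f_y,f_z,f_w)$ and Milnor algebra $M(f)=S/J_f$ (graded). The singular subscheme $\Sigma$ of $D:f=0$ is the subscheme of $\mathbb{P}^3$ defined by $J_f$. When $\dim\Sigma=1$, the Hilbert polynomial of $M(f)$ has the form $P(M(f))(k)=ak+b$ with $a\ne 0$, and $\deg\Sigma=a$. Syzygies: $AR(f)\subset S^4$ is the graded $S$-module of all $\rho=(\alpha,\beta,\gamma,\delta)$ with $\alpha f_x+\beta f_y+\gamma f_z+\delta f_w=0$; $AR(f)_q$ consists of those with all components in $S_q$, and such a $\rho$ has degree $q$. Choice of $\rho_1,\rho_2$: $\rho_1$ is a nonzero homogeneous element of minimal degree $e_1$ in $AR(f)$, and $\rho_2\in AR(f)$ is a homogeneous representative of a nonzero homogeneous element of minimal degree $e_2\ge e_1$ in $AR(f)/(S\rho_1)$. Tameness: let $\Omega^k$ be the $S$-module of algebraic differential $k$-forms on $\mathbb{C}^4$; for $\rho=(\alpha,\beta,\gamma,\delta)$ put $\omega(\rho)=\alpha\,dx+\beta\,dy+\gamma\,dz+\delta\,dw$, and let $\Omega^1_0=\{\omega(\rho):\rho\in AR(f)\}$. $D$ is tame with respect to $\rho_1,\rho_2$ (where $\rho_1$ is a nonzero element of minimal degree $e_1$ in $AR(f)$ and $\rho_2$ represents a nonzero homogeneous element of minimal degree $e_2$ in $AR(f)/(S\rho_1)$)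 if the sequence $S(-e_1-1)\oplus S(-e_2-1)\xrightarrow{u}\Omega^1_0\xrightarrow{v}\Omega^3(e_1+e_2+2)$ is exact (at the middle term), where $u(a,b)=a\,\omega(\rho_1)+b\,\omega(\rho_2)$ and $v(\omega)=\omega(\rho_1)\wedge\omega(\rho_2)\wedge\omega$. Freeness: $D$ is free if $AR(f)\cong S(-d_1)\oplus S(-d_2)\oplus S(-d_3)$ as graded $S$-modules for some positive integers $d_1\le d_2\le d_3$. Near freeness: $D$ is nearly free with exponents $1\le d_1\le d_2\le d_3$ (with $d_4=d_3$) if $M(f)$ has a minimal graded free resolution of the form $$0\to S(-d-d_3)\to\bigoplus_{j=1}^{4}S(-d-d_j+1)\to S^4(-d+1)\xrightarrow{(f_x,f_y,f_z,f_w)}S;$$ equivalently, $AR(f)$ is minimally generated by four syzygies of degrees $d_1\le d_2\le d_3=d_4=d-(d_1+d_2)$. *)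

theory Defs
  imports
    "HOL-Analysis.Analysis"
    "HOL-Library.Poly_Mapping"
    "HOL-Library.Extended_Nat"
    "HOL-Computational_Algebra.Squarefree"
    "HOL-Computational_Algebra.Polynomial"
begin

section \<open>The graded ring \<open>S = \<complex>[x,y,z,w]\<close>\<close>

text \<open>
  The variables \<open>x, y, z, w\<close> are indexed by the elements \<open>1, 2, 3, 4\<close> of the four-element
  type \<open>4\<close> (in which \<open>4 = 0\<close>). A monomial is its exponent vector.
\<close>

type_synonym mon = "4 \<Rightarrow>\<^sub>0 nat"
type_synonym S = "mon \<Rightarrow>\<^sub>0 complex"

definition Const :: "complex \<Rightarrow> S" where
  "Const c = Poly_Mapping.single 0 c"

definition Var :: "4 \<Rightarrow> S" where
  "Var i = Poly_Mapping.single (Poly_Mapping.single i 1) 1"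

definition mdeg :: "mon \<Rightarrow> nat" where
  "mdeg m = (\<Sum>i\<in>UNIV. Poly_Mapping.lookup m i)"

text \<open>The component \<open>S\<^sub>k\<close>; it contains \<open>0\<close>, and it is \<open>{0}\<close> for \<open>k < 0\<close>.\<close>

definition grade :: "int \<Rightarrow> S set" where
  "grade k = {p. \<forall>m\<in>Poly_Mapping.keys p. int (mdeg m) = k}"

definition irrelevant_ideal :: "S set" where
  "irrelevant_ideal = {p. Poly_Mapping.lookup p 0 = 0}"

definition partial :: "4 \<Rightarrow> S \<Rightarrow> S" where
  "partial i p = (\<Sum>m\<in>Poly_Mapping.keys p.
     Poly_Mapping.single (m - Poly_Mapping.single i 1)
       (of_nat (Poly_Mapping.lookup m i) * Poly_Mapping.lookup p m))"

text \<open>The substitution of the linear form \<open>\<Sum>\<^sub>j A\<^sub>i\<^sub>j x\<^sub>j\<close> for each variable \<open>x\<^sub>i\<close>.\<close>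

definition linear_change :: "complex^4^4 \<Rightarrow> S \<Rightarrow> S" where
  "linear_change A p = (\<Sum>m\<in>Poly_Mapping.keys p.
     Const (Poly_Mapping.lookup p m) *
       (\<Prod>i\<in>UNIV. (\<Sum>j\<in>UNIV. Const (A $ i $ j) * Var j) ^ Poly_Mapping.lookup m i))"

text \<open>
  In suitable linear coordinates the equation involves only \<open>x, y, z\<close>: the surface is the cone,
  with vertex \<open>(0:0:0:1)\<close>, over a curve in the plane \<open>w = 0\<close>.
\<close>

definition cone_over_plane_curve :: "S \<Rightarrow> bool" where
  "cone_over_plane_curve f \<longleftrightarrow>
     (\<exists>A. invertible A \<and> (\<forall>m\<in>Poly_Mapping.keys (linear_change A f). Poly_Mapping.lookup m 4 = 0))"

section \<open>The Milnor algebra and the singular subscheme\<close>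

definition jac_ideal :: "S \<Rightarrow> S set" where
  "jac_ideal f = module.span (*) (range (\<lambda>i. partial i f))"

text \<open>The classes of the elements of \<open>B\<close> form a \<open>\<complex>\<close>-basis of \<open>M(f)\<^sub>k = S\<^sub>k / (J\<^sub>f)\<^sub>k\<close>.\<close>

definition milnor_basis :: "S \<Rightarrow> int \<Rightarrow> S set \<Rightarrow> bool" where
  "milnor_basis f k B \<longleftrightarrow> finite B \<and> B \<subseteq> grade k \<and>
     (\<forall>p\<in>grade k. \<exists>!c. (\<forall>b. b \<notin> B \<longrightarrow> c b = 0) \<and> p - (\<Sum>b\<in>B. Const (c b) * b) \<in> jac_ideal f)"

definition milnor_dim :: "S \<Rightarrow> int \<Rightarrow> nat" where
  "milnor_dim f k = (THE n. \<exists>B. milnor_basis f k B \<and> card B = n)"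

definition hilbert_polynomial :: "(int \<Rightarrow> nat) \<Rightarrow> rat poly \<Rightarrow> bool" where
  "hilbert_polynomial h P \<longleftrightarrow> (\<forall>\<^sub>F k in sequentially. of_nat (h (int k)) = poly P (of_nat k))"

text \<open>
  The points of \<open>Proj (S / J)\<close>: the homogeneous primes that contain \<open>J\<close> but not the
  irrelevant ideal. A prime is homogeneous if it is generated by homogeneous elements.
\<close>

definition proj_points :: "S set \<Rightarrow> S set set" where
  "proj_points J = {P.
     module.subspace (*) P \<and> P = module.span (*) {p\<in>P. \<exists>k. p \<in> grade k} \<and>
     P \<noteq> UNIV \<and> (\<forall>a b. a * b \<in> P \<longrightarrow> a \<in> P \<or> b \<in> P) \<and>
     J \<subseteq> P \<and> \<not> irrelevant_ideal \<subseteq> P}"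

text \<open>
  The dimension of the scheme \<open>\<Sigma> = Proj (S / J\<^sub>f)\<close> as a topological space: irreducible closed
  subsets are the closures of points, so chains of them are chains of homogeneous primes.
  (The supremum in \<open>enat\<close> also assigns dimension \<open>0\<close> to the empty scheme.)
\<close>

definition sing_dim :: "S \<Rightarrow> enat" where
  "sing_dim f = (SUP n\<in>{n. \<exists>C. (\<forall>i\<le>n. C i \<in> proj_points (jac_ideal f)) \<and>
                              (\<forall>i<n. C i \<subset> C (Suc i))}. enat n)"

text \<open>
  For one-dimensional \<open>\<Sigma>\<close>: \<open>deg \<Sigma> = a\<close>, where \<open>P(M(f))(k) = a k + b\<close>. Since a Hilbert
  polynomial is unique, at most one \<open>a\<close> satisfies this.
\<close>

definition has_sing_degree :: "S \<Rightarrow> rat \<Rightarrow> bool" where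
  "has_sing_degree f a \<longleftrightarrow> (\<exists>b. hilbert_polynomial (milnor_dim f) [:b, a:])"

section \<open>Jacobian syzygies\<close>

definition jac_map :: "S \<Rightarrow> S^4 \<Rightarrow> S" where
  "jac_map f \<rho> = (\<Sum>i\<in>UNIV. \<rho> $ i * partial i f)"

definition AR :: "S \<Rightarrow> (S^4) set" where
  "AR f = {\<rho>. jac_map f \<rho> = 0}"

definition AR_grade :: "S \<Rightarrow> int \<Rightarrow> (S^4) set" where
  "AR_grade f q = {\<rho>\<in>AR f. \<forall>i. \<rho> $ i \<in> grade q}"

definition first_syzygy :: "S \<Rightarrow> S^4 \<Rightarrow> int \<Rightarrow> bool" where
  "first_syzygy f \<rho>1 e1 \<longleftrightarrow> \<rho>1 \<in> AR_grade f e1 \<and> \<rho>1 \<noteq> 0 \<and>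
     (\<forall>q. \<forall>\<rho>\<in>AR_grade f q. \<rho> \<noteq> 0 \<longrightarrow> e1 \<le> q)"

text \<open>
  A homogeneous \<open>\<rho>\<close> represents a nonzero element of \<open>AR(f) / S\<rho>\<^sub>1\<close> iff it is not a multiple
  of \<open>\<rho>\<^sub>1\<close>, and every homogeneous element of the quotient has a homogeneous representative.
\<close>

definition second_syzygy :: "S \<Rightarrow> S^4 \<Rightarrow> S^4 \<Rightarrow> int \<Rightarrow> bool" where
  "second_syzygy f \<rho>1 \<rho>2 e2 \<longleftrightarrow> \<rho>2 \<in> AR_grade f e2 \<and> \<rho>2 \<notin> module.span (*s) {\<rho>1} \<and>
     (\<forall>q. \<forall>\<rho>\<in>AR_grade f q. \<rho> \<notin> module.span (*s) {\<rho>1} \<longrightarrow> e2 \<le> q)"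

section \<open>Differential forms and tameness\<close>

text \<open>
  A form \<open>\<Sum>\<^sub>I \<omega>\<^sub>I dx\<^sub>I\<close> is given by its coefficients, where \<open>dx\<^sub>I\<close> is the wedge product of the
  \<open>dx\<^sub>i\<close>, \<open>i \<in> I\<close>, in increasing order with respect to the linear order of the type \<open>4\<close>.
\<close>

type_synonym form = "4 set \<Rightarrow> S"

text \<open>\<open>dx\<^sub>J \<and> dx\<^sub>K = wedge_sign J K dx\<^bsub>J \<union> K\<^esub>\<close> for disjoint \<open>J\<close> and \<open>K\<close>.\<close>

definition wedge_sign :: "4 set \<Rightarrow> 4 set \<Rightarrow> S" where
  "wedge_sign J K = (-1) ^ card {(j, k). j \<in> J \<and> k \<in> K \<and> k < j}"

definition wedge :: "form \<Rightarrow> form \<Rightarrow> form" where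
  "wedge \<omega> \<eta> = (\<lambda>I. \<Sum>J\<in>Pow I. wedge_sign J (I - J) * \<omega> J * \<eta> (I - J))"

definition dvar :: "4 \<Rightarrow> form" where
  "dvar i = (\<lambda>I. if I = {i} then 1 else 0)"

definition one_form :: "S^4 \<Rightarrow> form" where
  "one_form \<rho> = (\<lambda>I. \<Sum>i\<in>UNIV. \<rho> $ i * dvar i I)"

definition tame :: "S \<Rightarrow> S^4 \<Rightarrow> S^4 \<Rightarrow> bool" where
  "tame f \<rho>1 \<rho>2 \<longleftrightarrow>
     range (\<lambda>(a, b). \<lambda>I. a * one_form \<rho>1 I + b * one_form \<rho>2 I) =
     {\<omega>\<in>one_form ` AR f. wedge (wedge (one_form \<rho>1) (one_form \<rho>2)) \<omega> = (\<lambda>_. 0)}"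

section \<open>Free and nearly free surfaces\<close>

text \<open>The component of degree \<open>q\<close> of the graded free module \<open>\<Oplus>\<^sub>i S(s\<^sub>i)\<close>, where \<open>S(s)\<^sub>q = S\<^bsub>q+s\<^esub>\<close>.\<close>

definition twisted_grade :: "('n::finite \<Rightarrow> int) \<Rightarrow> int \<Rightarrow> (S^'n) set" where
  "twisted_grade s q = {v. \<forall>i. v $ i \<in> grade (q + s i)}"

definition graded_hom :: "('m::finite \<Rightarrow> int) \<Rightarrow> ('n::finite \<Rightarrow> int) \<Rightarrow> (S^'m \<Rightarrow> S^'n) \<Rightarrow> bool" where
  "graded_hom s t \<phi> \<longleftrightarrow> module_hom (*s) (*s) \<phi> \<and> (\<forall>q. \<phi> ` twisted_grade s q \<subseteq> twisted_grade t q)"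

text \<open>On the type \<open>3\<close> this is the family \<open>d\<^sub>1, d\<^sub>2, d\<^sub>3\<close>, on the type \<open>4\<close> it is \<open>d\<^sub>1, d\<^sub>2, d\<^sub>3, d\<^sub>3\<close>.\<close>

definition exps :: "int \<Rightarrow> int \<Rightarrow> int \<Rightarrow> 'n::{finite,numeral} \<Rightarrow> int" where
  "exps d1 d2 d3 j = (if j = 1 then d1 else if j = 2 then d2 else d3)"

definition free_surface :: "S \<Rightarrow> bool" where
  "free_surface f \<longleftrightarrow> (\<exists>d1 d2 d3. 0 < d1 \<and> d1 \<le> d2 \<and> d2 \<le> d3 \<and>
     (\<exists>\<phi> :: S^3 \<Rightarrow> S^4. module_hom (*s) (*s) \<phi> \<and> bij_betw \<phi> UNIV (AR f) \<and>
        (\<forall>q. \<phi> ` twisted_grade (\<lambda>j. - exps d1 d2 d3 j) q = AR_grade f q)))"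

text \<open>
  The maps \<open>\<phi>3\<close> and \<open>\<phi>2\<close> are the first two maps of the resolution
  \<open>0 \<rightarrow> S(-d-d\<^sub>3) \<rightarrow> \<Oplus>\<^sub>j S(-d-d\<^sub>j+1) \<rightarrow> S\<^sup>4(-d+1) \<rightarrow> S\<close>, whose last map is \<open>jac_map f\<close>, with
  cokernel \<open>M(f)\<close> and kernel \<open>AR(f)\<close>. Minimality: each map sends the free module into
  the irrelevant ideal times its target.
\<close>

definition nearly_free :: "S \<Rightarrow> int \<Rightarrow> int \<Rightarrow> int \<Rightarrow> int \<Rightarrow> bool" where
  "nearly_free f d d1 d2 d3 \<longleftrightarrow> 1 \<le> d1 \<and> d1 \<le> d2 \<and> d2 \<le> d3 \<and>
     (\<exists>(\<phi>3 :: S^1 \<Rightarrow> S^4) (\<phi>2 :: S^4 \<Rightarrow> S^4).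
        graded_hom (\<lambda>_. - d - d3) (\<lambda>j. - d - exps d1 d2 d3 j + 1) \<phi>3 \<and>
        graded_hom (\<lambda>j. - d - exps d1 d2 d3 j + 1) (\<lambda>_. - d + 1) \<phi>2 \<and>
        inj \<phi>3 \<and> range \<phi>3 = {v. \<phi>2 v = 0} \<and> range \<phi>2 = {v. jac_map f v = 0} \<and>
        (\<forall>v i. \<phi>3 v $ i \<in> irrelevant_ideal) \<and>
        (\<forall>v i. \<phi>2 v $ i \<in> irrelevant_ideal) \<and>
        (\<forall>v. jac_map f v \<in> irrelevant_ideal))"

end

theory Submission
  imports Defs "HOL-Computational_Algebra.Field_as_Ring" "HOL-Computational_Algebra.Polynomial_Factorial"
    "HOL-Computational_Algebra.Fundamental_Theorem_Algebra"
begin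

text \<open>
  The syzygies that are combinations of \<open>\<rho>\<^sub>1\<close> and \<open>\<rho>\<^sub>2\<close> are, by tameness, the kernel of the triple
  product \<open>\<rho> \<mapsto> \<rho>\<^sub>1 \<and> \<rho>\<^sub>2 \<and> \<rho>\<close> on \<open>AR(f)\<close>. Three syzygies are orthogonal to the gradient of \<open>f\<close>, and
  the partial derivatives have no common factor because the Hilbert polynomial of \<open>M(f)\<close> is linear;
  so the triple product is a multiple \<open>h\<close> of the gradient. This gives an exact sequence
  \<open>0 \<rightarrow> S(-e\<^sub>1) \<oplus> S(-e\<^sub>2) \<rightarrow> AR(f) \<rightarrow> I(-e\<^sub>3) \<rightarrow> 0\<close> with a homogeneous ideal \<open>I\<close>, and counting dimensions
  shows that \<open>S / I\<close> has a Hilbert polynomial of slope \<open>s\<^sub>1\<^sup>2 - s\<^sub>2 - deg \<Sigma> \<ge> 0\<close>.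

  If the slope is \<open>0\<close>, then \<open>I\<close> contains a nonzero form in any two of the variables, hence a product
  \<open>g\<close> of linear forms in \<open>x, y\<close> and a product \<open>h\<close> of linear forms in \<open>z, w\<close>. No associated prime of
  \<open>(g, h)\<close> contains \<open>I\<close>, so the cocycle of the extension is a coboundary on \<open>(g, h)\<close>, a syzygy maps to
  \<open>1 \<in> I\<close>, and \<open>D\<close> is free. Hence the slope is at least \<open>1\<close> when \<open>D\<close> is not free. If it is \<open>1\<close> and
  \<open>I\<close> has two generators, these can be chosen homogeneous; they form a complete intersection of degree
  \<open>1\<close>, so they are linear forms, and the resolution of \<open>I\<close> lifts to that of a nearly free surface.
\<close>

section \<open>Evaluation homomorphisms\<close>

text \<open>The extension class lives in Ext^1(I, S), which is isomorphic to Ext^2(S/I, S) and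
  vanishes when \<open>I\<close> has codimension at least three, that is, when the Hilbert function
  of \<open>S/I\<close> is bounded. This vanishing is made explicit: since \<open>g\<close> and
  \<open>h\<close> are products of linear forms in disjoint pairs of variables, their coprimality
  and the associated primes of \<open>(g, h)\<close> are computed by substitutions. Each such prime
  defines a line. Modulo it one variable of each pair survives, and a nonzero form of
  \<open>I\<close> in these two variables stays nonzero.

  The constant \<open>s1^2 - s2\<close> is the degree that the dimension count gives for
  \<open>I = S\<close>, where \<open>AR(f)\<close> is free with exponents \<open>e1, e2, e3\<close>.
  The \<open>1\<close> subtracted from it is the degree of a line, the scheme defined by
  \<open>I\<close> when \<open>I\<close> is generated by two independent linear forms.\<close>

abbreviation "look \<equiv> Poly_Mapping.lookup"
abbreviation "sing \<equiv> Poly_Mapping.single"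
abbreviation "keysof \<equiv> Poly_Mapping.keys"

definition rhom :: "('a::comm_ring_1 \<Rightarrow> 'b::comm_ring_1) \<Rightarrow> bool" where
  "rhom h \<longleftrightarrow> h 1 = 1 \<and> (\<forall>x y. h (x + y) = h x + h y) \<and> (\<forall>x y. h (x * y) = h x * h y)"

lemma rhom_simps:
  assumes "rhom h"
  shows "h 0 = 0" "h 1 = 1" "h (x + y) = h x + h y" "h (x * y) = h x * h y"
    "h (- x) = - h x" "h (x - y) = h x - h y" "h (x ^ n) = h x ^ n"
proof -
  show 1: "h 1 = 1" and 2: "\<And>x y. h (x + y) = h x + h y" and 3: "\<And>x y. h (x * y) = h x * h y"
    using assms by (auto simp: rhom_def)
  show 4: "h 0 = 0" using 2[of 0 0] by simp
  show 5: "h (- x) = - h x" for x using 2[of x "- x"] 4 by (simp add: eq_neg_iff_add_eq_0 add.commute)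
  show "h (x - y) = h x - h y" using 2[of x "- y"] 5 by simp
  show "h (x ^ n) = h x ^ n" by (induction n) (auto simp: 1 3)
qed

lemma rhom_sum: "rhom h \<Longrightarrow> h (\<Sum>i\<in>A. g i) = (\<Sum>i\<in>A. h (g i))"
  by (induction A rule: infinite_finite_induct) (auto simp: rhom_simps)

lemma rhom_comp: "rhom g \<Longrightarrow> rhom h \<Longrightarrow> rhom (\<lambda>x. g (h x))"
  by (auto simp: rhom_def)

lemma rhom_Const: "rhom Const"
  by (auto simp: rhom_def Const_def single_add mult_single)

lemmas Const_simps = rhom_simps[OF rhom_Const]

lemma Const_eq_iff [simp]: "Const a = Const b \<longleftrightarrow> a = b"
  unfolding Const_def by (meson inj_single injD)

lemma Const_eq_0_iff [simp]: "Const a = 0 \<longleftrightarrow> a = 0"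
  using Const_eq_iff[of a 0] by (simp add: Const_simps)

lemma Const_inverse: "c \<noteq> 0 \<Longrightarrow> Const (1 / c) * Const c = 1"
  by (simp flip: Const_simps(2,4))

lemma lookup_Const_mult: "look (Const c * p) m = c * look p m"
  unfolding Const_def by (simp add: map.rep_eq when_def flip: mult_map_scale_conv_mult)

lemma sum_single_lookup: "(\<Sum>m\<in>keysof p. sing m (look p m)) = p"
  by (rule poly_mapping_eqI) (simp add: lookup_sum lookup_single when_def in_keys_iff)

lemma sum_single_lookup_superset:
  assumes "finite A" "keysof p \<subseteq> A"
  shows "(\<Sum>m\<in>A. sing m (look p m)) = p"
  by (rule poly_mapping_eqI)
    (use assms in \<open>auto simp: lookup_sum lookup_single when_def in_keys_iff\<close>)

lemma Var_power: "Var i ^ n = sing (sing i n) 1"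
proof (induction n)
  case (Suc n)
  then show ?case by (simp add: Var_def mult_single flip: single_add)
qed simp

lemma single_eq_Const_Vars: "sing m c = Const c * (\<Prod>i\<in>UNIV. Var i ^ look m i)"
proof -
  have "(\<Prod>i\<in>A. Var i ^ look m i) = sing (\<Sum>i\<in>A. sing i (look m i)) 1" if "finite A" for A
    using that by (induction A) (auto simp: Var_power mult_single)
  from this[of UNIV] show ?thesis
    by (simp add: Const_def mult_single sum_single_lookup_superset)
qed

text \<open>Constants and variables generate \<open>S\<close> as a ring. Identities between ring
  homomorphisms, the product rule and the chain rule are reduced to these generators by this
  rule.\<close>

lemma S_induct [case_names Const Var add mult]:
  assumes c: "\<And>c. P (Const c)" and v: "\<And>i. P (Var i)"
    and a: "\<And>p q. P p \<Longrightarrow> P q \<Longrightarrow> P (p + q)" and m: "\<And>p q. P p \<Longrightarrow> P q \<Longrightarrow> P (p * q)"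
  shows "P p"
proof -
  have P0: "P 0" and P1: "P 1" using c[of 0] c[of 1] by (auto simp: Const_simps)
  have pw: "P (Var i ^ n)" for i n by (induction n) (auto intro: P1 v m)
  have "P (\<Prod>i\<in>A. Var i ^ g i)" for A g
    by (induction A rule: infinite_finite_induct) (auto intro: P1 m pw)
  then have s: "P (sing m c)" for m c by (subst single_eq_Const_Vars) (auto intro: m c)
  have "P (\<Sum>m\<in>A. sing m (look p m))" for A
    by (induction A rule: infinite_finite_induct) (auto intro: P0 a s)
  then show ?thesis by (metis sum_single_lookup)
qed

lemma rhom_S_eqI:
  assumes "rhom g" "rhom h" "\<And>c. g (Const c) = h (Const c)" "\<And>i. g (Var i) = h (Var i)"
  shows "g p = h p"
  by (induction p rule: S_induct) (auto simp: assms rhom_simps[OF assms(1)] rhom_simps[OF assms(2)])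

text \<open>The universal property of \<open>S\<close>. It is used with values in iterated
  polynomials, in \<open>S\<close> itself (substitutions) and in the complex numbers (value at the
  origin).\<close>

definition ev :: "(complex \<Rightarrow> 'a::comm_ring_1) \<Rightarrow> (4 \<Rightarrow> 'a) \<Rightarrow> S \<Rightarrow> 'a" where
  "ev c t p = (\<Sum>m\<in>keysof p. c (look p m) * (\<Prod>i\<in>UNIV. t i ^ look m i))"

lemma ev_superset:
  assumes "rhom c" "finite A" "keysof p \<subseteq> A"
  shows "ev c t p = (\<Sum>m\<in>A. c (look p m) * (\<Prod>i\<in>UNIV. t i ^ look m i))"
  unfolding ev_def
  by (rule sum.mono_neutral_left) (use assms in \<open>auto simp: in_keys_iff rhom_simps\<close>)

lemma ev_single:
  assumes "rhom c"
  shows "ev c t (sing m a) = c a * (\<Prod>i\<in>UNIV. t i ^ look m i)"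
  by (subst ev_superset[OF assms, of "{m}"]) auto

lemma ev_add:
  assumes "rhom c"
  shows "ev c t (p + q) = ev c t p + ev c t q"
proof -
  let ?A = "keysof p \<union> keysof q"
  have "keysof (p + q) \<subseteq> ?A" by (rule keys_add)
  then show ?thesis
    by (simp add: ev_superset[OF assms, of ?A] lookup_add rhom_simps[OF assms] ring_distribs sum.distrib)
qed

lemma rhom_ev:
  assumes "rhom c"
  shows "rhom (ev c t)"
proof -
  note add = ev_add[OF assms]
  have zero: "ev c t 0 = 0" by (simp add: ev_def)
  have sum: "ev c t (sum g A) = (\<Sum>i\<in>A. ev c t (g i))" for A and g :: "mon \<Rightarrow> S"
    by (induction A rule: infinite_finite_induct) (auto simp: zero add)
  have mono: "ev c t (sing m a * sing n b) = ev c t (sing m a) * ev c t (sing n b)" for m n a b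
    by (simp add: mult_single ev_single[OF assms] rhom_simps[OF assms] lookup_add power_add prod.distrib)
  have mult: "ev c t (p * q) = ev c t p * ev c t q" for p q
  proof -
    have "ev c t (p * q) = ev c t ((\<Sum>m\<in>keysof p. sing m (look p m)) * (\<Sum>n\<in>keysof q. sing n (look q n)))"
      by (simp add: sum_single_lookup)
    also have "\<dots> = (\<Sum>m\<in>keysof p. ev c t (sing m (look p m))) * (\<Sum>n\<in>keysof q. ev c t (sing n (look q n)))"
      unfolding sum_product by (simp add: sum mono)
    also have "\<dots> = ev c t p * ev c t q"
      by (simp add: sum_single_lookup flip: sum)
    finally show ?thesis .
  qed
  have one: "ev c t 1 = 1" using ev_single[OF assms, of t 0 1] by (simp add: rhom_simps[OF assms])
  show ?thesis using one mult add by (auto simp: rhom_def)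
qed

lemma ev_Const: "rhom c \<Longrightarrow> ev c t (Const a) = c a"
  unfolding Const_def by (simp add: ev_single)

lemma ev_Var:
  assumes "rhom c"
  shows "ev c t (Var i) = t i"
proof -
  have "(\<Prod>j\<in>UNIV. t j ^ look (sing i 1) j) = (\<Prod>j\<in>UNIV. if j = i then t j else 1)"
    by (rule prod.cong) (auto simp: lookup_single when_def)
  then show ?thesis unfolding Var_def by (simp add: ev_single assms rhom_simps)
qed

section \<open>Greatest common divisors\<close>

lemma rhom_const_poly: "rhom h \<Longrightarrow> rhom (\<lambda>x. [:h x:])"
  by (auto simp: rhom_def one_pCons)

lemma rhom_poly_map_poly:
  assumes "rhom h"
  shows "rhom (\<lambda>p. poly (map_poly h p) x)"
proof -
  note h = rhom_simps[OF assms]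
  have pc: "poly (map_poly h (pCons a p)) x = h a + x * poly (map_poly h p) x" for a p
    by (cases "a = 0 \<and> p = 0") (auto simp: map_poly_pCons h)
  have add: "poly (map_poly h (p + q)) x = poly (map_poly h p) x + poly (map_poly h q) x" for p q
    by (induction p q rule: poly_induct2) (simp_all add: pc h algebra_simps)
  have sm: "poly (map_poly h (smult a p)) x = h a * poly (map_poly h p) x" for a p
    by (induction p) (simp_all add: pc h algebra_simps)
  have "poly (map_poly h (p * q)) x = poly (map_poly h p) x * poly (map_poly h q) x" for p q
    by (induction p) (simp_all add: pc h algebra_simps add sm)
  then show ?thesis using add pc[of 1 0] by (auto simp: rhom_def h one_pCons)
qed

text \<open>The range of \<open>h\<close> is a subring, so it contains every polynomial expression
  in the images of the constants and of the indeterminate. This peels off one of the four nested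
  indeterminates at a time.\<close>

lemma range_rhom_poly:
  assumes "rhom h" "rhom c" "\<And>a. c [:a:] \<in> range h" "c [:0, 1:] \<in> range h"
  shows "c p \<in> range h"
proof (induction p)
  case 0
  show ?case using rhom_simps(1)[OF assms(1)] rhom_simps(1)[OF assms(2)] by (metis rangeI)
next
  case (pCons a p)
  obtain u v w where "c [:a:] = h u" "c [:0, 1:] = h v" "c p = h w" using assms pCons by (metis rangeE)
  moreover have "pCons a p = [:a:] + [:0, 1:] * p" by simp
  then have "c (pCons a p) = c [:a:] + c [:0, 1:] * c p" by (simp only: rhom_simps(3,4)[OF assms(2)])
  ultimately have "c (pCons a p) = h (u + v * w)" by (simp add: rhom_simps(3,4)[OF assms(1)])
  then show ?case by blast
qed

text \<open>Unique factorization in \<open>S\<close> is transferred from iterated univariate polynomials, for which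
  the library provides greatest common divisors.\<close>

type_synonym poly4 = "complex poly poly poly poly"

definition to_poly4 :: "S \<Rightarrow> poly4" where
  "to_poly4 = ev (\<lambda>a. [:[:[:[:a:]:]:]:])
     (\<lambda>i. if i = 1 then [:0, 1:] else if i = 2 then [:[:0, 1:]:] else if i = 3 then [:[:[:0, 1:]:]:]
          else [:[:[:[:0, 1:]:]:]:])"

lemma rhom_to_poly4: "rhom to_poly4"
  unfolding to_poly4_def by (intro rhom_ev rhom_const_poly) (simp add: rhom_def)

lemma to_poly4_Const: "to_poly4 (Const a) = [:[:[:[:a:]:]:]:]"
  unfolding to_poly4_def by (intro ev_Const rhom_const_poly) (simp add: rhom_def)

lemma to_poly4_Var: "to_poly4 (Var i) = (if i = 1 then [:0, 1:] else if i = 2 then [:[:0, 1:]:]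
    else if i = 3 then [:[:[:0, 1:]:]:] else [:[:[:[:0, 1:]:]:]:])"
  unfolding to_poly4_def by (intro ev_Var rhom_const_poly) (simp add: rhom_def)

lemma bij_to_poly4: "bij to_poly4"
proof (rule bijI)
  \<comment> \<open>The left inverse evaluates the outermost indeterminate at \<open>Var 1\<close>
    and the innermost at \<open>Var 4\<close>.\<close>
  define B :: "poly4 \<Rightarrow> S" where "B = (\<lambda>q. poly (map_poly (\<lambda>q. poly (map_poly (\<lambda>q. poly (map_poly
    (\<lambda>q. poly (map_poly Const q) (Var 4)) q) (Var 3)) q) (Var 2)) q) (Var 1))"
  have B: "rhom B" unfolding B_def by (intro rhom_poly_map_poly rhom_Const)
  have mc: "map_poly h [:a:] = [:h a:]" "map_poly h [:0, 1:] = [:0, 1:]" "h 0 = 0" "h 1 = 1"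
    if "rhom h" for h :: "'a::comm_ring_1 \<Rightarrow> 'b::comm_ring_1" and a
    using rhom_simps[OF that] by (simp_all add: map_poly_pCons)
  note p = rhom_poly_map_poly
  note r = rhom_Const p[OF rhom_Const] p[OF p[OF rhom_Const]] p[OF p[OF p[OF rhom_Const]]]
  note m = mc[OF r(1)] mc[OF r(2)] mc[OF r(3)] mc[OF r(4)]
  have "B (to_poly4 p) = p" for p
  proof (rule rhom_S_eqI[of "\<lambda>p. B (to_poly4 p)" "\<lambda>p. p"])
    show "rhom (\<lambda>p. B (to_poly4 p))" by (rule rhom_comp[OF B rhom_to_poly4])
    show "rhom (\<lambda>p::S. p)" by (simp add: rhom_def)
    show "B (to_poly4 (Const c)) = Const c" for c
      unfolding to_poly4_Const B_def by (simp add: m)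
    show "B (to_poly4 (Var i)) = Var i" for i
      unfolding to_poly4_Var B_def using exhaust_4[of i] by (auto simp: m)
  qed
  then show "inj to_poly4" by (metis injI)
  have cR: "[:[:[:[:a:]:]:]:] \<in> range to_poly4" for a by (metis to_poly4_Const rangeI)
  have XR: "[:0, 1:] \<in> range to_poly4" "[:[:0, 1:]:] \<in> range to_poly4"
    "[:[:[:0, 1:]:]:] \<in> range to_poly4" "[:[:[:[:0, 1:]:]:]:] \<in> range to_poly4"
    using rangeI[of to_poly4 "Var 1"] rangeI[of to_poly4 "Var 2"]
      rangeI[of to_poly4 "Var 3"] rangeI[of to_poly4 "Var 4"]
    unfolding to_poly4_Var by simp_all
  have i: "rhom (\<lambda>x. x)" by (simp add: rhom_def)
  note c = rhom_const_poly and r = range_rhom_poly[OF rhom_to_poly4]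
  have "[:[:[:q:]:]:] \<in> range to_poly4" for q by (rule r[OF c[OF c[OF c[OF i]]] cR XR(4)])
  then have "[:[:q:]:] \<in> range to_poly4" for q by (rule r[OF c[OF c[OF i]] _ XR(3)])
  then have "[:q:] \<in> range to_poly4" for q by (rule r[OF c[OF i] _ XR(2)])
  then have "q \<in> range to_poly4" for q by (rule r[OF i _ XR(1)])
  then show "surj to_poly4" by blast
qed

text \<open>Division by the gcd leaves a vector \<open>F'\<close> whose entries have unit gcd. If
  \<open>A\<close> is proportional to \<open>F'\<close>, then \<open>F' k\<close> divides
  \<open>A k * F' j\<close> for all \<open>j\<close>, hence \<open>A k\<close> times that unit. The
  quotient serves for every index because \<open>F' k\<close> is nonzero and cancels.\<close>

lemma poly4_gcd_vector:
  fixes F :: "'i::finite \<Rightarrow> poly4"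
  assumes "F k \<noteq> 0"
  obtains g F' where "\<And>i. F i = g * F' i"
    "\<And>A. (\<And>i j. A i * F' j = A j * F' i) \<Longrightarrow> \<exists>h. \<forall>i. A i = h * F' i"
proof -
  define g where "g = Gcd (range F)"
  have g0: "g \<noteq> 0" using assms by (auto simp: g_def Gcd_0_iff)
  have "g dvd F i" for i by (simp add: g_def Gcd_dvd)
  then have "\<forall>i. \<exists>h. F i = g * h" by (blast elim: dvdE)
  then obtain F' where F': "\<And>i. F i = g * F' i" using choice[of "\<lambda>i h. F i = g * h"] by blast
  have "range F = (*) g ` range F'" using F' by auto
  then have "Gcd (range F) = Gcd ((*) g ` range F')" by simp
  then have "g = normalize (g * Gcd (range F'))" unfolding g_def by (simp only: Gcd_mult)
  then have "g * Gcd (range F') dvd g * 1" by (metis dvd_refl mult.right_neutral normalize_dvd_iff dvd_normalize_iff)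
  then have G1: "is_unit (Gcd (range F'))" using g0 by (subst (asm) dvd_mult_cancel_left) auto
  have "\<exists>h. \<forall>i. A i = h * F' i" if A: "\<And>i j. A i * F' j = A j * F' i" for A
  proof -
    have nz: "F' k \<noteq> 0" using F' assms by auto
    have "F' k dvd A k * F' j" for j by (metis A dvd_triv_right)
    then have "F' k dvd Gcd ((*) (A k) ` range F')" by (auto intro: Gcd_greatest)
    then have "F' k dvd A k" by (simp add: Gcd_mult dvd_mult_unit_iff[OF G1])
    then obtain h where h: "A k = h * F' k" by (metis dvdE mult.commute)
    have "A i = h * F' i" for i
    proof -
      have "F' k * A i = F' k * (h * F' i)" using A[of i k] h by (simp add: ac_simps)
      then show ?thesis using nz by simp
    qed
    then show ?thesis by blast
  qed
  then show ?thesis using that F' by blast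
qed

lemma S_gcd_vector:
  fixes F :: "S^4"
  assumes "F \<noteq> 0"
  obtains g F' where "F = g *s F'"
    "\<And>A. (\<And>i j. A $ i * F' $ j = A $ j * F' $ i) \<Longrightarrow> \<exists>h. A = h *s F'"
proof -
  note R = rhom_to_poly4 and b = bij_to_poly4
  obtain k where "F $ k \<noteq> 0" using assms by (auto simp: vec_eq_iff)
  then have "to_poly4 (F $ k) \<noteq> 0"
    using bij_is_inj[OF b] rhom_simps(1)[OF R] by (metis injD)
  then obtain g G where g: "\<And>i. to_poly4 (F $ i) = g * G i"
    and G: "\<And>A. (\<And>i j. A i * G j = A j * G i) \<Longrightarrow> \<exists>h. \<forall>i. A i = h * G i"
    using poly4_gcd_vector[of "\<lambda>i. to_poly4 (F $ i)" k] by metis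
  have surj: "\<exists>p. to_poly4 p = q" for q using bij_is_surj[OF b] by (metis surjD)
  have inj: "p = q" if "to_poly4 p = to_poly4 q" for p q using bij_is_inj[OF b] that by (metis injD)
  obtain g' where g': "to_poly4 g' = g" using surj by blast
  obtain F' where F': "\<And>i. to_poly4 (F' i) = G i" using choice[of "\<lambda>i p. to_poly4 p = G i"] surj by blast
  show ?thesis
  proof (rule that[of g' "\<chi> i. F' i"])
    show "F = g' *s (\<chi> i. F' i)"
      by (auto simp: vec_eq_iff intro!: inj simp: rhom_simps[OF R] g g' F')
    fix A :: "S^4" assume *: "\<And>i j. A $ i * (\<chi> i. F' i) $ j = A $ j * (\<chi> i. F' i) $ i"
    have "to_poly4 (A $ i) * G j = to_poly4 (A $ j) * G i" for i j
      using arg_cong[OF *[of i j], of to_poly4] by (simp add: rhom_simps[OF R] F')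
    then obtain h where h: "\<And>i. to_poly4 (A $ i) = h * G i" using G[of "\<lambda>i. to_poly4 (A $ i)"] by auto
    obtain h' where "to_poly4 h' = h" using surj by blast
    then have "A = h' *s (\<chi> i. F' i)"
      by (auto simp: vec_eq_iff intro!: inj simp: rhom_simps[OF R] h F')
    then show "\<exists>h. A = h *s (\<chi> i. F' i)" by blast
  qed
qed

text \<open>The pair is padded by zeros to a vector of length four. Coprimality of \<open>p'\<close>
  and \<open>q'\<close> is expressed by their syzygies, the form in which it is applied.\<close>

lemma S_gcd_pair:
  fixes p q :: S
  assumes "p \<noteq> 0 \<or> q \<noteq> 0"
  obtains g p' q' where "p = g * p'" "q = g * q'"
    "\<And>a b. a * q' = b * p' \<Longrightarrow> \<exists>s. a = s * p' \<and> b = s * q'"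
proof -
  define F :: "S^4" where "F = (\<chi> i. if i = 1 then p else if i = 2 then q else 0)"
  have "F \<noteq> 0" using assms by (auto simp: F_def vec_eq_iff forall_4)
  then obtain g F' where g: "F = g *s F'"
    and A: "\<And>A. (\<And>i j. A $ i * F' $ j = A $ j * F' $ i) \<Longrightarrow> \<exists>h. A = h *s F'"
    using S_gcd_vector by blast
  from g have *: "p = g * F' $ 1" "q = g * F' $ 2" "0 = g * F' $ 3" "0 = g * F' $ 4"
    by (auto simp: F_def vec_eq_iff forall_4)
  then have "F' $ 3 = 0" "F' $ 4 = 0" using assms by auto
  then have z: "F' $ i = 0" if "i \<noteq> 1" "i \<noteq> 2" for i using that exhaust_4[of i] by auto
  show ?thesis
  proof (rule that[OF *(1,2)])
    fix a b assume ab: "a * F' $ 2 = b * F' $ 1"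
    have "\<exists>h. (\<chi> i. if i = 1 then a else if i = 2 then b else 0) = h *s F'"
      using ab z by (intro A) auto
    then show "\<exists>s. a = s * F' $ 1 \<and> b = s * F' $ 2" by (auto simp: vec_eq_iff forall_4)
  qed
qed

section \<open>Homogeneous components\<close>

lemma mdeg_add: "mdeg (m + n) = mdeg m + mdeg n"
  by (simp add: mdeg_def lookup_add sum.distrib)

lemma mdeg_eq_0_iff: "mdeg m = 0 \<longleftrightarrow> m = 0"
  by (auto simp: mdeg_def poly_mapping_eq_iff fun_eq_iff)

lemma mdeg_single: "mdeg (sing i n) = n"
  by (simp add: mdeg_def lookup_single when_def)

lemma grade_iff: "p \<in> grade k \<longleftrightarrow> (\<forall>m. look p m \<noteq> 0 \<longrightarrow> int (mdeg m) = k)"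
  by (auto simp: grade_def in_keys_iff)

lemma grade_0 [simp]: "0 \<in> grade k"
  by (simp add: grade_iff)

lemma grade_add: "p \<in> grade k \<Longrightarrow> q \<in> grade k \<Longrightarrow> p + q \<in> grade k"
  unfolding grade_iff lookup_add by (metis add.left_neutral)

lemma grade_uminus: "p \<in> grade k \<Longrightarrow> - p \<in> grade k"
  by (simp add: grade_iff)

lemma grade_diff: "p \<in> grade k \<Longrightarrow> q \<in> grade k \<Longrightarrow> p - q \<in> grade k"
  unfolding grade_iff lookup_minus by (metis diff_self)

lemma grade_sum: "(\<And>i. i \<in> A \<Longrightarrow> g i \<in> grade k) \<Longrightarrow> sum g A \<in> grade k"
  by (induction A rule: infinite_finite_induct) (auto intro: grade_add)

lemma grade_mult:
  assumes "p \<in> grade j" "q \<in> grade k"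
  shows "p * q \<in> grade (j + k)"
  unfolding grade_def
proof safe
  fix m assume "m \<in> keysof (p * q)"
  then obtain a b where "m = a + b" "a \<in> keysof p" "b \<in> keysof q" using keys_mult[of p q] by blast
  then show "int (mdeg m) = j + k" using assms by (auto simp: grade_def mdeg_add)
qed

lemma single_grade: "int (mdeg m) = k \<Longrightarrow> sing m c \<in> grade k"
  by (auto simp: grade_def)

lemma Const_grade: "Const c \<in> grade 0"
  unfolding Const_def by (rule single_grade) (simp add: mdeg_def)

lemma Var_grade: "Var i \<in> grade 1"
  unfolding Var_def by (rule single_grade) (simp add: mdeg_single)

lemma one_grade: "1 \<in> grade 0"
  using Const_grade[of 1] by (simp add: Const_simps)

lemma grade_Const_mult: "p \<in> grade k \<Longrightarrow> Const c * p \<in> grade k"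
  using grade_mult[OF Const_grade] by simp

lemma grade_power: "p \<in> grade k \<Longrightarrow> p ^ n \<in> grade (int n * k)"
proof (induction n)
  case (Suc n)
  then show ?case using grade_mult[OF Suc.prems Suc.IH[OF Suc.prems]] by (simp add: algebra_simps)
qed (simp add: one_grade)

lemma grade_neg: "p \<in> grade k \<Longrightarrow> k < 0 \<Longrightarrow> p = 0"
  by (rule poly_mapping_eqI) (force simp: grade_iff)

lemma grade_zero_Const: "p \<in> grade 0 \<Longrightarrow> p = Const (look p 0)"
  by (rule poly_mapping_eqI) (auto simp: grade_iff Const_def lookup_single when_def mdeg_eq_0_iff)

text \<open>Such a \<open>g\<close> is a nonzero constant. Common factors are shown to be invertible
  in this way once positive degree has been excluded.\<close>

lemma homogeneous_unit:
  assumes "g \<in> grade c" "g \<noteq> 0" "\<not> 0 < c"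
  shows "\<exists>r. r * g = 1"
proof -
  have "c = 0" using grade_neg[OF assms(1)] assms(2,3) by fastforce
  then obtain u where u: "g = Const u" using grade_zero_Const assms(1) by blast
  then have "u \<noteq> 0" using assms(2) by (simp add: Const_simps(1))
  then show ?thesis unfolding u using Const_inverse by blast
qed

lemma irrelevant_grade: "p \<in> grade k \<Longrightarrow> 0 < k \<Longrightarrow> p \<in> irrelevant_ideal"
  by (force simp: irrelevant_ideal_def grade_iff mdeg_def)

definition hc :: "int \<Rightarrow> S \<Rightarrow> S" where
  "hc k p = (\<Sum>m\<in>{m\<in>keysof p. int (mdeg m) = k}. sing m (look p m))"

definition degs :: "S \<Rightarrow> int set" where
  "degs p = (\<lambda>m. int (mdeg m)) ` keysof p"

lemma lookup_hc: "look (hc k p) m = (if int (mdeg m) = k then look p m else 0)"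
  unfolding hc_def by (simp add: lookup_sum lookup_single when_def in_keys_iff)

lemma hc_grade: "hc k p \<in> grade k"
  by (auto simp: grade_iff lookup_hc)

lemma hc_add: "hc k (p + q) = hc k p + hc k q"
  by (rule poly_mapping_eqI) (auto simp: lookup_hc lookup_add)

lemma hc_0 [simp]: "hc k 0 = 0"
  by (rule poly_mapping_eqI) (auto simp: lookup_hc)

lemma hc_sum: "hc k (sum g A) = (\<Sum>i\<in>A. hc k (g i))"
  by (induction A rule: infinite_finite_induct) (auto simp: hc_add)

lemma hc_of_grade: "p \<in> grade j \<Longrightarrow> hc k p = (if j = k then p else 0)"
  by (rule poly_mapping_eqI) (auto simp: lookup_hc grade_iff)

lemma grade_hc_iff: "p \<in> grade k \<longleftrightarrow> hc k p = p"
  using hc_grade[of k p] hc_of_grade[of p k k] by auto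

lemma finite_degs [simp]: "finite (degs p)"
  by (simp add: degs_def)

lemma degs_eq_empty_iff: "degs p = {} \<longleftrightarrow> p = 0"
  by (simp add: degs_def)

lemma hc_eq_0_iff: "hc k p = 0 \<longleftrightarrow> k \<notin> degs p"
  by (auto simp: poly_mapping_eq_iff fun_eq_iff lookup_hc degs_def in_keys_iff)

lemma sum_hc:
  assumes "finite K" "degs p \<subseteq> K"
  shows "(\<Sum>k\<in>K. hc k p) = p"
proof (rule poly_mapping_eqI)
  fix m
  show "look (\<Sum>k\<in>K. hc k p) m = look p m"
    using assms by (auto simp: lookup_sum lookup_hc degs_def in_keys_iff image_subset_iff)
qed

lemma hc_mult: "hc k (p * q) = (\<Sum>i\<in>degs p. hc i p * hc (k - i) q)"
proof -
  have 1: "hc k (hc i p * q) = hc i p * hc (k - i) q" for i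
  proof -
    have "hc k (hc i p * q) = hc k (hc i p * (\<Sum>j\<in>insert (k - i) (degs q). hc j q))"
      by (subst sum_hc) auto
    also have "\<dots> = (\<Sum>j\<in>insert (k - i) (degs q). hc k (hc i p * hc j q))"
      by (simp only: sum_distrib_left hc_sum)
    also have "\<dots> = (\<Sum>j\<in>insert (k - i) (degs q). if j = k - i then hc i p * hc (k - i) q else 0)"
      by (rule sum.cong) (auto simp: hc_of_grade[OF grade_mult[OF hc_grade hc_grade]])
    finally show ?thesis by simp
  qed
  have "hc k (p * q) = hc k ((\<Sum>i\<in>degs p. hc i p) * q)"
    by (subst sum_hc) auto
  then show ?thesis by (simp only: sum_distrib_right hc_sum 1)
qed

lemma hc_mult_grade:
  assumes "p \<in> grade j"
  shows "hc k (p * q) = p * hc (k - j) q"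
proof (cases "p = 0")
  case False
  have "degs p \<subseteq> {j}" using assms by (auto simp: degs_def grade_def)
  then have "degs p = {j}" using False degs_eq_empty_iff by blast
  then show ?thesis using assms by (simp add: hc_mult grade_hc_iff)
qed simp

lemma hc_Const_mult: "hc k (Const c * p) = Const c * hc k p"
  using hc_mult_grade[OF Const_grade] by simp

lemma hc_mult_grade_right: "p \<in> grade j \<Longrightarrow> hc k (q * p) = hc (k - j) q * p"
  using hc_mult_grade[of p j k q] by (simp add: mult.commute)

text \<open>The top components of \<open>p\<close> and \<open>q\<close> multiply to a nonzero
  component of the product, and so do the bottom ones. Both lie in degree \<open>k\<close>, so top
  and bottom degrees coincide.\<close>

lemma grade_factor:
  assumes "p * q \<in> grade k" "p \<noteq> 0" "q \<noteq> 0"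
  shows "\<exists>j. p \<in> grade j"
proof -
  have ne: "degs p \<noteq> {}" "degs q \<noteq> {}" using assms by (auto simp: degs_eq_empty_iff)
  have nz: "hc i p \<noteq> 0" if "i \<in> degs p" for i using that by (simp add: hc_eq_0_iff)
  have nz': "hc i q \<noteq> 0" if "i \<in> degs q" for i using that by (simp add: hc_eq_0_iff)
  \<comment> \<open>If no other pair of degrees sums to \<open>a + b\<close>, the component of the
    product in that degree is a single product of nonzero factors.\<close>
  have hit: "a + b = k" if ab: "a \<in> degs p" "b \<in> degs q"
    and others: "\<And>i. i \<in> degs p \<Longrightarrow> i \<noteq> a \<Longrightarrow> a + b - i \<notin> degs q" for a b
  proof -
    have "hc (a + b) (p * q) = (\<Sum>i\<in>degs p. if i = a then hc a p * hc b q else 0)"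
      unfolding hc_mult by (rule sum.cong) (use others in \<open>auto simp: hc_eq_0_iff\<close>)
    also have "\<dots> \<noteq> 0" using ab nz nz' by simp
    finally show ?thesis using hc_of_grade[OF assms(1), of "a + b"] by presburger
  qed
  have "Max (degs p) + Max (degs q) = k"
  proof (rule hit)
    fix i assume i: "i \<in> degs p" "i \<noteq> Max (degs p)"
    then have "i < Max (degs p)" by (simp add: le_neq_trans)
    then show "Max (degs p) + Max (degs q) - i \<notin> degs q"
      using Max_ge[OF finite_degs, of "Max (degs p) + Max (degs q) - i" q] by linarith
  qed (use ne in auto)
  moreover have "Min (degs p) + Min (degs q) = k"
  proof (rule hit)
    fix i assume i: "i \<in> degs p" "i \<noteq> Min (degs p)"
    then have "Min (degs p) < i" by (metis Min_le finite_degs order_le_neq_trans)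
    then show "Min (degs p) + Min (degs q) - i \<notin> degs q"
      using Min_le[OF finite_degs, of "Min (degs p) + Min (degs q) - i" q] by linarith
  qed (use ne in auto)
  moreover have "Min (degs p) \<le> Max (degs p)" "Min (degs q) \<le> Max (degs q)"
    using ne by (auto intro: Max_ge Min_in)
  ultimately have eq: "Min (degs p) = Max (degs p)" by linarith
  have "i = Max (degs p)" if "i \<in> degs p" for i
    using Min_le[OF finite_degs that] Max_ge[OF finite_degs that] eq by simp
  then have "p \<in> grade (Max (degs p))" by (auto simp: grade_def degs_def)
  then show ?thesis by blast
qed

section \<open>Homogeneous components of vectors in twisted free modules\<close>

definition hcv :: "('n::finite \<Rightarrow> int) \<Rightarrow> int \<Rightarrow> S^'n \<Rightarrow> S^'n" where
  "hcv s q v = (\<chi> i. hc (q + s i) (v $ i))"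

lemma hcv_nth [simp]: "hcv s q v $ i = hc (q + s i) (v $ i)"
  by (simp add: hcv_def)

lemma hcv_grade: "hcv s q v \<in> twisted_grade s q"
  by (simp add: twisted_grade_def hc_grade)

lemma twisted_grade_hcv_iff: "v \<in> twisted_grade s q \<longleftrightarrow> hcv s q v = v"
  by (simp add: twisted_grade_def vec_eq_iff grade_hc_iff)

lemma hcv_of_grade: "v \<in> twisted_grade s j \<Longrightarrow> hcv s q v = (if j = q then v else 0)"
proof -
  assume "v \<in> twisted_grade s j"
  then have "hc (q + s i) (v $ i) = (if j = q then v $ i else 0)" for i
    using hc_of_grade[of "v $ i" "j + s i" "q + s i"] by (simp add: twisted_grade_def)
  then show ?thesis by (simp add: vec_eq_iff)
qed

lemma hcv_add: "hcv s q (v + w) = hcv s q v + hcv s q w"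
  by (simp add: vec_eq_iff hc_add)

lemma hcv_0 [simp]: "hcv s q 0 = 0"
  by (simp add: vec_eq_iff)

lemma hcv_sum: "hcv s q (sum g A) = (\<Sum>i\<in>A. hcv s q (g i))"
  by (induction A rule: infinite_finite_induct) (auto simp: hcv_add)

lemma hcv_smult: "w \<in> twisted_grade s j \<Longrightarrow> hcv s q (p *s w) = hc (q - j) p *s w"
proof -
  assume "w \<in> twisted_grade s j"
  then have "hc (q + s i) (p * w $ i) = hc (q - j) p * w $ i" for i
    using hc_mult_grade_right[of "w $ i" "j + s i" "q + s i" p] by (simp add: twisted_grade_def)
  then show ?thesis by (simp add: vec_eq_iff)
qed

text \<open>The statement allows every larger finite set of degrees, so that a degree of interest
  can be inserted without knowing whether it occurs.\<close>

lemma sum_hcv: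
  obtains Q where "finite Q" "\<And>Q'. finite Q' \<Longrightarrow> Q \<subseteq> Q' \<Longrightarrow> (\<Sum>q\<in>Q'. hcv s q v) = v"
proof (rule that[of "\<Union>i. (\<lambda>k. k - s i) ` degs (v $ i)"])
  fix Q' assume Q': "finite Q'" "(\<Union>i. (\<lambda>k. k - s i) ` degs (v $ i)) \<subseteq> Q'"
  have "(\<Sum>q\<in>Q'. hc (q + s i) (v $ i)) = v $ i" for i
  proof -
    have "(\<Sum>q\<in>Q'. hc (q + s i) (v $ i)) = (\<Sum>k\<in>(\<lambda>q. q + s i) ` Q'. hc k (v $ i))"
      by (subst sum.reindex) (auto simp: inj_on_def)
    also have "\<dots> = v $ i"
    proof (rule sum_hc)
      show "degs (v $ i) \<subseteq> (\<lambda>q. q + s i) ` Q'"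
      proof
        fix k assume "k \<in> degs (v $ i)"
        then have "k - s i \<in> Q'" using Q' by blast
        then show "k \<in> (\<lambda>q. q + s i) ` Q'" by (rule rev_image_eqI) simp
      qed
    qed (use Q' in simp)
    finally show ?thesis .
  qed
  then show "(\<Sum>q\<in>Q'. hcv s q v) = v" by (simp add: vec_eq_iff)
qed auto

lemma module_S: "module ((*) :: S \<Rightarrow> S \<Rightarrow> S)"
  by standard (simp_all add: algebra_simps)

lemma module_Sn: "module ((*s) :: S \<Rightarrow> S^'n \<Rightarrow> S^'n)"
  by standard (simp_all add: vec_eq_iff algebra_simps)

interpretation SM: module "(*) :: S \<Rightarrow> S \<Rightarrow> S" by (rule module_S)
interpretation SnM: module "(*s) :: S \<Rightarrow> S^'n \<Rightarrow> S^'n" by (rule module_Sn)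

lemma hom_Sn_simps:
  assumes "module_hom ((*s) :: S \<Rightarrow> S^'m \<Rightarrow> S^'m) ((*s) :: S \<Rightarrow> S^'n \<Rightarrow> S^'n) \<phi>"
  shows "\<phi> (v + w) = \<phi> v + \<phi> w" "\<phi> (p *s v) = p *s \<phi> v" "\<phi> 0 = 0" "\<phi> (v - w) = \<phi> v - \<phi> w"
    "\<phi> (sum g A) = (\<Sum>i\<in>A. \<phi> (g i))"
  using module_hom.add[OF assms] module_hom.scale[OF assms] module_hom.zero[OF assms]
    module_hom.diff[OF assms] module_hom.sum[OF assms] by auto

lemma hom_SnI:
  fixes \<phi> :: "S^'m \<Rightarrow> S^'n"
  assumes "\<And>v w. \<phi> (v + w) = \<phi> v + \<phi> w" "\<And>p v. \<phi> (p *s v) = p *s \<phi> v"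
  shows "module_hom (*s) (*s) \<phi>"
  using assms by (intro module_hom.intro module_Sn module_hom_axioms.intro)

lemma graded_hom_hcv:
  fixes \<phi> :: "S^'m \<Rightarrow> S^'n"
  assumes "graded_hom s t \<phi>"
  shows "\<phi> (hcv s q v) = hcv t q (\<phi> v)"
proof -
  have h: "module_hom (*s) (*s) \<phi>" and g: "\<And>q v. v \<in> twisted_grade s q \<Longrightarrow> \<phi> v \<in> twisted_grade t q"
    using assms by (auto simp: graded_hom_def)
  obtain Q where Q: "finite Q" "\<And>Q'. finite Q' \<Longrightarrow> Q \<subseteq> Q' \<Longrightarrow> (\<Sum>q\<in>Q'. hcv s q v) = v"
    using sum_hcv[of s v] by metis
  have "(\<Sum>j\<in>insert q Q. hcv s j v) = v" using Q by blast
  then have "\<phi> v = (\<Sum>j\<in>insert q Q. \<phi> (hcv s j v))" by (metis hom_Sn_simps(5)[OF h])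
  then have "hcv t q (\<phi> v) = (\<Sum>j\<in>insert q Q. hcv t q (\<phi> (hcv s j v)))" by (simp only: hcv_sum)
  also have "\<dots> = (\<Sum>j\<in>insert q Q. if j = q then \<phi> (hcv s q v) else 0)"
    by (rule sum.cong) (auto simp: hcv_of_grade[OF g[OF hcv_grade]])
  finally show ?thesis using Q(1) by simp
qed

text \<open>A preimage of a homogeneous vector may be replaced by its component of the same degree.
  Exactness thereby passes to each degree separately.\<close>

lemma graded_hom_image:
  fixes \<phi> :: "S^'m \<Rightarrow> S^'n"
  assumes "graded_hom s t \<phi>"
  shows "\<phi> ` twisted_grade s q = twisted_grade t q \<inter> range \<phi>"
proof (intro equalityI subsetI)
  show "x \<in> twisted_grade t q \<inter> range \<phi>" if "x \<in> \<phi> ` twisted_grade s q" for x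
    using assms that unfolding graded_hom_def by blast
next
  fix x assume "x \<in> twisted_grade t q \<inter> range \<phi>"
  then obtain v where v: "x = \<phi> v" "hcv t q x = x" by (auto simp: twisted_grade_hcv_iff)
  then have "x = \<phi> (hcv s q v)" by (simp add: graded_hom_hcv[OF assms])
  then show "x \<in> \<phi> ` twisted_grade s q" using hcv_grade by blast
qed

section \<open>Partial derivatives\<close>

lemma lookup_partial: "look (partial i p) m = of_nat (look m i + 1) * look p (m + sing i 1)"
proof -
  \<comment> \<open>Subtraction of exponents is truncated. The monomials without
    \<open>Var i\<close>, for which it goes wrong, have coefficient \<open>0\<close> in the
    derivative.\<close>
  have eq: "(n - sing i 1 = m \<and> look n i \<noteq> 0) \<longleftrightarrow> n = m + sing i 1" for n :: mon
  proof
    assume n: "n - sing i 1 = m \<and> look n i \<noteq> 0"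
    show "n = m + sing i 1"
      by (rule poly_mapping_eqI)
        (use n in \<open>auto simp: lookup_add lookup_minus lookup_single when_def\<close>)
  qed (auto simp: lookup_add)
  have "look (partial i p) m = (\<Sum>n\<in>keysof p. if n = m + sing i 1
      then of_nat (look n i) * look p n else 0)"
    unfolding partial_def lookup_sum
  proof (rule sum.cong)
    fix n assume "n \<in> keysof p"
    show "look (sing (n - sing i 1) (of_nat (look n i) * look p n)) m =
        (if n = m + sing i 1 then of_nat (look n i) * look p n else 0)"
      using eq[of n] by (cases "look n i = 0") (auto simp: lookup_single when_def)
  qed simp
  also have "\<dots> = of_nat (look m i + 1) * look p (m + sing i 1)"
    by (simp add: in_keys_iff lookup_add)
  finally show ?thesis .
qed

lemma partial_grade: "p \<in> grade k \<Longrightarrow> partial i p \<in> grade (k - 1)"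
  by (force simp: grade_iff lookup_partial mdeg_add mdeg_single)

lemma partial_add: "partial i (p + q) = partial i p + partial i q"
  by (rule poly_mapping_eqI) (simp add: lookup_partial lookup_add ring_distribs)

lemma partial_0 [simp]: "partial i 0 = 0"
  by (simp add: partial_def)

lemma partial_sum: "partial i (sum g A) = (\<Sum>j\<in>A. partial i (g j))"
  by (induction A rule: infinite_finite_induct) (auto simp: partial_add)

lemma partial_Const_mult: "partial i (Const c * p) = Const c * partial i p"
  by (rule poly_mapping_eqI) (simp add: lookup_partial lookup_Const_mult)

lemma lookup_Var_mult: "look (Var j * p) (m + sing j 1) = look p m"
  and lookup_Var_mult_0: "look m j = 0 \<Longrightarrow> look (Var j * p) m = 0"
proof -
  have 1: "look (\<Sum>n\<in>keysof p. sing (sing j 1 + n) (look p n)) m =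
      (\<Sum>n\<in>keysof p. look p n when sing j 1 + n = m)" for m
    by (simp add: lookup_sum lookup_single)
  have 2: "Var j * p = (\<Sum>n\<in>keysof p. sing (sing j 1 + n) (look p n))"
    by (subst (1) sum_single_lookup[of p, symmetric]) (simp add: sum_distrib_left Var_def mult_single)
  have 3: "sing j 1 + n = m + sing j 1 \<longleftrightarrow> n = m" for n m :: mon
    by (metis add.commute add_left_imp_eq)
  show "look (Var j * p) (m + sing j 1) = look p m"
    unfolding 2 1 3 by (simp add: when_def in_keys_iff)
  assume "look m j = 0"
  then have "sing j 1 + n \<noteq> m" for n by (auto simp: lookup_add)
  then show "look (Var j * p) m = 0" unfolding 2 1 by simp
qed

lemma partial_Var_mult: "partial i (Var j * q) = (if i = j then q else 0) + Var j * partial i q"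
proof (rule poly_mapping_eqI)
  fix m
  show "look (partial i (Var j * q)) m = look ((if i = j then q else 0) + Var j * partial i q) m"
  proof (cases "look m j = 0")
    case True
    show ?thesis
    proof (cases "i = j")
      case False
      then have "look (m + sing i 1) j = 0" using True by (simp add: lookup_add lookup_single)
      then show ?thesis using True False by (simp add: lookup_partial lookup_Var_mult_0)
    qed (use True in \<open>simp add: lookup_partial lookup_Var_mult[unfolded One_nat_def] lookup_Var_mult_0 lookup_add\<close>)
  next
    case False
    define n where "n = m - sing j 1"
    have m: "m = n + sing j 1"
      by (rule poly_mapping_eqI)
        (use False in \<open>auto simp: n_def lookup_add lookup_minus lookup_single when_def\<close>)
    have "n + sing j 1 + sing i 1 = (n + sing i 1) + sing j 1" by (simp add: ac_simps)
    then have "look (Var j * q) (n + sing j 1 + sing i 1) = look q (n + sing i 1)"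
      by (metis lookup_Var_mult)
    then show ?thesis unfolding m
      by (auto simp: lookup_partial lookup_Var_mult[unfolded One_nat_def] lookup_add lookup_single when_def algebra_simps)
  qed
qed

lemma partial_Const: "partial i (Const c) = 0"
proof (rule poly_mapping_eqI)
  fix m :: mon
  have "look (m + sing i 1) i \<noteq> 0" by (simp add: lookup_add)
  then have "m + sing i 1 \<noteq> 0" by (metis lookup_zero)
  then show "look (partial i (Const c)) m = look 0 m"
    by (simp add: lookup_partial Const_def lookup_single when_def)
qed

lemma partial_Var: "partial i (Var j) = (if i = j then 1 else 0)"
  using partial_Var_mult[of i j 1] partial_Const[of i 1] by (simp add: Const_simps)

lemma partial_mult: "partial i (p * q) = partial i p * q + p * partial i q"
proof (induction p arbitrary: q rule: S_induct)
  case (Const c)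
  show ?case by (simp add: partial_Const_mult partial_Const)
next
  case (Var j)
  show ?case by (simp add: partial_Var_mult partial_Var)
next
  case (add p r)
  then show ?case by (simp add: ring_distribs partial_add)
next
  case (mult p r)
  have "partial i (p * r * q) = partial i p * (r * q) + p * (partial i r * q + r * partial i q)"
    by (simp only: mult.assoc mult.IH)
  also have "\<dots> = partial i (p * r) * q + p * r * partial i q"
    unfolding mult.IH(1)[of r] by (simp only: ring_distribs ac_simps)
  finally show ?case .
qed

text \<open>Chain rule: both sides are additive and obey the same product rule, so agreement on
  constants and variables suffices.\<close>

lemma partial_ev: "partial k (ev Const L p) = (\<Sum>i\<in>UNIV. ev Const L (partial i p) * partial k (L i))"
proof (induction p rule: S_induct)
  case (Const c)
  then show ?case by (simp add: ev_Const rhom_Const partial_Const rhom_simps[OF rhom_ev[OF rhom_Const]])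
next
  case (Var j)
  have "ev Const L (partial i (Var j)) * partial k (L i) = (if i = j then partial k (L j) else 0)" for i
    by (simp add: partial_Var rhom_simps[OF rhom_ev[OF rhom_Const]])
  then show ?case by (simp add: ev_Var rhom_Const)
next
  case (add p q)
  then show ?case
    by (simp add: partial_add rhom_simps[OF rhom_ev[OF rhom_Const]] sum.distrib ring_distribs)
next
  case (mult p q)
  note r = rhom_simps[OF rhom_ev[OF rhom_Const]]
  have "partial k (ev Const L (p * q)) =
      (\<Sum>i\<in>UNIV. ev Const L (partial i p) * partial k (L i)) * ev Const L q
      + ev Const L p * (\<Sum>i\<in>UNIV. ev Const L (partial i q) * partial k (L i))"
    by (simp only: r partial_mult mult.IH)
  then show ?case
    by (simp only: partial_mult r ring_distribs sum.distrib sum_distrib_left sum_distrib_right ac_simps)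
qed

section \<open>Constant syzygies and cones\<close>

lemma linear_change_ev: "linear_change A = ev Const (\<lambda>i. \<Sum>j\<in>UNIV. Const (A $ i $ j) * Var j)"
  by (rule ext) (simp add: linear_change_def ev_def)

lemma invertible_with_column:
  fixes c :: "complex^4"
  assumes "c \<noteq> 0"
  obtains A :: "complex^4^4" where "invertible A" "\<And>i. A $ i $ 4 = c $ i"
proof -
  obtain k where k: "c $ k \<noteq> 0" using assms by (auto simp: vec_eq_iff)
  define \<tau> where "\<tau> i = (if i = k then 4 else if i = 4 then k else i)" for i :: 4
  have \<tau>: "\<tau> (\<tau> i) = i" for i by (auto simp: \<tau>_def)
  \<comment> \<open>The permutation matrix that swaps \<open>k\<close> and \<open>4\<close>, with
    its last column replaced by \<open>c\<close>. Row \<open>k\<close> then has the single nonzero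
    entry \<open>c $ k\<close>, which forces the last coordinate of a kernel vector to vanish, and
    the other rows force the rest.\<close>
  define A :: "complex^4^4" where "A = (\<chi> i j. if j = 4 then c $ i else if j = \<tau> i then 1 else 0)"
  have mv: "(A *v x) $ i = c $ i * x $ 4 + (if \<tau> i = 4 then 0 else x $ \<tau> i)" for x i
  proof -
    have "(A *v x) $ i = (\<Sum>j\<in>UNIV. (if j = 4 then c $ i * x $ 4 else 0) +
        (if j = \<tau> i then if \<tau> i = 4 then 0 else x $ \<tau> i else 0))"
      unfolding matrix_vector_mult_def A_def vec_lambda_beta by (rule sum.cong) auto
    then show ?thesis by (simp add: sum.distrib)
  qed
  have "x = 0" if "A *v x = 0" for x
  proof -
    have *: "c $ i * x $ 4 + (if \<tau> i = 4 then 0 else x $ \<tau> i) = 0" for i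
      using that mv[of x i] by simp
    from *[of k] k have 4: "x $ 4 = 0" by (simp add: \<tau>_def)
    have "x $ i = 0" for i using *[of "\<tau> i"] 4 by (auto simp: \<tau> split: if_splits)
    then show ?thesis by (simp add: vec_eq_iff)
  qed
  then have "inj ((*v) A)" by (simp add: matrix_left_invertible_ker flip: matrix_left_invertible_injective)
  then have "invertible A" by (simp add: invertible_left_inverse matrix_left_invertible_injective)
  then show ?thesis using that by (simp add: A_def)
qed

text \<open>A constant syzygy is a constant vector field that annihilates \<open>f\<close>. In
  coordinates in which this field is the derivative with respect to the last variable, that variable
  does not occur.\<close>

lemma cone_if_constant_syzygy:
  fixes c :: "complex^4"
  assumes "c \<noteq> 0" "(\<Sum>i\<in>UNIV. Const (c $ i) * partial i f) = 0"
  shows "cone_over_plane_curve f"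
proof -
  obtain A :: "complex^4^4" where A: "invertible A" "\<And>i. A $ i $ 4 = c $ i"
    using invertible_with_column[OF assms(1)] by blast
  have "partial 4 (\<Sum>j\<in>UNIV. Const (A $ i $ j) * Var j) = Const (c $ i)" for i
    by (simp add: partial_sum partial_Const_mult partial_Var A(2) if_distrib[of "\<lambda>x. _ * x"] cong: if_cong)
  then have "partial 4 (linear_change A f) =
      (\<Sum>i\<in>UNIV. ev Const (\<lambda>i. \<Sum>j\<in>UNIV. Const (A $ i $ j) * Var j) (Const (c $ i) * partial i f))"
    unfolding linear_change_ev
    by (simp add: partial_ev rhom_simps[OF rhom_ev[OF rhom_Const]] ev_Const rhom_Const mult.commute)
  also have "\<dots> = 0"
    unfolding rhom_sum[OF rhom_ev[OF rhom_Const], symmetric]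
    by (simp add: assms(2) rhom_simps[OF rhom_ev[OF rhom_Const]])
  finally have 0: "partial 4 (linear_change A f) = 0" .
  have "look m 4 = 0" if "m \<in> keysof (linear_change A f)" for m
  proof (rule ccontr)
    assume "look m 4 \<noteq> 0"
    then have m: "m = (m - sing 4 1) + sing 4 1"
      by (intro poly_mapping_eqI) (auto simp: lookup_add lookup_minus lookup_single when_def)
    \<comment> \<open>In characteristic zero the exponent by which the coefficient is multiplied is
      nonzero.\<close>
    have "look (partial 4 (linear_change A f)) (m - sing 4 1) \<noteq> 0"
      unfolding lookup_partial using that m by (metis in_keys_iff mult_eq_0_iff of_nat_eq_0_iff
        add_is_0 one_neq_zero)
    then show False by (simp add: 0)
  qed
  then show ?thesis using A(1) unfolding cone_over_plane_curve_def by blast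
qed

section \<open>Dimensions\<close>

context vector_space
begin

lemma finite_basisE:
  assumes "V \<subseteq> span W" "finite W"
  obtains B where "B \<subseteq> V" "finite B" "independent B" "V \<subseteq> span B" "card B = dim V"
proof -
  obtain B where B: "B \<subseteq> V" "independent B" "V \<subseteq> span B" "card B = dim V"
    by (rule basis_exists)
  moreover have "finite B" using independent_span_bound[OF assms(2) B(2)] B(1) assms(1) by auto
  ultimately show ?thesis using that by blast
qed

lemma card_independent_le_dim:
  assumes "independent B" "B \<subseteq> V" "V \<subseteq> span W" "finite W"
  shows "card B \<le> dim V"
proof -
  obtain C where C: "C \<subseteq> V" "finite C" "independent C" "V \<subseteq> span C" "card C = dim V"
    using finite_basisE[OF assms(3,4)] .
  then show ?thesis using independent_span_bound[OF C(2) assms(1)] assms(2) by auto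
qed

lemma span_disjoint_zero:
  assumes "finite C" "independent C" "B \<subseteq> C" "x \<in> span B" "x \<in> span (C - B)"
  shows "x = 0"
proof -
  have fin: "finite B" "finite (C - B)" using assms finite_subset by auto
  obtain u where u: "x = (\<Sum>b\<in>B. scale (u b) b)" using assms(4) unfolding span_finite[OF fin(1)] by blast
  obtain v where v: "x = (\<Sum>b\<in>C - B. scale (v b) b)" using assms(5) unfolding span_finite[OF fin(2)] by blast
  let ?w = "\<lambda>b. if b \<in> B then u b else - v b"
  have "(\<Sum>b\<in>C. scale (?w b) b) = (\<Sum>b\<in>C - B. scale (?w b) b) + (\<Sum>b\<in>B. scale (?w b) b)"
    using assms by (intro sum.subset_diff) auto
  also have "(\<Sum>b\<in>C - B. scale (?w b) b) = - x" unfolding v sum_negf[symmetric] by (intro sum.cong) auto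
  also have "(\<Sum>b\<in>B. scale (?w b) b) = x" unfolding u by simp
  finally have "(\<Sum>b\<in>C. scale (?w b) b) = 0" by simp
  then have "u b = 0" if "b \<in> B" for b
    using independentD[OF assms(2,1) subset_refl, of ?w b] that assms(3) by auto
  then show ?thesis using u by simp
qed

lemma span_insert_splitE:
  assumes "finite C" "B \<subseteq> C" "x \<in> span C"
  obtains u where "x - (\<Sum>b\<in>C - B. scale (u b) b) \<in> span B"
proof -
  obtain u where u: "x = (\<Sum>b\<in>C. scale (u b) b)" using assms span_finite by auto
  have "x = (\<Sum>b\<in>C - B. scale (u b) b) + (\<Sum>b\<in>B. scale (u b) b)"
    unfolding u by (rule sum.subset_diff) (use assms in auto)
  then have "x - (\<Sum>b\<in>C - B. scale (u b) b) \<in> span B"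
    by (simp add: span_sum span_scale span_base)
  then show ?thesis using that by blast
qed

text \<open>In a linear relation the part over \<open>B\<close> lies in \<open>K\<close>, so the
  part over \<open>J\<close> does too and has zero coefficients by \<open>e\<close>. The remaining
  relation is one over \<open>B\<close>. The family is indexed, so injectivity is part of the
  conclusion.\<close>

lemma independent_mod_subspace:
  fixes e :: "'i \<Rightarrow> 'b"
  assumes K: "subspace K" and B: "B \<subseteq> K" "finite B" "independent B" and J: "finite J"
    and e: "\<And>u. (\<Sum>j\<in>J. scale (u j) (e j)) \<in> K \<Longrightarrow> \<forall>j\<in>J. u j = 0"
  shows "inj_on e J" "e ` J \<inter> B = {}" "independent (e ` J \<union> B)"
proof -
  have delta: "(\<Sum>j\<in>J. scale (if j = i then c else 0) (e j)) = scale c (e i)" if "i \<in> J" for i c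
  proof -
    have "(\<Sum>j\<in>J. scale (if j = i then c else 0) (e j)) = (\<Sum>j\<in>J. if j = i then scale c (e i) else 0)"
      by (rule sum.cong) auto
    then show ?thesis using that J by simp
  qed
  show inj: "inj_on e J"
  proof (rule inj_onI, rule ccontr)
    fix i k assume ik: "i \<in> J" "k \<in> J" "e i = e k" "i \<noteq> k"
    have "(\<Sum>j\<in>J. scale ((if j = i then 1 else 0) + (if j = k then -1 else 0)) (e j)) = 0"
      using ik by (simp only: scale_left_distrib sum.distrib delta) simp
    then show False
      using e[of "\<lambda>j. (if j = i then 1 else 0) + (if j = k then -1 else 0)"] ik subspace_0[OF K] by auto
  qed
  show disj: "e ` J \<inter> B = {}"
  proof (rule ccontr)
    assume "\<not> ?thesis"
    then obtain i where i: "i \<in> J" "e i \<in> B" by auto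
    have "\<forall>j\<in>J. (if j = i then 1 else 0 :: 'a) = 0"
      by (rule e) (use delta[of i 1] i B(1) in auto)
    then show False using i by auto
  qed
  show "independent (e ` J \<union> B)"
  proof (rule independent_if_scalars_zero)
    show "finite (e ` J \<union> B)" using B J by simp
    fix u x assume s: "(\<Sum>x\<in>e ` J \<union> B. scale (u x) x) = 0" and x: "x \<in> e ` J \<union> B"
    have sp: "(\<Sum>x\<in>e ` J. scale (u x) x) + (\<Sum>x\<in>B. scale (u x) x) = 0"
      using s by (subst (asm) sum.union_disjoint) (use B J disj in auto)
    have "(\<Sum>j\<in>J. scale (u (e j)) (e j)) = (\<Sum>x\<in>e ` J. scale (u x) x)"
      by (simp add: sum.reindex[OF inj])
    also have "\<dots> = - (\<Sum>x\<in>B. scale (u x) x)" using sp by (simp add: eq_neg_iff_add_eq_0)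
    also have "\<dots> \<in> K" using K B(1) by (intro subspace_neg subspace_sum subspace_scale) auto
    finally have 1: "u (e j) = 0" if "j \<in> J" for j using e[of "\<lambda>j. u (e j)"] that by blast
    then have "(\<Sum>x\<in>e ` J. scale (u x) x) = 0" by (intro sum.neutral) auto
    then have "(\<Sum>x\<in>B. scale (u x) x) = 0" using sp by simp
    then have "u x = 0" if "x \<in> B" for x using independentD[OF B(3,2) subset_refl] that by blast
    then show "u x = 0" using 1 x by auto
  qed
qed

lemma dim_coords:
  fixes e :: "'i \<Rightarrow> 'b" and c :: "'b \<Rightarrow> 'i \<Rightarrow> 'a"
  assumes J: "finite J" and V: "\<And>j. j \<in> J \<Longrightarrow> e j \<in> V"
    and span: "\<And>v. v \<in> V \<Longrightarrow> v = (\<Sum>j\<in>J. scale (c v j) (e j))"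
    and indep: "\<And>u. (\<Sum>j\<in>J. scale (u j) (e j)) = 0 \<Longrightarrow> \<forall>j\<in>J. u j = 0"
  shows "dim V = card J" "V \<subseteq> span (e ` J)"
proof -
  have *: "inj_on e J" "independent (e ` J)"
    using independent_mod_subspace[of "{0}" "{}" J e] J indep
    by (auto simp: independent_empty subspace_def)
  show sp: "V \<subseteq> span (e ` J)"
  proof
    fix v assume "v \<in> V"
    have "(\<Sum>j\<in>J. scale (c v j) (e j)) \<in> span (e ` J)"
      by (intro span_sum span_scale span_base) auto
    then show "v \<in> span (e ` J)" using span[OF \<open>v \<in> V\<close>] by simp
  qed
  show "dim V = card J"
    by (rule dim_unique[OF _ sp *(2) card_image[OF *(1)]]) (use V in auto)
qed

text \<open>Otherwise the family together with a basis of \<open>K\<close> would be an independent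
  set in \<open>V\<close> with more than \<open>dim V\<close> elements. This produces nonzero
  elements of \<open>I\<close> among prescribed monomials.\<close>

lemma meets_subspace:
  fixes e :: "'i \<Rightarrow> 'b"
  assumes "subspace V" "V \<subseteq> span W" "finite W" "subspace K" "K \<subseteq> V" "finite J" "\<And>j. j \<in> J \<Longrightarrow> e j \<in> V"
    and "dim V < dim K + card J"
  obtains u where "(\<Sum>j\<in>J. scale (u j) (e j)) \<in> K" "\<exists>j\<in>J. u j \<noteq> 0"
proof (rule ccontr)
  assume no: "\<not> thesis"
  note found = that
  obtain B where B: "B \<subseteq> K" "finite B" "independent B" "K \<subseteq> span B" "card B = dim K"
    using finite_basisE[of K W] assms by blast
  have "\<forall>j\<in>J. u j = 0" if "(\<Sum>j\<in>J. scale (u j) (e j)) \<in> K" for u using no found[of u] that by blast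
  note i = independent_mod_subspace[OF assms(4) B(1-3) assms(6) this]
  have "card (e ` J \<union> B) = card J + card B"
    using i B assms(6) by (subst card_Un_disjoint) (auto simp: card_image)
  moreover have "card (e ` J \<union> B) \<le> dim V"
    by (rule card_independent_le_dim[OF i(3) _ assms(2,3)]) (use assms B in auto)
  ultimately show False using assms(8) B(5) by simp
qed

end

text \<open>The ambient spaces are infinite-dimensional, hence the restriction to a subspace
  \<open>V\<close> inside a finite span. A basis \<open>B\<close> of the kernel is extended to a
  basis \<open>C\<close> of \<open>V\<close>, and \<open>f\<close> is injective on the span of
  \<open>C - B\<close>.\<close>

lemma (in vector_space_pair) rank_nullity:
  assumes lf: "Vector_Spaces.linear s1 s2 f"
  assumes V: "vs1.subspace V" "V \<subseteq> vs1.span W" "finite W"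
  shows "vs1.dim V = vs1.dim {v\<in>V. f v = 0} + vs2.dim (f ` V)"
proof -
  let ?K = "{v\<in>V. f v = 0}"
  have "?K \<subseteq> vs1.span W" using V by auto
  then obtain B where B: "B \<subseteq> ?K" "finite B" "vs1.independent B" "?K \<subseteq> vs1.span B" "card B = vs1.dim ?K"
    using vs1.finite_basisE V(3) by blast
  then obtain C where C: "B \<subseteq> C" "C \<subseteq> V" "vs1.independent C" "V \<subseteq> vs1.span C"
    using vs1.maximal_independent_subset_extend[of B V] by blast
  have finC: "finite C" using vs1.independent_span_bound[OF V(3) C(3)] C(2) V(2) by blast
  have K0: "x = 0" if x: "x \<in> vs1.span (C - B)" "f x = 0" for x
  proof (rule vs1.span_disjoint_zero[OF finC C(3,1) _ x(1)])
    have "vs1.span (C - B) \<subseteq> V" using C(2) V(1) by (intro vs1.span_minimal) auto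
    then show "x \<in> vs1.span B" using B(4) x by auto
  qed
  have inj: "inj_on f (vs1.span (C - B))"
  proof (rule inj_onI)
    fix x y assume "x \<in> vs1.span (C - B)" "y \<in> vs1.span (C - B)" "f x = f y"
    then have "x - y = 0" by (intro K0) (auto simp: vs1.span_diff linear_diff[OF lf])
    then show "x = y" by simp
  qed
  have indep: "vs2.independent (f ` (C - B))"
    using inj vs1.independent_mono[OF C(3), of "C - B"] by (intro linear_independent_injective_image[OF lf]) auto
  have "f x \<in> vs2.span (f ` (C - B))" if "x \<in> V" for x
  proof -
    have "x \<in> vs1.span C" using that C(4) by auto
    then obtain u where u: "x - (\<Sum>b\<in>C - B. s1 (u b) b) \<in> vs1.span B"
      using vs1.span_insert_splitE[OF finC C(1)] by blast
    have "f z = 0" if "z \<in> vs1.span B" for z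
      using that B(1) by (induction rule: vs1.span_induct_alt) (auto simp: linear_add[OF lf] linear_scale[OF lf] linear_0[OF lf])
    then have "f x = (\<Sum>b\<in>C - B. s2 (u b) (f b))" using u
      by (fastforce simp: linear_diff[OF lf] linear_sum[OF lf] linear_scale[OF lf])
    moreover have "(\<Sum>b\<in>C - B. s2 (u b) (f b)) \<in> vs2.span (f ` (C - B))"
      by (intro vs2.span_sum vs2.span_scale vs2.span_base) simp
    ultimately show ?thesis by simp
  qed
  then have "f ` V \<subseteq> vs2.span (f ` (C - B))" by blast
  moreover have "f ` (C - B) \<subseteq> f ` V" using C by auto
  ultimately have "vs2.dim (f ` V) = card (f ` (C - B))"
    using indep by (intro vs2.dim_unique) auto
  also have "\<dots> = card (C - B)"
    by (rule card_image, rule inj_on_subset[OF inj]) (rule vs1.span_superset)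
  also have "\<dots> = card C - card B" using C(1) B(2) by (rule card_Diff_subset[rotated])
  finally have "vs2.dim (f ` V) = card C - card B" .
  moreover have "card C = vs1.dim V" by (rule vs1.basis_card_eq_dim[OF C(2,4,3)])
  moreover have "card B \<le> card C" by (rule card_mono[OF finC C(1)])
  ultimately show ?thesis using B(5) by simp
qed

section \<open>Dimensions of graded pieces of free modules\<close>

lemma vector_space_S: "vector_space (\<lambda>c (p::S). Const c * p)"
  by standard (simp_all only: Const_simps ring_distribs mult.assoc mult_1_left)

lemma vector_space_Sn: "vector_space (\<lambda>c (v::S^'n). Const c *s v)"
  by standard (simp_all add: vec_eq_iff Const_simps(2-4) ring_distribs mult.assoc del: mult_eq_0_iff)

interpretation SV: vector_space "\<lambda>c (p::S). Const c * p" by (rule vector_space_S)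
interpretation SnV: vector_space "\<lambda>c (v::S^'n). Const c *s v" by (rule vector_space_Sn)

text \<open>The dimension of the component of degree \<open>k\<close> of \<open>S\<close>. The case
  distinction keeps negative degrees at \<open>0\<close>, where \<open>nat k\<close> would give
  \<open>1\<close>.\<close>

definition hS :: "int \<Rightarrow> nat" where
  "hS k = (if k < 0 then 0 else (nat k + 3) choose 3)"

definition mons :: "int \<Rightarrow> mon set" where
  "mons k = {m. int (mdeg m) = k}"

lemma card_mons: "card (mons k) = hS k" and finite_mons: "finite (mons k)"
proof -
  let ?f = "\<lambda>m :: mon. [look m 1, look m 2, look m 3, look m 4]"
  have inj: "inj ?f"
  proof (rule injI, rule poly_mapping_eqI)
    fix m n i assume "?f m = ?f n"
    then show "look m i = look n i" using exhaust_4[of i] by auto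
  qed
  have "card (mons k) = hS k \<and> finite (mons k)"
  proof (cases "k < 0")
    case True
    then have "mons k = {}" by (auto simp: mons_def)
    then show ?thesis using True by (simp add: hS_def)
  next
    case False
    have "?f ` mons k = {l. length l = 4 \<and> sum_list l = nat k}"
    proof (intro equalityI subsetI)
      show "l \<in> {l. length l = 4 \<and> sum_list l = nat k}" if "l \<in> ?f ` mons k" for l
        using that by (auto simp: mons_def mdeg_def sum_4)
    next
      fix l :: "nat list" assume "l \<in> {l. length l = 4 \<and> sum_list l = nat k}"
      then obtain a b c d where l: "l = [a, b, c, d]" "a + b + c + d = nat k"
        by (auto simp: numeral_eq_Suc length_Suc_conv)
      let ?m = "sing 1 a + sing 2 b + sing 3 c + sing 4 d :: mon"
      have "?f ?m = l" using l by (simp add: lookup_add lookup_single)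
      moreover have "?m \<in> mons k" using l False by (simp add: mons_def mdeg_add mdeg_single)
      ultimately show "l \<in> ?f ` mons k" by (intro image_eqI[OF sym])
    qed
    then have *: "card (?f ` mons k) = (nat k + 3) choose nat k"
      using card_length_sum_list[of 4 "nat k"] by (simp add: add.commute)
    have "card (?f ` mons k) = card (mons k)" by (rule card_image) (rule inj_on_subset[OF inj], simp)
    moreover have "(nat k + 3) choose nat k = (nat k + 3) choose 3"
      using binomial_symmetric[of 3 "nat k + 3"] by simp
    ultimately have "card (mons k) = hS k" using * False by (simp add: hS_def)
    \<comment> \<open>A positive cardinality also yields finiteness, since infinite sets have
      cardinality \<open>0\<close>.\<close>
    moreover have "hS k > 0" using False by (simp add: hS_def)
    ultimately show ?thesis by (metis card.infinite less_numeral_extra(3))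
  qed
  then show "card (mons k) = hS k" "finite (mons k)" by auto
qed

lemma sum_Const_single:
  assumes "finite A"
  shows "look (\<Sum>m\<in>A. Const (u m) * sing m 1) n = (if n \<in> A then u n else 0)"
  using assms by (simp add: lookup_sum lookup_Const_mult lookup_single when_def if_distrib[of "\<lambda>x. _ * x"] cong: if_cong)

lemma grade_expansion: "p \<in> grade k \<Longrightarrow> p = (\<Sum>m\<in>mons k. Const (look p m) * sing m 1)"
  by (rule poly_mapping_eqI, subst sum_Const_single[OF finite_mons]) (auto simp: mons_def grade_iff)

lemma
  shows dim_grade: "SV.dim (grade k) = hS k"
    and grade_finite_span: "grade k \<subseteq> SV.span ((\<lambda>m. sing m 1) ` mons k)"
proof -
  have ind: "\<forall>m\<in>mons k. u m = 0" if "(\<Sum>m\<in>mons k. Const (u m) * sing m 1) = 0" for u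
    using sum_Const_single[OF finite_mons, of u k] that by (metis lookup_zero)
  have "sing m 1 \<in> grade k" if "m \<in> mons k" for m using that by (auto simp: mons_def single_grade)
  note * = SV.dim_coords[of "mons k" "\<lambda>m. sing m 1" "grade k" look, OF finite_mons this grade_expansion ind]
  show "SV.dim (grade k) = hS k" "grade k \<subseteq> SV.span ((\<lambda>m. sing m 1) ` mons k)"
    using * by (simp_all add: card_mons)
qed

lemma subspace_grade: "SV.subspace (grade k)"
  by (auto simp: SV.subspace_def grade_add grade_Const_mult)

lemma subspace_twisted_grade: "SnV.subspace (twisted_grade s q)"
  by (auto simp: SnV.subspace_def twisted_grade_def grade_add grade_Const_mult)

lemma
  fixes s :: "'n::finite \<Rightarrow> int"
  shows dim_twisted_grade: "SnV.dim (twisted_grade s q) = (\<Sum>i\<in>UNIV. hS (q + s i))"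
    and twisted_grade_finite_span: "\<exists>W. finite W \<and> twisted_grade s q \<subseteq> SnV.span W"
proof -
  let ?J = "SIGMA i:UNIV. mons (q + s i)"
  let ?e = "\<lambda>(i, m). axis i (sing m 1) :: S^'n"
  have fin: "finite ?J" by (intro finite_SigmaI) (simp_all add: finite_mons)
  have nth: "(\<Sum>j\<in>?J. Const (u j) *s ?e j) $ k = (\<Sum>m\<in>mons (q + s k). Const (u (k, m)) * sing m 1)" for u k
  proof -
    have "(\<Sum>j\<in>?J. Const (u j) *s ?e j) $ k = (\<Sum>i\<in>UNIV. \<Sum>m\<in>mons (q + s i). if i = k then Const (u (i, m)) * sing m 1 else 0)"
      by (subst sum.Sigma) (auto simp: finite_mons sum_component axis_def intro!: sum.cong)
    also have "\<dots> = (\<Sum>i\<in>UNIV. if i = k then \<Sum>m\<in>mons (q + s k). Const (u (k, m)) * sing m 1 else 0)"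
      by (rule sum.cong) auto
    finally show ?thesis by simp
  qed
  have ind: "\<forall>j\<in>?J. u j = 0" if "(\<Sum>j\<in>?J. Const (u j) *s ?e j) = 0" for u
  proof
    fix j assume "j \<in> ?J"
    then obtain k m where j: "j = (k, m)" "m \<in> mons (q + s k)" by auto
    have "(\<Sum>m\<in>mons (q + s k). Const (u (k, m)) * sing m 1) = 0" using nth[of u k] that by simp
    then show "u j = 0" using sum_Const_single[OF finite_mons, of "\<lambda>m. u (k, m)" "q + s k" m] j by simp
  qed
  have mem: "?e j \<in> twisted_grade s q" if "j \<in> ?J" for j
    using that by (auto simp: mons_def axis_def twisted_grade_def intro: single_grade)
  have exp: "v = (\<Sum>j\<in>?J. Const (case j of (i, m) \<Rightarrow> look (v $ i) m) *s ?e j)" if "v \<in> twisted_grade s q" for v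
    unfolding vec_eq_iff nth prod.case using that grade_expansion by (auto simp: twisted_grade_def)
  note * = SnV.dim_coords[of ?J ?e "twisted_grade s q", OF fin mem exp ind]
  show "SnV.dim (twisted_grade s q) = (\<Sum>i\<in>UNIV. hS (q + s i))"
    using *(1) by (simp add: card_mons finite_mons)
  show "\<exists>W. finite W \<and> twisted_grade s q \<subseteq> SnV.span W" using *(2) fin by blast
qed

lemma linear_hom_Sn:
  assumes "module_hom ((*s) :: S \<Rightarrow> S^'m \<Rightarrow> S^'m) ((*s) :: S \<Rightarrow> S^'n \<Rightarrow> S^'n) \<phi>"
  shows "Vector_Spaces.linear (\<lambda>c (v::S^'m). Const c *s v) (\<lambda>c (v::S^'n). Const c *s v) \<phi>"
  unfolding Vector_Spaces.linear_iff by (intro conjI vector_space_Sn allI) (simp_all add: hom_Sn_simps[OF assms])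

text \<open>Rank-nullity in a single degree. Every Hilbert function of a resolution below is
  computed by it.\<close>

lemma dim_graded_hom:
  fixes \<phi> :: "S^'m \<Rightarrow> S^'n"
  assumes "graded_hom s t \<phi>"
  shows "(\<Sum>i\<in>UNIV. hS (q + s i)) =
    SnV.dim {v\<in>twisted_grade s q. \<phi> v = 0} + SnV.dim (twisted_grade t q \<inter> range \<phi>)"
proof -
  obtain W where W: "finite W" "twisted_grade s q \<subseteq> SnV.span W" using twisted_grade_finite_span by blast
  show ?thesis
    unfolding dim_twisted_grade[symmetric] graded_hom_image[OF assms, symmetric]
    by (rule vector_space_pair.rank_nullity[OF _ linear_hom_Sn subspace_twisted_grade W(2,1)])
      (use assms in \<open>auto simp: vector_space_pair_def vector_space_Sn graded_hom_def\<close>)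
qed

section \<open>The Hilbert function of the Milnor algebra\<close>

text \<open>As \<open>milnor_dim\<close> is a definite description, a basis must be shown to exist
  and all bases to have the same size. Both follow because a basis modulo \<open>J\<close>, joined
  with a basis of the degree \<open>k\<close> part of \<open>J\<close>, is a basis of the degree
  \<open>k\<close> part of \<open>S\<close>.\<close>

lemma milnor_dim_eq:
  assumes J: "SM.subspace J" and JJ: "jac_ideal f = J"
  shows "milnor_dim f k + SV.dim (grade k \<inter> J) = hS k"
proof -
  let ?V = "grade k" and ?K = "grade k \<inter> J"
  let ?W = "(\<lambda>m. sing m 1) ` mons k"
  have W: "finite ?W" "?V \<subseteq> SV.span ?W" using finite_mons grade_finite_span by auto
  have J': "SV.subspace J" using J by (auto simp: SV.subspace_def SM.subspace_def)
  have K: "SV.subspace ?K" using J' subspace_grade SV.subspace_inter by blast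
  have "?K \<subseteq> SV.span ?W" using W by auto
  then obtain B0 where B0: "B0 \<subseteq> ?K" "finite B0" "SV.independent B0" "?K \<subseteq> SV.span B0" "card B0 = SV.dim ?K"
    using SV.finite_basisE[of ?K ?W] W by blast
  have spB0: "SV.span B0 = ?K" using B0(1,4) K by (metis SV.span_minimal subset_antisym)
  have card: "card B + SV.dim ?K = hS k" if B: "milnor_basis f k B" for B
  proof -
    have fin: "finite B" and BV: "B \<subseteq> ?V" and
      u: "\<And>p. p \<in> ?V \<Longrightarrow> \<exists>!c. (\<forall>b. b \<notin> B \<longrightarrow> c b = 0) \<and> p - (\<Sum>b\<in>B. Const (c b) * b) \<in> J"
      using B JJ by (auto simp: milnor_basis_def)
    \<comment> \<open>Uniqueness of the coefficients that represent \<open>0\<close> is linear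
      independence modulo \<open>J\<close>.\<close>
    have e: "\<forall>b\<in>B. c b = 0" if c: "(\<Sum>b\<in>B. Const (c b) * b) \<in> ?K" for c
    proof -
      let ?c = "\<lambda>b. if b \<in> B then c b else 0"
      have "0 - (\<Sum>b\<in>B. Const (?c b) * b) \<in> J" using c SM.subspace_neg[OF J] by simp
      moreover have "0 - (\<Sum>b\<in>B. Const 0 * b) \<in> J" using SM.subspace_0[OF J] by (simp add: Const_simps)
      moreover obtain c0 where
        "\<And>c. (\<forall>b. b \<notin> B \<longrightarrow> c b = 0) \<and> 0 - (\<Sum>b\<in>B. Const (c b) * b) \<in> J \<Longrightarrow> c = c0"
        using u[OF grade_0] by (elim ex1E) blast
      ultimately have "?c = c0" "(\<lambda>_. 0) = c0" by simp_all
      then have "?c = (\<lambda>_. 0)" by simp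
      then show ?thesis by (metis (full_types))
    qed
    note i = SV.independent_mod_subspace[OF K B0(1-3) fin, of "\<lambda>b. b", OF e, simplified]
    have "?V \<subseteq> SV.span (B \<union> B0)"
    proof
      fix p assume p: "p \<in> ?V"
      then obtain c where c: "p - (\<Sum>b\<in>B. Const (c b) * b) \<in> J" using u by blast
      have s: "(\<Sum>b\<in>B. Const (c b) * b) \<in> ?V" using BV by (auto intro!: grade_sum grade_Const_mult)
      then have "p - (\<Sum>b\<in>B. Const (c b) * b) \<in> SV.span B0" using c p spB0 by (simp add: grade_diff)
      then have "p - (\<Sum>b\<in>B. Const (c b) * b) \<in> SV.span (B \<union> B0)"
        by (rule subsetD[OF SV.span_mono, rotated]) simp
      moreover have "(\<Sum>b\<in>B. Const (c b) * b) \<in> SV.span (B \<union> B0)"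
        by (intro SV.span_sum SV.span_scale SV.span_base) auto
      ultimately have "p - (\<Sum>b\<in>B. Const (c b) * b) + (\<Sum>b\<in>B. Const (c b) * b) \<in> SV.span (B \<union> B0)"
        by (rule SV.span_add)
      then show "p \<in> SV.span (B \<union> B0)" by simp
    qed
    then have "SV.dim ?V = card (B \<union> B0)"
      using i B0(1) BV by (intro SV.dim_unique) auto
    also have "\<dots> = card B + card B0" using i fin B0(2) by (intro card_Un_disjoint) auto
    finally show ?thesis using B0(5) by (simp add: dim_grade)
  qed
  have "\<exists>B. milnor_basis f k B"
  proof -
    obtain C where C: "B0 \<subseteq> C" "C \<subseteq> ?V" "SV.independent C" "?V \<subseteq> SV.span C"
      using SV.maximal_independent_subset_extend[of B0 ?V] B0 by blast
    have finC: "finite C" using SV.independent_span_bound[OF W(1) C(3)] C(2) W(2) by blast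
    let ?B = "C - B0"
    have "\<exists>!c. (\<forall>b. b \<notin> ?B \<longrightarrow> c b = 0) \<and> p - (\<Sum>b\<in>?B. Const (c b) * b) \<in> J" if p: "p \<in> ?V" for p
    proof (rule ex_ex1I)
      obtain u where "p - (\<Sum>b\<in>?B. Const (u b) * b) \<in> SV.span B0"
        using SV.span_insert_splitE[OF finC C(1), of p] p C(4) by blast
      then show "\<exists>c. (\<forall>b. b \<notin> ?B \<longrightarrow> c b = 0) \<and> p - (\<Sum>b\<in>?B. Const (c b) * b) \<in> J"
        using spB0 by (intro exI[of _ "\<lambda>b. if b \<in> ?B then u b else 0"]) auto
    next
      fix c c' assume c: "(\<forall>b. b \<notin> ?B \<longrightarrow> c b = 0) \<and> p - (\<Sum>b\<in>?B. Const (c b) * b) \<in> J"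
        and c': "(\<forall>b. b \<notin> ?B \<longrightarrow> c' b = 0) \<and> p - (\<Sum>b\<in>?B. Const (c' b) * b) \<in> J"
      let ?s = "\<Sum>b\<in>?B. Const (c b - c' b) * b"
      have "?s = (p - (\<Sum>b\<in>?B. Const (c' b) * b)) - (p - (\<Sum>b\<in>?B. Const (c b) * b))"
        by (simp add: Const_simps left_diff_distrib sum_subtractf)
      also have "\<dots> \<in> J" by (rule SM.subspace_diff[OF J conjunct2[OF c'] conjunct2[OF c]])
      finally have "?s \<in> J" .
      moreover have "?s \<in> ?V" using C(2) by (auto intro!: grade_sum grade_Const_mult)
      ultimately have "?s \<in> SV.span B0" using spB0 by simp
      moreover have "?s \<in> SV.span ?B" by (intro SV.span_sum SV.span_scale SV.span_base) assumption
      ultimately have "?s = 0" using SV.span_disjoint_zero[OF finC C(3,1)] by blast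
      then have "c b - c' b = 0" if "b \<in> ?B" for b
        by (intro SV.independentD[OF C(3) _ Diff_subset _ that]) (simp_all add: finC)
      then have "c b = c' b" for b using c c' by (cases "b \<in> ?B") auto
      then show "c = c'" by (rule ext)
    qed
    then have "milnor_basis f k ?B" using finC C(2) by (auto simp: milnor_basis_def JJ)
    then show ?thesis by blast
  qed
  then obtain B where B: "milnor_basis f k B" by blast
  have "milnor_dim f k = card B"
    unfolding milnor_dim_def
  proof (rule the_equality)
    show "\<exists>A. milnor_basis f k A \<and> card A = card B" using B by blast
    fix n assume "\<exists>A. milnor_basis f k A \<and> card A = n"
    then show "n = card B" using card[OF B] card by (metis add_right_cancel)
  qed
  then show ?thesis using card[OF B] by simp
qed

section \<open>Growth of Hilbert functions\<close>

text \<open>The cubic has its zeros at \<open>-1, -2, -3\<close>, where \<open>hS\<close> is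
  \<open>0\<close> as well, so the formula already holds from \<open>-3\<close> on.\<close>

lemma hS_eq:
  assumes "- 3 \<le> k"
  shows "of_nat (hS k) = (of_int ((k + 1) * (k + 2) * (k + 3)) / 6 :: rat)"
proof (cases "k < 0")
  case True
  then have "k = -1 \<or> k = -2 \<or> k = -3" using assms by linarith
  then show ?thesis by (auto simp: hS_def)
next
  case False
  then obtain n where k: "k = int n" by (metis nonneg_int_cases not_less)
  have "(of_nat ((n + 3) choose 3) :: rat) = (\<Prod>i = 0..<3. of_nat (n + 3 - i) / of_nat (3 - i))"
    by (rule binomial_altdef_of_nat) simp
  also have "\<dots> = of_nat (n + 3) / 3 * (of_nat (n + 2) / 2) * of_nat (n + 1)"
    by (simp add: numeral_eq_Suc)
  finally show ?thesis by (simp add: hS_def k field_simps)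
qed

lemma hS_mono: "j \<le> k \<Longrightarrow> hS j \<le> hS k"
  unfolding hS_def by (auto intro!: binomial_right_mono)

lemma linear_not_quadratic:
  fixes a b :: rat
  assumes "\<And>k::int. K \<le> k \<Longrightarrow> of_int ((k + 1) * (k + 2)) / 2 \<le> a * of_int k + b"
  shows False
proof -
  \<comment> \<open>For \<open>k\<close> at least \<open>1\<close> and \<open>2|a| + 2|b|\<close>,
    twice the linear function is at most \<open>k^2\<close>, which is less than
    \<open>(k + 1) * (k + 2)\<close>.\<close>
  define A where "A = max 1 (\<lceil>2 * \<bar>a\<bar>\<rceil> + \<lceil>2 * \<bar>b\<bar>\<rceil>)"
  define k where "k = max K A"
  have k: "1 \<le> k" "K \<le> k" "\<lceil>2 * \<bar>a\<bar>\<rceil> + \<lceil>2 * \<bar>b\<bar>\<rceil> \<le> k" by (auto simp: k_def A_def)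
  have kr: "(1::rat) \<le> of_int k" using k(1) by simp
  have "2 * \<bar>a\<bar> + 2 * \<bar>b\<bar> \<le> of_int (\<lceil>2 * \<bar>a\<bar>\<rceil> + \<lceil>2 * \<bar>b\<bar>\<rceil>)"
    unfolding of_int_add by (intro add_mono le_of_int_ceiling)
  also have "\<dots> \<le> of_int k" using k(3) by (simp only: of_int_le_iff)
  finally have ab: "2 * \<bar>a\<bar> + 2 * \<bar>b\<bar> \<le> of_int k" .
  have "2 * (a * of_int k + b) \<le> 2 * \<bar>a\<bar> * of_int k + 2 * \<bar>b\<bar> * of_int k"
  proof (rule order_trans)
    show "2 * (a * of_int k + b) \<le> 2 * (\<bar>a\<bar> * of_int k + \<bar>b\<bar>)"
      using kr by (intro mult_left_mono add_mono mult_right_mono) auto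
    have "\<bar>b\<bar> * 1 \<le> \<bar>b\<bar> * of_int k" using kr by (intro mult_left_mono) auto
    then show "2 * (\<bar>a\<bar> * of_int k + \<bar>b\<bar>) \<le> 2 * \<bar>a\<bar> * of_int k + 2 * \<bar>b\<bar> * of_int k" by simp
  qed
  also have "\<dots> = (2 * \<bar>a\<bar> + 2 * \<bar>b\<bar>) * of_int k" by (simp add: algebra_simps)
  also have "\<dots> \<le> of_int k * of_int k" using ab kr by (intro mult_right_mono) auto
  also have "\<dots> < of_int ((k + 1) * (k + 2))" using kr by (simp add: algebra_simps)
  finally have "2 * (a * of_int k + b) < of_int ((k + 1) * (k + 2))" .
  moreover have "N / 2 \<le> X \<Longrightarrow> 2 * X < N \<Longrightarrow> False" for N X :: rat by linarith
  ultimately show False using assms[OF k(2)] by blast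
qed

lemma linear_unique:
  fixes a b a' b' :: rat
  assumes "\<And>k::int. K \<le> k \<Longrightarrow> a * of_int k + b = a' * of_int k + b'"
  shows "a = a'"
  using assms[of K] assms[of "K + 1"] by (simp add: algebra_simps)

lemma has_sing_degreeD:
  assumes "has_sing_degree f a"
  obtains b K where "\<And>k. K \<le> k \<Longrightarrow> of_nat (milnor_dim f k) = a * of_int k + b"
proof -
  obtain b where "\<forall>\<^sub>F k in sequentially. of_nat (milnor_dim f (int k)) = poly [:b, a:] (of_nat k)"
    using assms unfolding has_sing_degree_def hilbert_polynomial_def by blast
  then obtain N where N: "\<And>k. N \<le> k \<Longrightarrow> of_nat (milnor_dim f (int k)) = poly [:b, a:] (of_nat k)"
    unfolding eventually_sequentially by blast
  have "of_nat (milnor_dim f k) = a * of_int k + b" if "int N \<le> k" for k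
    using N[of "nat k"] that by (simp add: algebra_simps)
  then show ?thesis using that by blast
qed

lemma (in vector_space) dim_mono_finite:
  assumes "V \<subseteq> V'" "V' \<subseteq> span W" "finite W"
  shows "dim V \<le> dim V'"
proof -
  have "V \<subseteq> span W" using assms by auto
  then obtain B where "B \<subseteq> V" "independent B" "card B = dim V"
    using finite_basisE assms(3) by metis
  then show ?thesis using card_independent_le_dim[of B V' W] assms by auto
qed

lemma (in vector_space) dim_zero: "dim {0} = 0"
  using dim_unique[of "{}" "{0}" 0] by (simp add: independent_empty)

lemma linear_mult: "Vector_Spaces.linear (\<lambda>c (p::S). Const c * p) (\<lambda>c (p::S). Const c * p) ((*) g)"
  unfolding Vector_Spaces.linear_iff
  by (intro conjI vector_space_S allI) (simp_all only: ring_distribs ac_simps)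

lemma finite_span_grade: "\<exists>W. finite W \<and> grade k \<subseteq> SV.span W"
  using grade_finite_span finite_mons by blast

lemma dim_principal_le:
  assumes g: "g \<in> grade c" and X: "X \<subseteq> range ((*) g)"
  shows "SV.dim (grade k \<inter> X) \<le> hS (k - c)"
proof -
  obtain W where W: "finite W" "grade (k - c) \<subseteq> SV.span W" using finite_span_grade by blast
  have "x \<in> (*) g ` grade (k - c)" if x: "x \<in> grade k \<inter> X" for x
  proof -
    obtain y where y: "x = g * y" using x X by auto
    have "hc k x = g * hc (k - c) y" unfolding y by (rule hc_mult_grade[OF g])
    moreover have "hc k x = x" using x grade_hc_iff by blast
    ultimately have "x = g * hc (k - c) y" by simp
    then show ?thesis using hc_grade by blast
  qed
  then have "grade k \<inter> X \<subseteq> (*) g ` grade (k - c)" by blast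
  moreover have "(*) g ` grade (k - c) \<subseteq> grade k" using grade_mult[OF g] by fastforce
  moreover obtain W' where W': "finite W'" "grade k \<subseteq> SV.span W'" using finite_span_grade by blast
  ultimately have "SV.dim (grade k \<inter> X) \<le> SV.dim ((*) g ` grade (k - c))"
    by (intro SV.dim_mono_finite[OF _ _ W'(1)]) auto
  also have "\<dots> \<le> SV.dim (grade (k - c))"
    using vector_space_pair.rank_nullity[OF _ linear_mult subspace_grade W(2,1), of g]
    by (simp add: vector_space_pair_def vector_space_S)
  finally show ?thesis by (simp add: dim_grade)
qed

text \<open>A quotient of \<open>S\<close> whose Hilbert function grows linearly is not divided by a hypersurface:
  otherwise it would map onto \<open>S / (g)\<close>, whose Hilbert function grows quadratically.\<close>

lemma not_in_principal:
  fixes a b :: rat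
  assumes L: "\<And>k. L k + SV.dim (grade k \<inter> X) = hS k"
    and lin: "\<And>k. K \<le> k \<Longrightarrow> of_nat (L k) = a * of_int k + b"
    and g: "g \<in> grade c" "0 < c"
  shows "\<not> X \<subseteq> range ((*) g)"
proof
  assume X: "X \<subseteq> range ((*) g)"
  show False
  proof (rule linear_not_quadratic)
    fix k assume k: "max K 0 \<le> k"
    \<comment> \<open>As \<open>c\<close> is at least \<open>1\<close>, enlarging
      \<open>k - c\<close> to \<open>k - 1\<close> reduces to a linear form, and the difference that
      remains is the Hilbert function of a plane.\<close>
    have "hS k \<le> L k + hS (k - 1)"
      using L[of k] dim_principal_le[OF g(1) X, of k] hS_mono[of "k - c" "k - 1"] g(2) by linarith
    then have "(of_nat (hS k) :: rat) \<le> of_nat (L k) + of_nat (hS (k - 1))"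
      by (metis of_nat_add of_nat_le_iff)
    moreover have "of_nat (L k) = a * of_int k + b" using lin k by simp
    moreover have "(of_nat (hS k) :: rat) = of_int ((k + 1) * (k + 2) * (k + 3)) / 6"
      by (rule hS_eq) (use k in simp)
    moreover have "(of_nat (hS (k - 1)) :: rat) = of_int ((k - 1 + 1) * (k - 1 + 2) * (k - 1 + 3)) / 6"
      by (rule hS_eq) (use k in simp)
    moreover have "of_int ((k + 1) * (k + 2)) / 2 =
        (of_int ((k + 1) * (k + 2) * (k + 3)) / 6 - of_int ((k - 1 + 1) * (k - 1 + 2) * (k - 1 + 3)) / 6 :: rat)"
      by (simp add: algebra_simps add_divide_distrib)
    ultimately show "of_int ((k + 1) * (k + 2)) / 2 \<le> a * of_int k + b" by linarith
  qed
qed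

section \<open>The triple cross product\<close>

text \<open>The minor with rows \<open>a, b, c\<close> and columns \<open>i, j, k\<close>, expanded
  along \<open>c\<close>.\<close>

definition det3 :: "S^4 \<Rightarrow> S^4 \<Rightarrow> S^4 \<Rightarrow> 4 \<Rightarrow> 4 \<Rightarrow> 4 \<Rightarrow> S" where
  "det3 a b c i j k = (a $ i * b $ j - a $ j * b $ i) * c $ k - (a $ i * b $ k - a $ k * b $ i) * c $ j
     + (a $ j * b $ k - a $ k * b $ j) * c $ i"

text \<open>The cross product in dimension four: the vector of signed maximal minors, which is
  orthogonal to \<open>a\<close>, \<open>b\<close> and \<open>c\<close>. Up to signs it lists the
  coefficients of the triple wedge product of the corresponding one-forms.\<close>

definition cross :: "S^4 \<Rightarrow> S^4 \<Rightarrow> S^4 \<Rightarrow> S^4" where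
  "cross a b c = (\<chi> i. if i = 1 then det3 a b c 2 3 4 else if i = 2 then - det3 a b c 1 3 4
     else if i = 3 then det3 a b c 1 2 4 else - det3 a b c 1 2 3)"

lemma cross_nth:
  "cross a b c $ 1 = det3 a b c 2 3 4" "cross a b c $ 2 = - det3 a b c 1 3 4"
  "cross a b c $ 3 = det3 a b c 1 2 4" "cross a b c $ 4 = - det3 a b c 1 2 3"
  by (simp_all add: cross_def)

lemma det3_linear:
  "det3 a b (v + w) i j k = det3 a b v i j k + det3 a b w i j k"
  "det3 a b (p *s v) i j k = p * det3 a b v i j k"
  unfolding det3_def vector_add_component vector_smult_component by algebra+

lemma det3_self: "det3 a b a i j k = 0" "det3 a b b i j k = 0"
  unfolding det3_def by algebra+

lemma hom_cross: "module_hom (*s) (*s) (cross a b)"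
  by (rule hom_SnI) (simp_all add: vec_eq_iff forall_4 cross_nth det3_linear)

lemma cross_self: "cross a b a = 0" "cross a b b = 0"
  by (simp_all add: vec_eq_iff forall_4 cross_nth det3_self)

lemma det3_grade:
  assumes "\<And>i. a $ i \<in> grade p" "\<And>i. b $ i \<in> grade q" "\<And>i. c $ i \<in> grade r"
  shows "det3 a b c i j k \<in> grade (p + q + r)"
  unfolding det3_def
  by (intro grade_add grade_diff grade_mult assms)

lemma graded_hom_cross:
  assumes "\<And>i. a $ i \<in> grade p" "\<And>i. b $ i \<in> grade q"
  shows "graded_hom (\<lambda>_. 0) (\<lambda>_. p + q) (cross a b)"
  unfolding graded_hom_def
proof (intro conjI allI hom_cross subsetI)
  fix r x assume "x \<in> cross a b ` twisted_grade (\<lambda>_. 0) r"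
  then obtain c where c: "x = cross a b c" "\<And>i. c $ i \<in> grade r" by (auto simp: twisted_grade_def)
  show "x \<in> twisted_grade (\<lambda>_. p + q) r"
    using det3_grade[OF assms c(2)]
    by (auto simp: twisted_grade_def forall_4 c(1) cross_nth intro: grade_uminus simp: algebra_simps)
qed

text \<open>Over a field both vectors would lie in the orthogonal complement of
  \<open>a, b, c\<close>, generically a line. Over a ring the 2 x 2 minors of the two vectors are
  written as explicit combinations of the three vanishing inner products.\<close>

lemma cross_orthogonal:
  fixes a b c F :: "S^4"
  assumes "(\<Sum>i\<in>UNIV. a $ i * F $ i) = 0" "(\<Sum>i\<in>UNIV. b $ i * F $ i) = 0" "(\<Sum>i\<in>UNIV. c $ i * F $ i) = 0"
  shows "cross a b c $ i * F $ j = cross a b c $ j * F $ i"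
proof -
  obtain a1 a2 a3 a4 b1 b2 b3 b4 c1 c2 c3 c4 f1 f2 f3 f4
    where e: "a $ 1 = a1" "a $ 2 = a2" "a $ 3 = a3" "a $ 4 = a4" "b $ 1 = b1" "b $ 2 = b2" "b $ 3 = b3" "b $ 4 = b4"
      "c $ 1 = c1" "c $ 2 = c2" "c $ 3 = c3" "c $ 4 = c4" "F $ 1 = f1" "F $ 2 = f2" "F $ 3 = f3" "F $ 4 = f4"
    by blast
  have h: "a1 * f1 + a2 * f2 + a3 * f3 + a4 * f4 = 0" "b1 * f1 + b2 * f2 + b3 * f3 + b4 * f4 = 0"
    "c1 * f1 + c2 * f2 + c3 * f3 + c4 * f4 = 0"
    using assms by (simp_all add: sum_4 e)
  note s = cross_nth det3_def e
  define ra rb rc where r: "ra = a1 * f1 + a2 * f2 + a3 * f3 + a4 * f4"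
    "rb = b1 * f1 + b2 * f2 + b3 * f3 + b4 * f4" "rc = c1 * f1 + c2 * f2 + c3 * f3 + c4 * f4"
  have r0: "ra = 0" "rb = 0" "rc = 0" using h by (simp_all add: r)
  \<comment> \<open>The right-hand side is the 3 x 3 determinant with columns
    \<open>(ra, rb, rc)\<close> and the columns of the two remaining indices. It vanishes with its
    first column, and the other five pairs are analogous up to sign.\<close>
  have "cross a b c $ 1 * F $ 2 - cross a b c $ 2 * F $ 1 =
       ((ra * b3 - a3 * rb) * c4 - (ra * b4 - a4 * rb) * c3 + (a3 * b4 - a4 * b3) * rc)"
    unfolding s r by algebra
  then have 12: "cross a b c $ 1 * F $ 2 = cross a b c $ 2 * F $ 1" by (simp add: r0)
  have "cross a b c $ 1 * F $ 3 - cross a b c $ 3 * F $ 1 =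
      - ((ra * b2 - a2 * rb) * c4 - (ra * b4 - a4 * rb) * c2 + (a2 * b4 - a4 * b2) * rc)"
    unfolding s r by algebra
  then have 13: "cross a b c $ 1 * F $ 3 = cross a b c $ 3 * F $ 1" by (simp add: r0)
  have "cross a b c $ 1 * F $ 4 - cross a b c $ 4 * F $ 1 =
       ((ra * b2 - a2 * rb) * c3 - (ra * b3 - a3 * rb) * c2 + (a2 * b3 - a3 * b2) * rc)"
    unfolding s r by algebra
  then have 14: "cross a b c $ 1 * F $ 4 = cross a b c $ 4 * F $ 1" by (simp add: r0)
  have "cross a b c $ 2 * F $ 3 - cross a b c $ 3 * F $ 2 =
       ((ra * b1 - a1 * rb) * c4 - (ra * b4 - a4 * rb) * c1 + (a1 * b4 - a4 * b1) * rc)"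
    unfolding s r by algebra
  then have 23: "cross a b c $ 2 * F $ 3 = cross a b c $ 3 * F $ 2" by (simp add: r0)
  have "cross a b c $ 2 * F $ 4 - cross a b c $ 4 * F $ 2 =
      - ((ra * b1 - a1 * rb) * c3 - (ra * b3 - a3 * rb) * c1 + (a1 * b3 - a3 * b1) * rc)"
    unfolding s r by algebra
  then have 24: "cross a b c $ 2 * F $ 4 = cross a b c $ 4 * F $ 2" by (simp add: r0)
  have "cross a b c $ 3 * F $ 4 - cross a b c $ 4 * F $ 3 =
       ((ra * b1 - a1 * rb) * c2 - (ra * b2 - a2 * rb) * c1 + (a1 * b2 - a2 * b1) * rc)"
    unfolding s r by algebra
  then have 34: "cross a b c $ 3 * F $ 4 = cross a b c $ 4 * F $ 3" by (simp add: r0)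
  show ?thesis using exhaust_4[of i] exhaust_4[of j] 12 13 14 23 24 34 by auto
qed

section \<open>Wedge products of one-forms in coordinates\<close>

lemma one_form_single: "one_form \<rho> {i} = \<rho> $ i"
  by (simp add: one_form_def dvar_def if_distrib[of "\<lambda>x. _ * x"] cong: if_cong)

lemma one_form_other: "card I \<noteq> 1 \<Longrightarrow> one_form \<rho> I = 0"
  unfolding one_form_def dvar_def by (intro sum.neutral) auto

lemma wedge_one_form: "wedge \<eta> (one_form \<rho>) I = (\<Sum>k\<in>I. wedge_sign (I - {k}) {k} * \<eta> (I - {k}) * \<rho> $ k)"
proof -
  have *: "I - (I - {k}) = {k}" if "k \<in> I" for k using that by auto
  have "wedge \<eta> (one_form \<rho>) I = (\<Sum>J\<in>(\<lambda>k. I - {k}) ` I. wedge_sign J (I - J) * \<eta> J * one_form \<rho> (I - J))"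
    unfolding wedge_def
  proof (rule sum.mono_neutral_right)
    show "\<forall>J\<in>Pow I - (\<lambda>k. I - {k}) ` I. wedge_sign J (I - J) * \<eta> J * one_form \<rho> (I - J) = 0"
    proof
      fix J assume J: "J \<in> Pow I - (\<lambda>k. I - {k}) ` I"
      have "card (I - J) \<noteq> 1"
      proof
        assume "card (I - J) = 1"
        then obtain k where "I - J = {k}" by (auto simp: card_1_singleton_iff)
        then have "J = I - {k}" "k \<in> I" using J by auto
        then show False using J by auto
      qed
      then show "wedge_sign J (I - J) * \<eta> J * one_form \<rho> (I - J) = 0" by (simp add: one_form_other)
    qed
  qed auto
  also have "\<dots> = (\<Sum>k\<in>I. wedge_sign (I - {k}) (I - (I - {k})) * \<eta> (I - {k}) * one_form \<rho> (I - (I - {k})))"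
    by (subst sum.reindex) (auto simp: inj_on_def)
  also have "\<dots> = (\<Sum>k\<in>I. wedge_sign (I - {k}) {k} * \<eta> (I - {k}) * \<rho> $ k)"
    by (rule sum.cong) (auto simp: * one_form_single)
  finally show ?thesis .
qed

text \<open>The sign that sorts a product of two differentials. The order on the type
  \<open>4\<close> places \<open>4 = 0\<close> before \<open>1\<close>. Keeping signs symbolic makes
  the computation depend only on linearity of the order.\<close>

definition sg :: "4 \<Rightarrow> 4 \<Rightarrow> S" where "sg i j = (if j < i then - 1 else 1)"

lemma sg_swap: "i \<noteq> j \<Longrightarrow> sg j i = - sg i j"
  by (auto simp: sg_def)

lemma wedge_sign_single: "wedge_sign J {k} = (\<Prod>j\<in>J. sg j k)"
proof -
  have fin: "finite J" by (rule finite)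
  have "{(j, l). j \<in> J \<and> l \<in> {k} \<and> l < j} = (\<lambda>j. (j, k)) ` {j \<in> J. k < j}" by auto
  then have "card {(j, l). j \<in> J \<and> l \<in> {k} \<and> l < j} = card {j \<in> J. k < j}"
    by (simp add: card_image inj_on_def)
  then have "wedge_sign J {k} = (\<Prod>j\<in>{j \<in> J. k < j}. - 1)" by (simp add: wedge_sign_def)
  also have "\<dots> = (\<Prod>j\<in>J. sg j k)"
    unfolding sg_def by (rule prod.inter_filter[OF fin])
  finally show ?thesis .
qed

lemma wedge_2:
  assumes "i \<noteq> j"
  shows "wedge (one_form a) (one_form b) {i, j} = sg i j * (a $ i * b $ j - a $ j * b $ i)"
proof -
  have "{i, j} - {i} = {j}" "{i, j} - {j} = {i}" using assms by auto
  then have "wedge (one_form a) (one_form b) {i, j} = sg j i * a $ j * b $ i + sg i j * a $ i * b $ j"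
    using assms by (simp add: wedge_one_form wedge_sign_single one_form_single)
  then show ?thesis unfolding sg_swap[OF assms] by algebra
qed

lemma wedge_2_other:
  assumes "card I \<noteq> 2"
  shows "wedge (one_form a) (one_form b) I = 0"
  unfolding wedge_one_form
proof (intro sum.neutral ballI)
  fix k assume "k \<in> I"
  then have "card (I - {k}) \<noteq> 1" using assms by (auto simp: card_Diff_singleton_if)
  then show "wedge_sign (I - {k}) {k} * one_form a (I - {k}) * b $ k = 0" by (simp add: one_form_other)
qed

text \<open>Moving the third form past the others produces the same three signs in each summand, so
  they factor out of the expansion of \<open>det3\<close> along \<open>c\<close>.\<close>

lemma wedge_3:
  assumes "i \<noteq> j" "i \<noteq> k" "j \<noteq> k"
  shows "wedge (wedge (one_form a) (one_form b)) (one_form c) {i, j, k} =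
    sg i j * sg i k * sg j k * det3 a b c i j k"
proof -
  have d: "{i, j, k} - {i} = {j, k}" "{i, j, k} - {j} = {i, k}" "{i, j, k} - {k} = {i, j}"
    using assms by auto
  have s: "sg j i = - sg i j" "sg k i = - sg i k" "sg k j = - sg j k"
    by (fact sg_swap[OF assms(1)] sg_swap[OF assms(2)] sg_swap[OF assms(3)])+
  have "wedge (wedge (one_form a) (one_form b)) (one_form c) {i, j, k} =
      - sg i j * - sg i k * (sg j k * (a $ j * b $ k - a $ k * b $ j)) * c $ i
      + (sg i j * - sg j k * (sg i k * (a $ i * b $ k - a $ k * b $ i)) * c $ j
      + sg i k * sg j k * (sg i j * (a $ i * b $ j - a $ j * b $ i)) * c $ k)"
    unfolding wedge_one_form[of "wedge _ _"]
    using assms by (simp only: sum.insert finite_insert finite.emptyI sum.empty insert_iff empty_iff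
      prod.insert prod.empty simp_thms d wedge_2 wedge_sign_single s not_False_eq_True mult_1_right add_0_right)
  then show ?thesis unfolding det3_def by algebra
qed

text \<open>A three-form in four variables has four coefficients, indexed by the complements of
  single indices. Up to sign they are the entries of \<open>cross\<close>.\<close>

lemma wedge_3_eq_0:
  assumes "cross a b c = 0"
  shows "wedge (wedge (one_form a) (one_form b)) (one_form c) = (\<lambda>_. 0)"
proof
  fix I
  show "wedge (wedge (one_form a) (one_form b)) (one_form c) I = 0"
  proof (cases "card I = 3")
    case True
    have "card (- I) = 1" using True card_Un_disjoint[of I "- I"] by (simp add: Compl_partition)
    then obtain l where "- I = {l}" by (auto simp: card_1_singleton_iff)
    then have "I = UNIV - {l}" by auto
    moreover have "UNIV - {1} = {2, 3, 4 :: 4}" "UNIV - {2} = {1, 3, 4 :: 4}"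
      "UNIV - {3} = {1, 2, 4 :: 4}" "UNIV - {4} = {1, 2, 3 :: 4}"
      unfolding UNIV_4 by (simp_all add: insert_Diff_if)
    ultimately have "I = {2, 3, 4} \<or> I = {1, 3, 4} \<or> I = {1, 2, 4} \<or> I = {1, 2, 3}"
      using exhaust_4[of l] by (elim disjE) simp_all
    moreover have "det3 a b c 2 3 4 = 0" "det3 a b c 1 3 4 = 0" "det3 a b c 1 2 4 = 0" "det3 a b c 1 2 3 = 0"
      using assms cross_nth[of a b c] by auto
    ultimately show ?thesis by (elim disjE) (simp_all add: wedge_3)
  next
    case False
    show ?thesis unfolding wedge_one_form[of "wedge _ _"]
    proof (intro sum.neutral ballI)
      fix k assume "k \<in> I"
      then have "card (I - {k}) \<noteq> 2" using False by (auto simp: card_Diff_singleton_if)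
      then show "wedge_sign (I - {k}) {k} * wedge (one_form a) (one_form b) (I - {k}) * c $ k = 0"
        by (simp add: wedge_2_other)
    qed
  qed
qed

lemma tame_cross:
  assumes "tame f \<rho>1 \<rho>2" "\<rho> \<in> AR f" "cross \<rho>1 \<rho>2 \<rho> = 0"
  obtains a b where "\<rho> = a *s \<rho>1 + b *s \<rho>2"
proof -
  have "one_form \<rho> \<in> {\<omega>\<in>one_form ` AR f. wedge (wedge (one_form \<rho>1) (one_form \<rho>2)) \<omega> = (\<lambda>_. 0)}"
    using assms(2) wedge_3_eq_0[OF assms(3)] by blast
  then have "one_form \<rho> \<in> range (\<lambda>(a, b). \<lambda>I. a * one_form \<rho>1 I + b * one_form \<rho>2 I)"
    using assms(1) by (simp only: tame_def)
  then obtain a b where "one_form \<rho> = (\<lambda>I. a * one_form \<rho>1 I + b * one_form \<rho>2 I)" by auto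
  then have "\<rho> $ i = a * \<rho>1 $ i + b * \<rho>2 $ i" for i
    by (metis one_form_single)
  then show ?thesis using that[of a b] by (simp add: vec_eq_iff)
qed

section \<open>Jacobian syzygies as an extension of an ideal\<close>

lemma jac_map_simps:
  "jac_map f (v + w) = jac_map f v + jac_map f w" "jac_map f (p *s v) = p * jac_map f v"
  "jac_map f 0 = 0" "jac_map f (v - w) = jac_map f v - jac_map f w"
proof -
  show 1: "jac_map f (v + w) = jac_map f v + jac_map f w" for v w
    by (simp only: jac_map_def vector_add_component distrib_right sum.distrib)
  show "jac_map f (p *s v) = p * jac_map f v"
    by (simp only: jac_map_def vector_smult_component mult.assoc sum_distrib_left)
  show "jac_map f 0 = 0" by (simp add: jac_map_def)
  show "jac_map f (v - w) = jac_map f v - jac_map f w" using 1[of "v - w" w] by simp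
qed

lemma linear_jac_map:
  "Vector_Spaces.linear (\<lambda>c (v::S^4). Const c *s v) (\<lambda>c (p::S). Const c * p) (jac_map f)"
  unfolding Vector_Spaces.linear_iff
  by (intro conjI vector_space_S vector_space_Sn allI) (simp_all add: jac_map_simps)

lemma AR_add: "v \<in> AR f \<Longrightarrow> w \<in> AR f \<Longrightarrow> v + w \<in> AR f"
  and AR_diff: "v \<in> AR f \<Longrightarrow> w \<in> AR f \<Longrightarrow> v - w \<in> AR f"
  and AR_smult: "v \<in> AR f \<Longrightarrow> p *s v \<in> AR f"
  and AR_0: "0 \<in> AR f"
  by (simp_all add: AR_def jac_map_simps)

lemma AR_smult_cancel: "p *s v \<in> AR f \<Longrightarrow> p \<noteq> 0 \<Longrightarrow> v \<in> AR f"
  by (simp add: AR_def jac_map_simps)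

lemma subspace_range_jac_map: "SM.subspace (range (jac_map f))"
  unfolding SM.subspace_def by (metis (no_types, lifting) jac_map_simps(1-3) rangeE rangeI)

lemma jac_ideal_eq: "jac_ideal f = range (jac_map f)"
proof
  have "partial i f \<in> range (jac_map f)" for i
  proof -
    have "jac_map f (axis i 1) = (\<Sum>j\<in>UNIV. if j = i then partial i f else 0)"
      unfolding jac_map_def by (rule sum.cong) (auto simp: axis_def)
    then have "jac_map f (axis i 1) = partial i f" by simp
    then show ?thesis by (rule range_eqI[OF sym])
  qed
  then show "jac_ideal f \<subseteq> range (jac_map f)"
    unfolding jac_ideal_def by (intro SM.span_minimal subspace_range_jac_map) blast
  show "range (jac_map f) \<subseteq> jac_ideal f"
    unfolding jac_ideal_def jac_map_def
    by (rule image_subsetI, rule SM.span_sum, rule SM.span_scale, rule SM.span_base) simp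
qed

lemma AR_grade_iff: "\<rho> \<in> AR_grade f q \<longleftrightarrow> \<rho> \<in> AR f \<and> \<rho> \<in> twisted_grade (\<lambda>_. 0) q"
  by (auto simp: AR_grade_def twisted_grade_def)

lemma subspace_AR_grade: "SnV.subspace (AR_grade f q)"
proof -
  have "AR_grade f q = AR f \<inter> twisted_grade (\<lambda>_. 0) q" using AR_grade_iff by blast
  moreover have "SnV.subspace (AR f)" by (simp add: SnV.subspace_def AR_0 AR_add AR_smult)
  ultimately show ?thesis using SnV.subspace_inter[OF _ subspace_twisted_grade] by simp
qed

lemma hc_jac_map:
  assumes "f \<in> grade d"
  shows "hc (q + (d - 1)) (jac_map f v) = jac_map f (hcv (\<lambda>_. 0) q v)"
proof -
  have "hc (q + (d - 1)) (v $ i * partial i f) = hc q (v $ i) * partial i f" for i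
    using hc_mult_grade_right[OF partial_grade[OF assms], of "q + (d - 1)" "v $ i" i] by simp
  then show ?thesis by (simp add: jac_map_def hc_sum)
qed

lemma AR_hcv: "f \<in> grade d \<Longrightarrow> \<rho> \<in> AR f \<Longrightarrow> hcv (\<lambda>_. 0) q \<rho> \<in> AR_grade f q"
  using hc_jac_map[of f d q \<rho>] by (simp add: AR_grade_iff hcv_grade) (simp add: AR_def)

text \<open>Partial derivatives have degree \<open>d - 1\<close>, so degree \<open>k\<close> of the
  Jacobian ideal is the image of the vectors of degree \<open>k - (d - 1)\<close>, with kernel the
  syzygies of that degree.\<close>

lemma milnor_dim_AR:
  assumes f: "f \<in> grade d"
  shows "int (milnor_dim f k) = int (hS k) - 4 * int (hS (k - (d - 1))) + int (SnV.dim (AR_grade f (k - (d - 1))))"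
proof -
  let ?q = "k - (d - 1)" and ?V = "twisted_grade (\<lambda>_::4. 0) (k - (d - 1))"
  obtain W where W: "finite W" "?V \<subseteq> SnV.span W" using twisted_grade_finite_span by blast
  have "{v \<in> ?V. jac_map f v = 0} = AR_grade f ?q" by (auto simp: AR_grade_iff AR_def)
  moreover have "jac_map f ` ?V = grade k \<inter> range (jac_map f)"
  proof (intro equalityI subsetI)
    fix x assume "x \<in> jac_map f ` ?V"
    then obtain v where v: "x = jac_map f v" "hcv (\<lambda>_. 0) ?q v = v" by (auto simp: twisted_grade_hcv_iff)
    then have "hc k x = x" using hc_jac_map[OF f, of ?q v] by simp
    then show "x \<in> grade k \<inter> range (jac_map f)" using v by (auto simp: grade_hc_iff)
  next
    fix x assume "x \<in> grade k \<inter> range (jac_map f)"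
    then obtain v where v: "x = jac_map f v" "hc k x = x" by (auto simp: grade_hc_iff)
    then have "x = jac_map f (hcv (\<lambda>_. 0) ?q v)" using hc_jac_map[OF f, of ?q v] by simp
    then show "x \<in> jac_map f ` ?V" using hcv_grade by blast
  qed
  ultimately have "SnV.dim ?V = SnV.dim (AR_grade f ?q) + SV.dim (grade k \<inter> range (jac_map f))"
    using vector_space_pair.rank_nullity[OF _ linear_jac_map subspace_twisted_grade W(2,1), of f]
    by (simp add: vector_space_pair_def vector_space_S vector_space_Sn)
  then show ?thesis
    using milnor_dim_eq[OF subspace_range_jac_map jac_ideal_eq, of f k] by (simp add: dim_twisted_grade)
qed

lemma dim_grade_Int_le: "SV.dim (grade k \<inter> X) \<le> hS k"
proof -
  obtain W where W: "finite W" "grade k \<subseteq> SV.span W" using finite_span_grade by blast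
  then show ?thesis using SV.dim_mono_finite[OF Int_lower1 W(2,1), of X] by (simp add: dim_grade)
qed

text \<open>The Hilbert function of \<open>S / X\<close>. The bound just proved ensures that the
  natural subtraction is not truncated.\<close>

definition hilbert_quotient :: "S set \<Rightarrow> int \<Rightarrow> nat" where
  "hilbert_quotient X k = hS k - SV.dim (grade k \<inter> X)"

lemma hilbert_quotient: "hilbert_quotient X k + SV.dim (grade k \<inter> X) = hS k"
  using dim_grade_Int_le[of k X] by (simp add: hilbert_quotient_def)

lemma linear_smult: "Vector_Spaces.linear (\<lambda>c (p::S). Const c * p) (\<lambda>c (v::S^'n). Const c *s v) (\<lambda>h. h *s F)"
  unfolding Vector_Spaces.linear_iff
  by (intro conjI vector_space_S vector_space_Sn allI) (simp_all add: vec_eq_iff distrib_right mult.assoc)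

lemma dim_smult_image:
  fixes v :: "S^'n"
  assumes V: "SV.subspace V" "V \<subseteq> grade k" and v: "v \<noteq> 0"
  shows "SnV.dim ((\<lambda>h. h *s v) ` V) = SV.dim V"
proof -
  obtain W where W: "finite W" "grade k \<subseteq> SV.span W" using finite_span_grade by blast
  have "h *s v = 0 \<longleftrightarrow> h = 0" for h using v by (auto simp: vec_eq_iff)
  then have "{h \<in> V. h *s v = 0} = {0}" using SV.subspace_0[OF V(1)] by blast
  moreover have "V \<subseteq> SV.span W" using V(2) W(2) by blast
  ultimately show ?thesis
    using vector_space_pair.rank_nullity[OF _ linear_smult V(1) _ W(1), of v]
    by (simp add: vector_space_pair_def vector_space_S vector_space_Sn SV.dim_zero)
qed

text \<open>The homomorphism whose matrix has columns \<open>R j\<close>. The maps of the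
  resolutions constructed below have this form.\<close>

definition comb :: "('m::finite \<Rightarrow> S^'n) \<Rightarrow> S^'m \<Rightarrow> S^'n" where
  "comb R v = (\<Sum>j\<in>UNIV. v $ j *s R j)"

lemma comb_nth: "comb R v $ i = (\<Sum>j\<in>UNIV. v $ j * R j $ i)"
  by (simp add: comb_def)

lemma graded_hom_comb:
  assumes "\<And>j i. R j $ i \<in> grade (t i - s j)"
  shows "graded_hom s t (comb R)"
  unfolding graded_hom_def
proof (intro conjI allI hom_SnI subsetI)
  show "comb R (v + v') = comb R v + comb R v'" for v v'
    by (simp add: vec_eq_iff comb_nth distrib_right sum.distrib)
  show "comb R (c *s v) = c *s comb R v" for c v
    by (simp only: vec_eq_iff comb_nth vector_smult_component sum_distrib_left mult.assoc simp_thms)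
  fix k x assume "x \<in> comb R ` twisted_grade s k"
  then obtain v where v: "x = comb R v" "\<And>j. v $ j \<in> grade (k + s j)"
    by (auto simp: twisted_grade_def)
  have "v $ j * R j $ i \<in> grade (k + t i)" for i j
    using grade_mult[OF v(2) assms, of j j i] by simp
  then show "x \<in> twisted_grade t k" by (simp add: v(1) comb_nth twisted_grade_def grade_sum)
qed

lemma dim_comb_pair:
  assumes "u \<in> twisted_grade t p" "w \<in> twisted_grade t q"
    and "\<And>a b. a *s u + b *s w = 0 \<Longrightarrow> a = 0 \<and> b = 0"
  shows "SnV.dim (twisted_grade t k \<inter> {a *s u + b *s w | a b. True}) = hS (k - p) + hS (k - q)"
proof -
  let ?s = "\<lambda>i::2. if i = 1 then - p else - q" and ?R = "\<lambda>i::2. if i = 1 then u else w"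
  have c: "comb ?R v = v $ 1 *s u + v $ 2 *s w" for v by (simp add: comb_def sum_2)
  have "graded_hom ?s t (comb ?R)"
    by (rule graded_hom_comb) (use assms in \<open>auto simp: twisted_grade_def add.commute\<close>)
  note dim_graded_hom[OF this, of k]
  moreover have "{v \<in> twisted_grade ?s k. comb ?R v = 0} = {0}"
  proof -
    have "comb ?R v = 0 \<longleftrightarrow> v = 0" for v
      using assms(3)[of "v $ 1" "v $ 2"] by (auto simp: c vec_eq_iff[of v] forall_2)
    moreover have "0 \<in> twisted_grade ?s k" by (simp add: twisted_grade_def)
    ultimately show ?thesis by blast
  qed
  moreover have "range (comb ?R) = {a *s u + b *s w | a b. True}"
  proof (intro equalityI subsetI)
    fix x assume "x \<in> {a *s u + b *s w | a b. True}"
    then obtain a b where "x = a *s u + b *s w" by auto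
    then have "x = comb ?R (vector [a, b])" by (simp add: c)
    then show "x \<in> range (comb ?R)" by blast
  qed (auto simp: c)
  ultimately show ?thesis by (simp add: UNIV_2 SnV.dim_zero)
qed

text \<open>The number \<open>e3\<close> is a degree shift: for a syzygy of degree \<open>q\<close>
  the triple product has degree \<open>q + e1 + e2\<close> and the gradient has degree
  \<open>d - 1\<close>, so the factor between them has degree \<open>q - e3\<close>.\<close>

locale tame_surface =
  fixes f :: S and \<rho>1 \<rho>2 :: "S^4" and d e1 e2 e3 :: int and a :: rat
  assumes f: "f \<in> grade d" and deg: "has_sing_degree f a"
    and rho1: "first_syzygy f \<rho>1 e1" and rho2: "second_syzygy f \<rho>1 \<rho>2 e2"
    and tame: "tame f \<rho>1 \<rho>2" and e3: "e3 = d - 1 - e1 - e2"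
begin

definition F :: "S^4" where "F = (\<chi> i. partial i f)"

lemma F_grade: "F $ i \<in> grade (d - 1)"
  by (simp add: F_def partial_grade[OF f])

lemma F_twisted: "F \<in> twisted_grade (\<lambda>_. e1 + e2) e3"
  using F_grade by (simp add: twisted_grade_def e3)

lemma jac_map_F: "jac_map f v = (\<Sum>i\<in>UNIV. v $ i * F $ i)"
  by (simp add: jac_map_def F_def)

lemma range_jac_not_in_principal:
  assumes "g \<in> grade c" "0 < c"
  shows "\<not> range (jac_map f) \<subseteq> range ((*) g)"
proof -
  obtain b K where "\<And>k. K \<le> k \<Longrightarrow> of_nat (milnor_dim f k) = a * of_int k + b"
    using has_sing_degreeD[OF deg] by metis
  then show ?thesis
    using not_in_principal[OF milnor_dim_eq[OF subspace_range_jac_map jac_ideal_eq] _ assms] by blast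
qed

lemma F_nonzero: "F \<noteq> 0"
proof
  assume "F = 0"
  then have "range (jac_map f) \<subseteq> range ((*) (Var 1))"
    by (auto simp: jac_map_F intro: range_eqI[of _ _ 0])
  then show False using range_jac_not_in_principal[OF Var_grade[of 1]] by simp
qed

lemma smult_F_cancel: "h *s F = h' *s F \<longleftrightarrow> h = h'"
  using F_nonzero by (auto simp: vec_eq_iff)

text \<open>A common factor \<open>g\<close> of the partial derivatives is homogeneous, and positive
  degree would put the Jacobian ideal inside a principal one. So \<open>g\<close> is a unit, and
  proportionality to the primitive vector \<open>F'\<close> yields a multiple of \<open>F\<close>
  itself.\<close>

lemma proportional_F:
  assumes "\<And>i j. A $ i * F $ j = A $ j * F $ i"
  obtains h where "A = h *s F"
proof -
  obtain g F' where g: "F = g *s F'"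
    and A: "\<And>A. (\<And>i j. A $ i * F' $ j = A $ j * F' $ i) \<Longrightarrow> \<exists>h. A = h *s F'"
    using S_gcd_vector[OF F_nonzero] by metis
  obtain i where i: "F $ i \<noteq> 0" using F_nonzero by (auto simp: vec_eq_iff)
  then have nz: "g \<noteq> 0" "F' $ i \<noteq> 0" using g by (auto simp: vec_eq_iff)
  have gi: "g * F' $ i \<in> grade (d - 1)" using F_grade[of i] unfolding g by simp
  obtain c where c: "g \<in> grade c" using grade_factor[OF gi nz] by blast
  have "range (jac_map f) \<subseteq> range ((*) g)"
  proof
    fix x assume "x \<in> range (jac_map f)"
    then obtain v where "x = (\<Sum>i\<in>UNIV. v $ i * F $ i)" by (auto simp: jac_map_F)
    also have "\<dots> = g * (\<Sum>i\<in>UNIV. v $ i * F' $ i)"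
      unfolding sum_distrib_left by (rule sum.cong) (simp_all add: g mult.left_commute)
    finally show "x \<in> range ((*) g)" by blast
  qed
  then have "\<not> 0 < c" using range_jac_not_in_principal[OF c] by blast
  then obtain r where inv: "r * g = 1" using homogeneous_unit[OF c nz(1)] by blast
  have "A $ i * F' $ j = A $ j * F' $ i" for i j
  proof -
    have "g * (A $ i * F' $ j) = g * (A $ j * F' $ i)" using assms[of i j] by (simp add: g mult.left_commute)
    then show ?thesis using nz by simp
  qed
  then obtain h where h: "A = h *s F'" using A by blast
  have "h * F' $ i = h * r * (g * F' $ i)" for i
    using inv by algebra
  then have "A = (h * r) *s F" by (simp add: h g vec_eq_iff)
  then show ?thesis using that by blast
qed

lemma rho1_AR: "\<rho>1 \<in> AR f" and rho1_grade: "\<rho>1 $ i \<in> grade e1" and rho1_nonzero: "\<rho>1 \<noteq> 0"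
  and rho2_AR: "\<rho>2 \<in> AR f" and rho2_grade: "\<rho>2 $ i \<in> grade e2"
  using rho1 rho2 by (auto simp: first_syzygy_def second_syzygy_def AR_grade_def)

lemma rho2_not_multiple: "\<rho>2 \<noteq> h *s \<rho>1"
  using rho2 by (auto simp: second_syzygy_def SnM.span_singleton)

lemma cross_AR:
  assumes "\<rho> \<in> AR f"
  obtains h where "cross \<rho>1 \<rho>2 \<rho> = h *s F"
proof (rule proportional_F)
  show "cross \<rho>1 \<rho>2 \<rho> $ i * F $ j = cross \<rho>1 \<rho>2 \<rho> $ j * F $ i" for i j
    using rho1_AR rho2_AR assms by (intro cross_orthogonal) (simp_all add: AR_def jac_map_F)
qed

text \<open>Divide \<open>\<rho>1\<close> by its gcd \<open>g\<close>: the quotient is again a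
  syzygy, so minimality of \<open>e1\<close> makes \<open>g\<close> a unit. A relation with
  \<open>q\<close> nonzero would then make \<open>\<rho>2\<close> a multiple of
  \<open>\<rho>1\<close>, against its choice.\<close>

lemma rho_independent:
  assumes "p *s \<rho>1 + q *s \<rho>2 = 0"
  shows "p = 0 \<and> q = 0"
proof -
  have q0: "q = 0"
  proof (rule ccontr)
    assume q: "q \<noteq> 0"
    have pq: "q * \<rho>2 $ i = - p * \<rho>1 $ i" for i
      using arg_cong[OF assms, of "\<lambda>v. v $ i"] by (simp add: add_eq_0_iff add.commute)
    obtain g \<sigma> where g: "\<rho>1 = g *s \<sigma>"
      and A: "\<And>A. (\<And>i j. A $ i * \<sigma> $ j = A $ j * \<sigma> $ i) \<Longrightarrow> \<exists>h. A = h *s \<sigma>"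
      using S_gcd_vector[OF rho1_nonzero] by metis
    obtain i where "\<rho>1 $ i \<noteq> 0" using rho1_nonzero by (auto simp: vec_eq_iff)
    then have nz: "g \<noteq> 0" "\<sigma> $ i \<noteq> 0" using g by (auto simp: vec_eq_iff)
    have gi: "g * \<sigma> $ i \<in> grade e1" for i using rho1_grade[of i] unfolding g by simp
    obtain c where c: "g \<in> grade c" using grade_factor[OF gi nz] by blast
    have "\<sigma> $ j \<in> grade (e1 - c)" for j
    proof -
      have "g * \<sigma> $ j = g * hc (e1 - c) (\<sigma> $ j)"
        unfolding hc_mult_grade[OF c, of e1 "\<sigma> $ j", symmetric] using gi[of j] by (simp only: grade_hc_iff)
      then have "hc (e1 - c) (\<sigma> $ j) = \<sigma> $ j" using nz by simp
      then show ?thesis by (simp only: grade_hc_iff)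
    qed
    moreover have "\<sigma> \<in> AR f" using AR_smult_cancel rho1_AR g nz by blast
    moreover have "\<sigma> \<noteq> 0" using nz by auto
    ultimately have "\<sigma> \<in> AR_grade f (e1 - c)" "\<sigma> \<noteq> 0" by (simp_all add: AR_grade_def)
    then have "e1 \<le> e1 - c" using rho1 unfolding first_syzygy_def by blast
    then have "\<not> 0 < c" by simp
    then obtain r where inv: "r * g = 1" using homogeneous_unit[OF c nz(1)] by blast
    have "\<rho>2 $ i * \<sigma> $ j = \<rho>2 $ j * \<sigma> $ i" for i j
    proof -
      have "q * (\<rho>2 $ i * \<sigma> $ j) = q * (\<rho>2 $ j * \<sigma> $ i)"
        using pq[of i] pq[of j] unfolding g vector_smult_component by algebra
      then show ?thesis using q by simp
    qed
    then obtain h where h: "\<rho>2 = h *s \<sigma>" using A by blast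
    have "h * \<sigma> $ i = h * r * (g * \<sigma> $ i)" for i
      using inv by algebra
    then have "\<rho>2 = (h * r) *s \<rho>1" by (simp add: h g vec_eq_iff)
    then show False using rho2_not_multiple by blast
  qed
  then show ?thesis using assms rho1_nonzero by (auto simp: vec_eq_iff)
qed

definition I :: "S set" where "I = {h. \<exists>\<rho>\<in>AR f. cross \<rho>1 \<rho>2 \<rho> = h *s F}"

lemmas cross_simps = hom_Sn_simps[OF hom_cross]

lemma I_I: "\<rho> \<in> AR f \<Longrightarrow> cross \<rho>1 \<rho>2 \<rho> = h *s F \<Longrightarrow> h \<in> I"
  unfolding I_def by blast

lemma I_add:
  assumes "h \<in> I" "h' \<in> I"
  shows "h + h' \<in> I"
proof -
  obtain \<rho> \<rho>' where r: "\<rho> \<in> AR f" "cross \<rho>1 \<rho>2 \<rho> = h *s F" "\<rho>' \<in> AR f" "cross \<rho>1 \<rho>2 \<rho>' = h' *s F"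
    using assms unfolding I_def by blast
  show ?thesis by (rule I_I[OF AR_add[OF r(1,3)]]) (simp only: cross_simps r SnM.scale_left_distrib)
qed

lemma I_mult:
  assumes "h \<in> I"
  shows "p * h \<in> I"
proof -
  obtain \<rho> where r: "\<rho> \<in> AR f" "cross \<rho>1 \<rho>2 \<rho> = h *s F"
    using assms unfolding I_def by blast
  show ?thesis by (rule I_I[OF AR_smult[OF r(1)]]) (simp only: cross_simps r SnM.scale_scale)
qed

lemma I_0: "0 \<in> I"
  by (rule I_I[OF AR_0]) (simp add: cross_simps)

lemma subspace_I: "SV.subspace I"
  by (simp add: SV.subspace_def I_0 I_add I_mult)

lemma graded_cross: "graded_hom (\<lambda>_. 0) (\<lambda>_. e1 + e2) (cross \<rho>1 \<rho>2)"
  by (rule graded_hom_cross) (rule rho1_grade rho2_grade)+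

lemma cross_hcv:
  assumes "cross \<rho>1 \<rho>2 \<rho> = h *s F"
  shows "cross \<rho>1 \<rho>2 (hcv (\<lambda>_. 0) q \<rho>) = hc (q - e3) h *s F"
  unfolding graded_hom_hcv[OF graded_cross] assms by (rule hcv_smult[OF F_twisted])

lemma I_hc:
  assumes "h \<in> I"
  shows "hc k h \<in> I"
proof -
  obtain \<rho> where r: "\<rho> \<in> AR f" "cross \<rho>1 \<rho>2 \<rho> = h *s F"
    using assms unfolding I_def by blast
  have "hcv (\<lambda>_. 0) (k + e3) \<rho> \<in> AR f" using AR_hcv[OF f r(1)] by (simp add: AR_grade_iff)
  then show ?thesis by (rule I_I) (simp add: cross_hcv[OF r(2)])
qed

lemma I_lift:
  assumes "h \<in> I" "h \<in> grade k"
  obtains \<rho> where "\<rho> \<in> AR_grade f (k + e3)" "cross \<rho>1 \<rho>2 \<rho> = h *s F"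
proof -
  obtain \<rho> where \<rho>: "\<rho> \<in> AR f" "cross \<rho>1 \<rho>2 \<rho> = h *s F" using assms by (auto simp: I_def)
  have "cross \<rho>1 \<rho>2 (hcv (\<lambda>_. 0) (k + e3) \<rho>) = h *s F"
    using cross_hcv[OF \<rho>(2), of "k + e3"] assms(2) by (simp add: grade_hc_iff)
  then show ?thesis using that AR_hcv[OF f \<rho>(1)] by blast
qed

lemma kernel_cross:
  assumes "\<rho> \<in> AR f"
  shows "cross \<rho>1 \<rho>2 \<rho> = 0 \<longleftrightarrow> (\<exists>p q. \<rho> = p *s \<rho>1 + q *s \<rho>2)"
proof
  assume "cross \<rho>1 \<rho>2 \<rho> = 0"
  then obtain p q where "\<rho> = p *s \<rho>1 + q *s \<rho>2" by (rule tame_cross[OF tame assms])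
  then show "\<exists>p q. \<rho> = p *s \<rho>1 + q *s \<rho>2" by blast
qed (auto simp: cross_simps cross_self)

lemma span_rho_AR: "p *s \<rho>1 + q *s \<rho>2 \<in> AR f"
  by (intro AR_add AR_smult rho1_AR rho2_AR)

text \<open>Rank-nullity for the triple product: by tameness its kernel is free on
  \<open>\<rho>1\<close> and \<open>\<rho>2\<close>, and its image is the shifted ideal times the
  gradient.\<close>

lemma dim_AR_grade:
  "SnV.dim (AR_grade f q) = hS (q - e1) + hS (q - e2) + SV.dim (grade (q - e3) \<inter> I)"
proof -
  obtain W where W: "finite W" "twisted_grade (\<lambda>_::4. 0) q \<subseteq> SnV.span W"
    using twisted_grade_finite_span by blast
  have sub: "AR_grade f q \<subseteq> SnV.span W" using W(2) by (auto simp: AR_grade_iff)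
  have ker: "{\<rho> \<in> AR_grade f q. cross \<rho>1 \<rho>2 \<rho> = 0} =
      twisted_grade (\<lambda>_. 0) q \<inter> {p *s \<rho>1 + q *s \<rho>2 | p q. True}"
    using kernel_cross span_rho_AR by (auto simp: AR_grade_iff)
  have "SnV.dim (twisted_grade (\<lambda>_. 0) q \<inter> {p *s \<rho>1 + q *s \<rho>2 | p q. True}) = hS (q - e1) + hS (q - e2)"
    by (rule dim_comb_pair[OF _ _ rho_independent]) (simp_all add: twisted_grade_def rho1_grade rho2_grade)
  moreover have "cross \<rho>1 \<rho>2 ` AR_grade f q = (\<lambda>h. h *s F) ` (grade (q - e3) \<inter> I)"
  proof (intro equalityI subsetI)
    fix x assume "x \<in> cross \<rho>1 \<rho>2 ` AR_grade f q"
    then obtain \<rho> where \<rho>: "x = cross \<rho>1 \<rho>2 \<rho>" "\<rho> \<in> AR f" "hcv (\<lambda>_. 0) q \<rho> = \<rho>"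
      by (auto simp: AR_grade_iff twisted_grade_hcv_iff)
    obtain h where h: "x = h *s F" using cross_AR[OF \<rho>(2)] \<rho>(1) by blast
    then have "h \<in> I" using \<rho> by (auto simp: I_def)
    moreover have "x = hc (q - e3) h *s F" using cross_hcv[of \<rho> h q] h \<rho> by simp
    ultimately show "x \<in> (\<lambda>h. h *s F) ` (grade (q - e3) \<inter> I)" using I_hc hc_grade by blast
  next
    fix x assume "x \<in> (\<lambda>h. h *s F) ` (grade (q - e3) \<inter> I)"
    then obtain h where h: "x = h *s F" "h \<in> I" "h \<in> grade (q - e3)" by auto
    then show "x \<in> cross \<rho>1 \<rho>2 ` AR_grade f q" using I_lift[OF h(2,3)] by (metis diff_add_cancel image_eqI)
  qed
  moreover have "SnV.dim ((\<lambda>h. h *s F) ` (grade (q - e3) \<inter> I)) = SV.dim (grade (q - e3) \<inter> I)"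
    by (rule dim_smult_image[OF SV.subspace_inter[OF subspace_grade subspace_I] Int_lower1 F_nonzero])
  ultimately show ?thesis
    using vector_space_pair.rank_nullity[OF _ linear_hom_Sn[OF hom_cross] subspace_AR_grade sub W(1), of \<rho>1 \<rho>2]
    by (simp add: vector_space_pair_def vector_space_Sn ker)
qed

end

section \<open>Hilbert polynomials of the resolutions\<close>

definition hp :: "rat \<Rightarrow> rat" where
  "hp x = (x + 1) * (x + 2) * (x + 3) / 6"

lemma hS_hp: "- 3 \<le> k \<Longrightarrow> of_nat (hS k) = hp (of_int k)"
  by (simp add: hS_eq hp_def)

text \<open>The coefficients \<open>1, -4, 1, 1, 1\<close> sum to zero, and weighted by the shifts
  they sum to zero because \<open>D = x + y + z\<close>. So the cubic and quadratic terms cancel.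
  Half the weighted sum of the squared shifts remains as the slope.\<close>

lemma hp_extension:
  fixes x y z D :: rat
  assumes "D = x + y + z"
  shows "hp k - 4 * hp (k - D) + hp (k - D - x) + hp (k - D - y) + hp (k - D - z) =
    (D\<^sup>2 - (x * y + x * z + y * z)) * k
    + (hp 0 - 4 * hp (- D) + hp (- D - x) + hp (- D - y) + hp (- D - z))"
proof -
  define P where "P t = (t + 1) * (t + 2) * (t + 3)" for t :: rat
  have "P k - 4 * P (k - D) + P (k - D - x) + P (k - D - y) + P (k - D - z) =
      6 * ((D\<^sup>2 - (x * y + x * z + y * z)) * k)
      + (P 0 - 4 * P (- D) + P (- D - x) + P (- D - y) + P (- D - z))"
    unfolding P_def assms by algebra
  then show ?thesis unfolding hp_def P_def[symmetric] by linarith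
qed

text \<open>Compared with the preceding formula, this one is smaller by a second difference of
  \<open>hp\<close>, the Hilbert polynomial \<open>t + 1\<close> of a line at
  \<open>t = k - D - z\<close>. This accounts for the \<open>1\<close> lost in the slope.\<close>

lemma hp_nearly_free:
  fixes x y z D :: rat
  assumes "D = x + y + z"
  shows "hp k - 4 * hp (k - D) + hp (k - D - x) + hp (k - D - y) + 2 * hp (k - D - z - 1) - hp (k - D - z - 2) =
    (D\<^sup>2 - (x * y + x * z + y * z) - 1) * k
    + (hp 0 - 4 * hp (- D) + hp (- D - x) + hp (- D - y) + 2 * hp (- D - z - 1) - hp (- D - z - 2))"
proof -
  define P where "P t = (t + 1) * (t + 2) * (t + 3)" for t :: rat
  have "P k - 4 * P (k - D) + P (k - D - x) + P (k - D - y) + 2 * P (k - D - z - 1) - P (k - D - z - 2) =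
      6 * ((D\<^sup>2 - (x * y + x * z + y * z) - 1) * k)
      + (P 0 - 4 * P (- D) + P (- D - x) + P (- D - y) + 2 * P (- D - z - 1) - P (- D - z - 2))"
    unfolding P_def assms by algebra
  then show ?thesis unfolding hp_def P_def[symmetric] by linarith
qed

text \<open>The Koszul resolution of two forms of degrees \<open>m\<close> and \<open>n\<close>; the
  slope is the product of degrees given by Bezout's theorem.\<close>

lemma hp_complete_intersection:
  fixes m n :: rat
  shows "hp k - hp (k - m) - hp (k - n) + hp (k - m - n) =
    m * n * k + (hp 0 - hp (- m) - hp (- n) + hp (- m - n))"
proof -
  define P where "P t = (t + 1) * (t + 2) * (t + 3)" for t :: rat
  have "P k - P (k - m) - P (k - n) + P (k - m - n) =
      6 * (m * n * k) + (P 0 - P (- m) - P (- n) + P (- m - n))"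
    unfolding P_def by algebra
  then show ?thesis unfolding hp_def P_def[symmetric] by linarith
qed

lemma nearly_free_dim_AR_grade:
  assumes f: "f \<in> grade d" and nf: "nearly_free f d d1 d2 d3"
  shows "hS (k - d - d1 + 1) + hS (k - d - d2 + 1) + 2 * hS (k - d - d3 + 1) =
    SnV.dim (AR_grade f (k - (d - 1))) + hS (k - d - d3)"
proof -
  let ?s = "\<lambda>j::4. - d - exps d1 d2 d3 j + 1"
  obtain \<phi>3 :: "S^1 \<Rightarrow> S^4" and \<phi>2 :: "S^4 \<Rightarrow> S^4" where
    g3: "graded_hom (\<lambda>_. - d - d3) ?s \<phi>3" and g2: "graded_hom ?s (\<lambda>_. - d + 1) \<phi>2"
    and inj: "inj \<phi>3" and ex: "range \<phi>3 = {v. \<phi>2 v = 0}" "range \<phi>2 = {v. jac_map f v = 0}"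
    using nf unfolding nearly_free_def by blast
  have h3: "module_hom (*s) (*s) \<phi>3" using g3 by (simp add: graded_hom_def)
  have "\<phi>3 v = 0 \<longleftrightarrow> v = 0" for v using inj hom_Sn_simps(3)[OF h3] by (metis injD)
  moreover have "0 \<in> twisted_grade (\<lambda>_::1. - d - d3) k" by (simp add: twisted_grade_def)
  ultimately have "{v \<in> twisted_grade (\<lambda>_. - d - d3) k. \<phi>3 v = 0} = {0}" by auto
  then have 3: "hS (k + (- d - d3)) = SnV.dim (twisted_grade ?s k \<inter> range \<phi>3)"
    using dim_graded_hom[OF g3, of k] by (simp add: SnV.dim_zero)
  have "{v \<in> twisted_grade ?s k. \<phi>2 v = 0} = twisted_grade ?s k \<inter> range \<phi>3" using ex by auto
  moreover have "twisted_grade (\<lambda>_. - d + 1) k \<inter> range \<phi>2 = AR_grade f (k - (d - 1))"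
  proof -
    have "twisted_grade (\<lambda>_::4. - d + 1) k = twisted_grade (\<lambda>_. 0) (k - (d - 1))"
      unfolding twisted_grade_def by (intro Collect_cong all_cong1 arg_cong2[where f = "(\<in>)"] arg_cong[where f = grade]) simp_all
    moreover have "twisted_grade (\<lambda>_. 0) (k - (d - 1)) \<inter> {v. jac_map f v = 0} = AR_grade f (k - (d - 1))"
      unfolding set_eq_iff Int_iff AR_grade_iff AR_def mem_Collect_eq by blast
    ultimately show ?thesis unfolding ex(2) by (simp only:)
  qed
  ultimately have "(\<Sum>j\<in>UNIV. hS (k + ?s j)) = hS (k + (- d - d3)) + SnV.dim (AR_grade f (k - (d - 1)))"
    using dim_graded_hom[OF g2, of k] 3 by simp
  then show ?thesis by (simp add: sum_4 exps_def algebra_simps)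
qed

lemma nearly_free_degree:
  assumes f: "f \<in> grade d" and deg: "has_sing_degree f a" and D: "d - 1 = e1 + e2 + e3"
    and nf: "nearly_free f d e1 e2 (e3 + 1)"
  shows "a = of_int ((e1 + e2 + e3)\<^sup>2 - (e1 * e2 + e1 * e3 + e2 * e3) - 1)"
proof -
  define x y z D :: rat where xyz: "x = of_int e1" "y = of_int e2" "z = of_int e3" "D = x + y + z"
  have Dd: "of_int d = D + 1"
  proof -
    have "(of_int d :: rat) = of_int (e1 + e2 + e3 + 1)" using D by (intro arg_cong[where f=of_int]) linarith
    then show ?thesis by (simp add: xyz)
  qed
  obtain b K where bK: "\<And>k. K \<le> k \<Longrightarrow> of_nat (milnor_dim f k) = a * of_int k + b"
    using has_sing_degreeD[OF deg] by metis
  define C where "C = hp 0 - 4 * hp (- D) + hp (- D - x) + hp (- D - y) + 2 * hp (- D - z - 1) - hp (- D - z - 2)"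
  \<comment> \<open>Beyond this bound every shifted degree that occurs is in the range where
    \<open>hS\<close> agrees with \<open>hp\<close>.\<close>
  define L where "L = \<bar>K\<bar> + \<bar>d\<bar> + \<bar>e1\<bar> + \<bar>e2\<bar> + \<bar>e3\<bar> + 1"
  have "a * of_int k + b = (D\<^sup>2 - (x * y + x * z + y * z) - 1) * of_int k + C" if k: "L \<le> k" for k
  proof -
    have ge: "K \<le> k" "0 \<le> k" "d \<le> k" "d + e1 \<le> k" "d + e2 \<le> k" "d + e3 + 1 \<le> k"
      using k unfolding L_def by linarith+
    have "int (milnor_dim f k) = int (hS k) - 4 * int (hS (k - (d - 1))) + int (hS (k - d - e1 + 1))
        + int (hS (k - d - e2 + 1)) + 2 * int (hS (k - d - (e3 + 1) + 1)) - int (hS (k - d - (e3 + 1)))"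
      using milnor_dim_AR[OF f, of k] nearly_free_dim_AR_grade[OF f nf, of k] by linarith
    then have "of_int (int (milnor_dim f k)) = (of_int (int (hS k) - 4 * int (hS (k - (d - 1))) + int (hS (k - d - e1 + 1))
        + int (hS (k - d - e2 + 1)) + 2 * int (hS (k - d - (e3 + 1) + 1)) - int (hS (k - d - (e3 + 1)))) :: rat)"
      by (simp only:)
    then have "of_nat (milnor_dim f k) = hp (of_int k) - 4 * hp (of_int (k - (d - 1))) + hp (of_int (k - d - e1 + 1))
        + hp (of_int (k - d - e2 + 1)) + 2 * hp (of_int (k - d - (e3 + 1) + 1)) - hp (of_int (k - d - (e3 + 1)))"
      using ge by (simp add: hS_hp del: of_int_diff of_int_add) (simp add: hS_hp)
    also have "\<dots> = hp (of_int k) - 4 * hp (of_int k - D) + hp (of_int k - D - x) + hp (of_int k - D - y)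
        + 2 * hp (of_int k - D - z - 1) - hp (of_int k - D - z - 2)"
      by (simp add: Dd xyz(1-3)) (simp add: algebra_simps)
    also have "\<dots> = (D\<^sup>2 - (x * y + x * z + y * z) - 1) * of_int k + C"
      unfolding C_def by (rule hp_nearly_free[OF xyz(4)])
    finally show ?thesis using bK[OF ge(1)] by simp
  qed
  then have "a = D\<^sup>2 - (x * y + x * z + y * z) - 1" by (rule linear_unique)
  then show ?thesis by (simp add: xyz)
qed

context tame_surface
begin

text \<open>With \<open>S\<close> in place of \<open>I\<close>, the syzygies would have the Hilbert
  function of a free module with exponents \<open>e1, e2, e3\<close>. The Milnor algebra falls short
  of the resulting degree by exactly the slope of \<open>S / I\<close>.\<close>

lemma hilbert_quotient_I_linear:
  obtains b K where "\<And>k. K \<le> k \<Longrightarrow> of_nat (hilbert_quotient I k) =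
    (of_int ((e1 + e2 + e3)\<^sup>2 - (e1 * e2 + e1 * e3 + e2 * e3)) - a) * of_int k + b"
proof -
  define x y z D :: rat where xyz: "x = of_int e1" "y = of_int e2" "z = of_int e3" "D = x + y + z"
  have Dd: "of_int d = D + 1"
  proof -
    have "(of_int d :: rat) = of_int (e1 + e2 + e3 + 1)" using e3 by (intro arg_cong[where f=of_int]) linarith
    then show ?thesis by (simp add: xyz)
  qed
  obtain b K where bK: "\<And>k. K \<le> k \<Longrightarrow> of_nat (milnor_dim f k) = a * of_int k + b"
    using has_sing_degreeD[OF deg] by metis
  define C where "C = hp 0 - 4 * hp (- D) + hp (- D - x) + hp (- D - y) + hp (- D - z)"
  define M where "M = D\<^sup>2 - (x * y + x * z + y * z)"
  define L where "L = \<bar>K\<bar> + 2 * \<bar>d\<bar> + \<bar>e1\<bar> + \<bar>e2\<bar> + 2 * \<bar>e3\<bar> + 1"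
  have "of_nat (hilbert_quotient I j) = (M - a) * of_int j + ((M - a) * (D + z) + C - b)" if j: "L \<le> j" for j
  proof -
    \<comment> \<open>The degree of the Milnor algebra in which the component of degree
      \<open>j\<close> of \<open>I\<close> appears.\<close>
    define k where "k = j + (d - 1) + e3"
    have ge: "K \<le> k" "0 \<le> k" "d \<le> k" "d + e1 \<le> k" "d + e2 \<le> k" "d + e3 \<le> k"
      using j unfolding L_def k_def by linarith+
    have jk: "k - (d - 1) - e3 = j" by (simp add: k_def)
    have "int (hilbert_quotient I j) = int (hS k) - 4 * int (hS (k - (d - 1))) + int (hS (k - (d - 1) - e1))
        + int (hS (k - (d - 1) - e2)) + int (hS (k - (d - 1) - e3)) - int (milnor_dim f k)"
      using milnor_dim_AR[OF f, of k] dim_AR_grade[of "k - (d - 1)"] hilbert_quotient[of I j]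
      unfolding jk by linarith
    then have "of_int (int (hilbert_quotient I j)) = (of_int (int (hS k) - 4 * int (hS (k - (d - 1)))
        + int (hS (k - (d - 1) - e1)) + int (hS (k - (d - 1) - e2)) + int (hS (k - (d - 1) - e3))
        - int (milnor_dim f k)) :: rat)"
      by (simp only:)
    then have "of_nat (hilbert_quotient I j) = hp (of_int k) - 4 * hp (of_int (k - (d - 1)))
        + hp (of_int (k - (d - 1) - e1)) + hp (of_int (k - (d - 1) - e2)) + hp (of_int (k - (d - 1) - e3))
        - of_nat (milnor_dim f k)"
      using ge by (simp add: hS_hp del: of_int_diff of_int_add) (simp add: hS_hp)
    also have "\<dots> = hp (of_int k) - 4 * hp (of_int k - D) + hp (of_int k - D - x) + hp (of_int k - D - y)
        + hp (of_int k - D - z) - (a * of_int k + b)"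
      using bK[OF ge(1)] by (simp add: Dd xyz(1-3))
    also have "\<dots> = M * of_int k + C - (a * of_int k + b)"
      unfolding C_def M_def hp_extension[OF xyz(4)] by simp
    also have "of_int k = of_int j + (D + z)" by (simp add: k_def Dd xyz(1-3))
    finally show ?thesis by (simp add: algebra_simps)
  qed
  moreover have "M = of_int ((e1 + e2 + e3)\<^sup>2 - (e1 * e2 + e1 * e3 + e2 * e3))"
    by (simp add: M_def xyz)
  ultimately show ?thesis using that by metis
qed

end

section \<open>Binary forms\<close>

text \<open>Homogenization of \<open>p\<close> to degree \<open>k\<close> in two variables. It is
  faithful only for \<open>degree p \<le> k\<close>, which the lemmas below therefore
  assume.\<close>

definition bform :: "4 \<Rightarrow> 4 \<Rightarrow> nat \<Rightarrow> complex poly \<Rightarrow> S" where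
  "bform i j k p = (\<Sum>l\<le>k. Const (coeff p l) * (Var i ^ l * Var j ^ (k - l)))"

definition lin :: "4 \<Rightarrow> 4 \<Rightarrow> complex \<times> complex \<Rightarrow> S" where
  "lin i j m = Const (fst m) * Var i + Const (snd m) * Var j"

abbreviation linprod :: "4 \<Rightarrow> 4 \<Rightarrow> (complex \<times> complex) list \<Rightarrow> S" where
  "linprod i j ms \<equiv> prod_list (map (lin i j) ms)"

lemma lookup_bform:
  assumes "i \<noteq> j" "l \<le> k"
  shows "look (bform i j k p) (sing i l + sing j (k - l)) = coeff p l"
proof -
  have e: "sing i n + sing j (k - n) = sing i l + sing j (k - l) \<longleftrightarrow> n = l" for n
  proof
    assume eq: "sing i n + sing j (k - n) = sing i l + sing j (k - l)"
    have "look (sing i n + sing j (k - n)) i = look (sing i l + sing j (k - l)) i" by (simp only: eq)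
    then show "n = l" using assms(1) by (simp add: lookup_add lookup_single)
  qed simp
  have "look (bform i j k p) (sing i l + sing j (k - l)) =
      (\<Sum>n\<le>k. coeff p n * (if n = l then 1 else 0))"
    unfolding bform_def lookup_sum lookup_Const_mult Var_power mult_single
    by (rule sum.cong) (simp_all add: lookup_single when_def e)
  also have "\<dots> = (\<Sum>n\<le>k. if n = l then coeff p l else 0)"
    by (rule sum.cong) auto
  finally show ?thesis using assms(2) by simp
qed

lemma bform_nonzero: "i \<noteq> j \<Longrightarrow> degree p \<le> k \<Longrightarrow> p \<noteq> 0 \<Longrightarrow> bform i j k p \<noteq> 0"
  using lookup_bform[of i j "degree p" k p] by (metis leading_coeff_0_iff lookup_zero)

lemma bform_diff: "bform i j k (p - q) = bform i j k p - bform i j k q"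
  by (simp add: bform_def Const_simps(6) left_diff_distrib sum_subtractf)

lemma bform_smult: "bform i j k (smult c p) = Const c * bform i j k p"
  by (simp only: bform_def coeff_smult Const_simps(4) mult.assoc sum_distrib_left)

lemma bform_pCons: "bform i j (Suc k) (pCons 0 p) = Var i * bform i j k p"
proof -
  have "bform i j (Suc k) (pCons 0 p) = (\<Sum>l\<le>k. Const (coeff p l) * (Var i ^ Suc l * Var j ^ (k - l)))"
    unfolding bform_def by (subst sum.atMost_Suc_shift) (simp add: Const_simps(1))
  also have "\<dots> = Var i * bform i j k p"
    unfolding bform_def sum_distrib_left by (rule sum.cong) (simp_all only: power_Suc ac_simps)
  finally show ?thesis .
qed

lemma bform_Suc:
  assumes "degree p \<le> k"
  shows "bform i j (Suc k) p = Var j * bform i j k p"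
proof -
  have "bform i j (Suc k) p = (\<Sum>l\<le>k. Const (coeff p l) * (Var i ^ l * Var j ^ (Suc k - l)))"
    using assms by (simp add: bform_def coeff_eq_0 Const_simps(1))
  also have "\<dots> = Var j * bform i j k p"
    unfolding bform_def sum_distrib_left
  proof (rule sum.cong)
    fix l assume "l \<in> {..k}"
    then have "Suc k - l = Suc (k - l)" by (simp add: Suc_diff_le)
    then show "Const (coeff p l) * (Var i ^ l * Var j ^ (Suc k - l)) =
        Var j * (Const (coeff p l) * (Var i ^ l * Var j ^ (k - l)))"
      by (simp only: power_Suc ac_simps)
  qed simp
  finally show ?thesis .
qed

text \<open>The fundamental theorem of algebra in homogeneous form. If the degree of
  \<open>p\<close> drops below \<open>k\<close>, there is a root at infinity and
  \<open>Var j\<close> splits off; otherwise a root \<open>r\<close> splits off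
  \<open>Var i - r * Var j\<close>.\<close>

lemma bform_factorization:
  assumes "degree p \<le> k" "p \<noteq> 0"
  shows "\<exists>c ms. c \<noteq> 0 \<and> (\<forall>m\<in>set ms. m \<noteq> (0, 0)) \<and> bform i j k p = Const c * linprod i j ms"
  using assms
proof (induction k arbitrary: p)
  case 0
  then obtain c where p: "p = [:c:]" by (metis degree_eq_zeroE le_zero_eq)
  then have "c \<noteq> 0" using 0 by auto
  then show ?case by (intro exI[of _ c] exI[of _ "[]"]) (simp add: bform_def p)
next
  case (Suc k)
  have step: "\<exists>c ms. c \<noteq> 0 \<and> (\<forall>m\<in>set ms. m \<noteq> (0, 0)) \<and>
      lin i j m * bform i j k q = Const c * linprod i j ms"
    if q: "degree q \<le> k" "q \<noteq> 0" and m: "m \<noteq> (0, 0)" for q m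
  proof -
    obtain c ms where c: "c \<noteq> 0" "\<forall>m\<in>set ms. m \<noteq> (0, 0)" "bform i j k q = Const c * linprod i j ms"
      using Suc.IH[OF q] by blast
    have "lin i j m * bform i j k q = Const c * linprod i j (m # ms)"
      by (simp only: c(3) list.map prod_list.Cons ac_simps)
    then show ?thesis using c m by (intro exI[of _ c] exI[of _ "m # ms"]) auto
  qed
  show ?case
  proof (cases "degree p \<le> k")
    case True
    have "bform i j (Suc k) p = lin i j (0, 1) * bform i j k p"
      by (simp add: bform_Suc[OF True] lin_def Const_simps(1,2))
    then show ?thesis using step[OF True Suc.prems(2), of "(0, 1)"] by simp
  next
    case False
    then have dp: "degree p = Suc k" using Suc.prems by simp
    then have "\<not> constant (poly p)" by (simp add: constant_degree)
    then obtain r where "poly p r = 0" using fundamental_theorem_of_algebra by blast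
    then obtain q where q: "p = [:- r, 1:] * q" by (metis poly_eq_0_iff_dvd dvdE)
    then have "q \<noteq> 0" using Suc.prems by auto
    then have dq: "degree q = k" using dp unfolding q by (subst (asm) degree_mult_eq) auto
    have "p = pCons 0 q - smult r q" unfolding q by simp
    then have "bform i j (Suc k) p = Var i * bform i j k q - Const r * (Var j * bform i j k q)"
      using dq by (simp add: bform_diff bform_smult bform_pCons bform_Suc)
    also have "\<dots> = lin i j (1, - r) * bform i j k q"
      unfolding lin_def fst_conv snd_conv Const_simps(2,5) by algebra
    finally show ?thesis using step[of q "(1, - r)"] dq \<open>q \<noteq> 0\<close> by simp
  qed
qed

lemma bform_in_ideal:
  assumes X: "SV.subspace X" and ij: "i \<noteq> j" and bd: "\<And>k. K \<le> k \<Longrightarrow> hilbert_quotient X k \<le> N"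
  obtains k p where "bform i j k p \<in> X" "degree p \<le> k" "p \<noteq> 0"
proof -
  \<comment> \<open>In degree \<open>k\<close> there are \<open>k + 1\<close> monomials in the two
    variables, more than the codimension of \<open>X\<close>, which is at most
    \<open>N\<close>.\<close>
  define k where "k = max (nat K) N"
  let ?e = "\<lambda>l. Var i ^ l * Var j ^ (k - l)"
  obtain W where W: "finite W" "grade (int k) \<subseteq> SV.span W" using finite_span_grade by blast
  have "hilbert_quotient X (int k) \<le> N" "N \<le> k" by (rule bd) (simp_all add: k_def)
  then have "SV.dim (grade (int k)) < SV.dim (grade (int k) \<inter> X) + card {..k}"
    using hilbert_quotient[of X "int k"] unfolding dim_grade card_atMost by linarith
  moreover have "?e l \<in> grade (int k)" if "l \<in> {..k}" for l
  proof -
    have "int l * 1 + int (k - l) * 1 = int k" using that by simp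
    then show ?thesis
      using grade_mult[OF grade_power[OF Var_grade[of i], of l] grade_power[OF Var_grade[of j], of "k - l"]] by simp
  qed
  ultimately obtain u where u: "(\<Sum>l\<le>k. Const (u l) * ?e l) \<in> grade (int k) \<inter> X" "\<exists>l\<in>{..k}. u l \<noteq> 0"
    using SV.meets_subspace[OF subspace_grade W(2,1) SV.subspace_inter[OF subspace_grade X] Int_lower1, of "{..k}" ?e]
    by auto
  define p where "p = (\<Sum>l\<le>k. monom (u l) l)"
  have c: "coeff p l = (if l \<le> k then u l else 0)" for l
    by (simp add: p_def coeff_sum)
  have "bform i j k p = (\<Sum>l\<le>k. Const (u l) * ?e l)" unfolding bform_def by (rule sum.cong) (simp_all add: c)
  moreover have "degree p \<le> k" by (rule degree_le) (simp add: c)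
  moreover have "p \<noteq> 0" using u(2) c by (metis atMost_iff coeff_0)
  ultimately show ?thesis using that u(1) by (metis IntD2)
qed

section \<open>Ideals generated by two products of linear forms\<close>

definition ideal2 :: "S \<Rightarrow> S \<Rightarrow> S set" where
  "ideal2 g h = {x. \<exists>p q. x = g * p + h * q}"

lemma ideal2_I: "g * p + h * q \<in> ideal2 g h"
  by (auto simp: ideal2_def)

lemma ideal2_E:
  assumes "x \<in> ideal2 g h" obtains p q where "x = g * p + h * q"
  using assms by (auto simp: ideal2_def)

lemma ideal2_add: "x \<in> ideal2 g h \<Longrightarrow> y \<in> ideal2 g h \<Longrightarrow> x + y \<in> ideal2 g h"
proof (elim ideal2_E)
  fix p q p' q' assume x: "x = g * p + h * q" "y = g * p' + h * q'"
  have "x + y = g * (p + p') + h * (q + q')" unfolding x by algebra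
  then show ?thesis by (simp only: ideal2_I)
qed

lemma ideal2_mult: "x \<in> ideal2 g h \<Longrightarrow> y * x \<in> ideal2 g h"
proof (elim ideal2_E)
  fix p q assume x: "x = g * p + h * q"
  have "y * x = g * (y * p) + h * (y * q)" unfolding x by algebra
  then show ?thesis by (simp only: ideal2_I)
qed

lemma ideal2_gens: "g \<in> ideal2 g h" "h \<in> ideal2 g h" "0 \<in> ideal2 g h"
  using ideal2_I[of g 1 h 0] ideal2_I[of g 0 h 1] ideal2_I[of g 0 h 0] by simp_all

lemma ev_congruent:
  assumes "\<And>i. Var i - \<tau> i \<in> ideal2 g h"
  shows "p - ev Const \<tau> p \<in> ideal2 g h"
proof (induction p rule: S_induct)
  case (Const c)
  then show ?case by (simp add: ev_Const rhom_Const ideal2_gens)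
next
  case (Var i)
  then show ?case by (simp add: ev_Var rhom_Const assms)
next
  note r = rhom_simps[OF rhom_ev[OF rhom_Const]]
  case (add p q)
  have "p + q - ev Const \<tau> (p + q) = (p - ev Const \<tau> p) + (q - ev Const \<tau> q)"
    unfolding r by algebra
  then show ?case using ideal2_add[OF add] by (simp only:)
next
  note r = rhom_simps[OF rhom_ev[OF rhom_Const]]
  case (mult p q)
  have "p * q - ev Const \<tau> (p * q) = q * (p - ev Const \<tau> p) + ev Const \<tau> p * (q - ev Const \<tau> q)"
    unfolding r by algebra
  then show ?case using ideal2_add[OF ideal2_mult[OF mult(1)] ideal2_mult[OF mult(2)]] by (simp only:)
qed

text \<open>A linear form in \<open>x\<^sub>i, x\<^sub>j\<close> is killed by solving for one of the two variables.\<close>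

lemma eliminate_linear:
  assumes "i \<noteq> j" "m \<noteq> (0, 0)"
  obtains \<tau>i \<tau>j v where "Const (fst m) * \<tau>i + Const (snd m) * \<tau>j = 0"
    "\<exists>p. Var i - \<tau>i = lin i j m * p" "\<exists>p. Var j - \<tau>j = lin i j m * p"
    "v \<in> {i, j}" "(v = i \<longrightarrow> \<tau>i = Var i) \<and> (v = j \<longrightarrow> \<tau>j = Var j)"
proof -
  obtain \<alpha> \<beta> where m: "m = (\<alpha>, \<beta>)" by (cases m)
  show ?thesis
  proof (cases "\<beta> = 0")
    case False
    have b: "Const \<beta> * Const (1 / \<beta>) = 1" using False by (simp flip: Const_simps(2,4))
    show ?thesis
    proof (rule that[of "Var i" "- Const (1 / \<beta>) * Const \<alpha> * Var i" i])
      show "Const (fst m) * Var i + Const (snd m) * (- Const (1 / \<beta>) * Const \<alpha> * Var i) = 0"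
        unfolding m fst_conv snd_conv using b by algebra
      show "\<exists>p. Var i - Var i = lin i j m * p" by (rule exI[of _ 0]) simp
      show "\<exists>p. Var j - - Const (1 / \<beta>) * Const \<alpha> * Var i = lin i j m * p"
        by (rule exI[of _ "Const (1 / \<beta>)"]) (unfold lin_def m fst_conv snd_conv, use b in algebra)
    qed (use assms in auto)
  next
    case True
    then have "\<alpha> \<noteq> 0" using assms m by auto
    then have a: "Const \<alpha> * Const (1 / \<alpha>) = 1" by (simp flip: Const_simps(2,4))
    show ?thesis
    proof (rule that[of 0 "Var j" j])
      show "Const (fst m) * 0 + Const (snd m) * Var j = 0"
        by (simp add: m True Const_simps(1))
      show "\<exists>p. Var j - Var j = lin i j m * p" by (rule exI[of _ 0]) simp
      have "lin i j m = Const \<alpha> * Var i" by (simp add: lin_def m True Const_simps(1))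
      then have "Var i - 0 = lin i j m * Const (1 / \<alpha>)" using a by algebra
      then show "\<exists>p. Var i - 0 = lin i j m * p" by blast
    qed (use assms in auto)
  qed
qed

lemma ev_lin: "ev Const \<tau> (lin i j m) = Const (fst m) * \<tau> i + Const (snd m) * \<tau> j"
  by (simp add: lin_def rhom_simps(3,4)[OF rhom_ev[OF rhom_Const]] ev_Const ev_Var rhom_Const)

lemma lin_nonzero: "i \<noteq> j \<Longrightarrow> m \<noteq> (0, 0) \<Longrightarrow> lin i j m \<noteq> 0"
proof
  assume *: "i \<noteq> j" "m \<noteq> (0, 0)" "lin i j m = 0"
  have "look (lin i j m) (sing i 1) = fst m" "look (lin i j m) (sing j 1) = snd m"
  proof -
    have "(sing i 1 :: mon) \<noteq> sing j 1"
    proof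
      assume "(sing i 1 :: mon) = sing j 1"
      then have "look (sing i 1 :: mon) i = look (sing j 1) i" by (simp only:)
      then show False using *(1) by (simp add: lookup_single)
    qed
    then show "look (lin i j m) (sing i 1) = fst m" "look (lin i j m) (sing j 1) = snd m"
      by (auto simp: lin_def lookup_add lookup_Const_mult Var_def lookup_single when_def)
  qed
  then show False using * by (simp add: prod_eq_iff)
qed

text \<open>The substitution that kills \<open>lin 1 2 m\<close> fixes the nonzero product in the
  other two variables, so it kills \<open>z\<close>. Every polynomial is congruent to its image
  modulo the linear form, which therefore divides \<open>z\<close>.\<close>

lemma lin_coprime:
  assumes m: "m \<noteq> (0, 0)" and ns: "\<forall>n\<in>set ns. n \<noteq> (0, 0)"
    and eq: "lin 1 2 m * w = linprod 3 4 ns * z"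
  shows "\<exists>u. z = lin 1 2 m * u"
proof -
  have "(1::4) \<noteq> 2" by simp
  from eliminate_linear[OF this m] obtain \<tau>1 \<tau>2
    where t: "Const (fst m) * \<tau>1 + Const (snd m) * \<tau>2 = 0"
      "\<exists>p. Var 1 - \<tau>1 = lin 1 2 m * p" "\<exists>p. Var 2 - \<tau>2 = lin 1 2 m * p"
    by metis
  define \<tau> where "\<tau> k = (if k = 1 then \<tau>1 else if k = 2 then \<tau>2 else Var k)" for k :: 4
  let ?\<sigma> = "ev Const \<tau>"
  note r = rhom_simps[OF rhom_ev[OF rhom_Const, of \<tau>]]
  have v: "\<tau> 1 = \<tau>1" "\<tau> 2 = \<tau>2" "\<tau> 3 = Var 3" "\<tau> 4 = Var 4" by (simp_all add: \<tau>_def)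
  have "?\<sigma> (linprod 3 4 ns) = linprod 3 4 ns"
  proof (induction ns)
    case (Cons n ns)
    have "?\<sigma> (lin 3 4 n) = lin 3 4 n" unfolding ev_lin v by (simp add: lin_def)
    then show ?case using Cons by (simp add: r(4))
  qed (simp add: r(2))
  moreover have "?\<sigma> (lin 1 2 m) = 0" unfolding ev_lin v by (rule t(1))
  ultimately have "0 = linprod 3 4 ns * ?\<sigma> z"
    using arg_cong[OF eq, of ?\<sigma>] by (simp add: r(4))
  moreover have "linprod 3 4 ns \<noteq> 0" using ns by (induction ns) (simp_all add: lin_nonzero)
  ultimately have "?\<sigma> z = 0" by simp
  moreover have "z - ?\<sigma> z \<in> ideal2 (lin 1 2 m) 0"
  proof (rule ev_congruent)
    fix i
    have "\<exists>p. Var i - \<tau> i = lin 1 2 m * p"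
      using exhaust_4[of i] t(2,3) by (auto simp: v intro: exI[of _ 0])
    then show "Var i - \<tau> i \<in> ideal2 (lin 1 2 m) 0" by (auto simp: ideal2_def)
  qed
  ultimately show ?thesis by (auto simp: ideal2_def)
qed

lemma prod_lin_coprime:
  assumes ms: "\<forall>m\<in>set ms. m \<noteq> (0, 0)" and ns: "\<forall>n\<in>set ns. n \<noteq> (0, 0)"
    and eq: "linprod 1 2 ms * w = linprod 3 4 ns * z"
  shows "\<exists>u. z = linprod 1 2 ms * u"
  using ms eq
proof (induction ms arbitrary: w z)
  case (Cons m ms)
  have m: "m \<noteq> (0, 0)" using Cons.prems by simp
  let ?g = "linprod 1 2 ms" and ?h = "linprod 3 4 ns"
  have eq: "lin 1 2 m * (?g * w) = ?h * z" using Cons.prems(2) by (simp only: list.map prod_list.Cons mult.assoc)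
  then obtain u where u: "z = lin 1 2 m * u" using lin_coprime[OF m ns] by blast
  have "lin 1 2 m * (?g * w) = lin 1 2 m * (?h * u)" using eq unfolding u by algebra
  then have "?g * w = ?h * u" using lin_nonzero[of 1 2 m] m by simp
  then obtain u' where "u = ?g * u'" using Cons by auto
  then have "z = linprod 1 2 (m # ms) * u'" using u by (simp only: list.map prod_list.Cons mult.assoc)
  then show ?case by blast
qed simp

text \<open>In particular the ideal of two linear forms in disjoint pairs of variables is prime.\<close>

lemma ideal2_lin_kernel:
  assumes m: "m \<noteq> (0, 0)" and n: "n \<noteq> (0, 0)"
  obtains \<sigma> i j where "rhom \<sigma>" "\<And>c. \<sigma> (Const c) = Const c" "\<sigma> (Var i) = Var i" "\<sigma> (Var j) = Var j"
    "i \<noteq> j" "\<And>x. x \<in> ideal2 (lin 1 2 m) (lin 3 4 n) \<longleftrightarrow> \<sigma> x = 0"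
proof -
  have ne: "(1::4) \<noteq> 2" "(3::4) \<noteq> 4" by simp_all
  obtain \<tau>1 \<tau>2 and v :: 4 where t: "Const (fst m) * \<tau>1 + Const (snd m) * \<tau>2 = 0"
    "\<exists>p. Var 1 - \<tau>1 = lin 1 2 m * p" "\<exists>p. Var 2 - \<tau>2 = lin 1 2 m * p"
    "v \<in> {1, 2}" "(v = 1 \<longrightarrow> \<tau>1 = Var 1) \<and> (v = 2 \<longrightarrow> \<tau>2 = Var 2)"
    using eliminate_linear[OF ne(1) m] by metis
  obtain \<tau>3 \<tau>4 and w :: 4 where t': "Const (fst n) * \<tau>3 + Const (snd n) * \<tau>4 = 0"
    "\<exists>p. Var 3 - \<tau>3 = lin 3 4 n * p" "\<exists>p. Var 4 - \<tau>4 = lin 3 4 n * p"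
    "w \<in> {3, 4}" "(w = 3 \<longrightarrow> \<tau>3 = Var 3) \<and> (w = 4 \<longrightarrow> \<tau>4 = Var 4)"
    using eliminate_linear[OF ne(2) n] by metis
  define \<tau> where "\<tau> k = (if k = 1 then \<tau>1 else if k = 2 then \<tau>2 else if k = 3 then \<tau>3 else \<tau>4)" for k :: 4
  have v: "\<tau> 1 = \<tau>1" "\<tau> 2 = \<tau>2" "\<tau> 3 = \<tau>3" "\<tau> 4 = \<tau>4" by (simp_all add: \<tau>_def)
  note r = rhom_simps[OF rhom_ev[OF rhom_Const, of \<tau>]]
  let ?g = "lin 1 2 m" and ?h = "lin 3 4 n"
  show ?thesis
  \<comment> \<open>One variable of each pair survives the substitution, so binary forms in
    \<open>Var v\<close> and \<open>Var w\<close> are left unchanged.\<close>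
  proof (rule that[of "ev Const \<tau>" v w])
    show "rhom (ev Const \<tau>)" by (rule rhom_ev[OF rhom_Const])
    show "ev Const \<tau> (Const c) = Const c" for c by (rule ev_Const[OF rhom_Const])
    show "ev Const \<tau> (Var v) = Var v" "ev Const \<tau> (Var w) = Var w"
      using t(4,5) t'(4,5) by (auto simp: ev_Var rhom_Const \<tau>_def)
    show "v \<noteq> w" using t(4) t'(4) by auto
    fix x
    have "Var i - \<tau> i \<in> ideal2 ?g ?h" for i
    proof -
      have "(\<exists>p. Var i - \<tau> i = ?g * p) \<or> (\<exists>p. Var i - \<tau> i = ?h * p)"
        using exhaust_4[of i] t(2,3) t'(2,3) by (elim disjE) (simp_all add: v)
      then show ?thesis using ideal2_mult[OF ideal2_gens(1)] ideal2_mult[OF ideal2_gens(2)]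
        by (metis mult.commute)
    qed
    then have c: "x - ev Const \<tau> x \<in> ideal2 ?g ?h" by (rule ev_congruent)
    show "x \<in> ideal2 ?g ?h \<longleftrightarrow> ev Const \<tau> x = 0"
    proof
      assume "x \<in> ideal2 ?g ?h"
      then obtain p q where x: "x = ?g * p + ?h * q" by (rule ideal2_E)
      have "ev Const \<tau> ?g = 0" "ev Const \<tau> ?h = 0" unfolding ev_lin v by (rule t(1) t'(1))+
      then show "ev Const \<tau> x = 0" unfolding x r(3,4) by simp
    qed (use c in simp)
  qed
qed

text \<open>Every associated prime of the complete intersection of two such products is generated by
  one factor of each: the annihilator of a nonzero class lies in one of these primes.\<close>

lemma colon_lin_prod:
  assumes m: "m \<noteq> (0, 0)" and ns: "\<forall>n\<in>set ns. n \<noteq> (0, 0)"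
    and a: "a \<notin> ideal2 (lin 1 2 m) (linprod 3 4 ns)"
  shows "\<exists>n\<in>set ns. \<forall>s. s * a \<in> ideal2 (lin 1 2 m) (linprod 3 4 ns) \<longrightarrow>
    s \<in> ideal2 (lin 1 2 m) (lin 3 4 n)"
  using ns a
proof (induction ns arbitrary: a)
  case Nil
  then show ?case using ideal2_mult[OF ideal2_gens(2)[where h = 1 and g = "lin 1 2 m"], where y = a] by simp
next
  case (Cons n ns)
  let ?M = "lin 1 2 m" and ?N = "lin 3 4 n" and ?h = "linprod 3 4 ns"
  have h: "linprod 3 4 (n # ns) = ?N * ?h" by simp
  have n: "n \<noteq> (0, 0)" using Cons.prems by simp
  show ?case
  proof (cases "a \<in> ideal2 ?M ?N")
    \<comment> \<open>Here the annihilator lies in the prime ideal of the two linear forms.\<close>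
    case False
    obtain \<sigma> :: "S \<Rightarrow> S" where \<sigma>: "rhom \<sigma>" "\<And>x. x \<in> ideal2 ?M ?N \<longleftrightarrow> \<sigma> x = 0"
      using ideal2_lin_kernel[OF m n] by metis
    have "s \<in> ideal2 ?M ?N" if s: "s * a \<in> ideal2 ?M (?N * ?h)" for s
    proof -
      have "s * a \<in> ideal2 ?M ?N" using s by (elim ideal2_E) (simp only: mult.assoc ideal2_I)
      then have "\<sigma> s * \<sigma> a = 0" using \<sigma>(2)[of "s * a"] by (simp add: rhom_simps(4)[OF \<sigma>(1)])
      then show ?thesis using False \<sigma>(2) by auto
    qed
    then show ?thesis unfolding h by auto
  next
    case True
    \<comment> \<open>Modulo \<open>?M\<close> the element is \<open>?N * a1\<close>, and
      \<open>?N\<close> can be cancelled there by coprimality, so the shorter product with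
      \<open>a1\<close> is treated instead.\<close>
    then obtain p a1 where a: "a = ?M * p + ?N * a1" by (rule ideal2_E)
    have a1: "a1 \<notin> ideal2 ?M ?h"
    proof
      assume "a1 \<in> ideal2 ?M ?h"
      then obtain b c where b: "a1 = ?M * b + ?h * c" by (rule ideal2_E)
      have "a = ?M * (p + ?N * b) + (?N * ?h) * c" unfolding a b by algebra
      then show False using Cons.prems(2) unfolding h by (metis ideal2_I)
    qed
    have "\<forall>n\<in>set ns. n \<noteq> (0, 0)" using Cons.prems by simp
    then obtain n' where n': "n' \<in> set ns" "\<And>s. s * a1 \<in> ideal2 ?M ?h \<Longrightarrow> s \<in> ideal2 ?M (lin 3 4 n')"
      using Cons.IH[OF _ a1] by blast
    have "s \<in> ideal2 ?M (lin 3 4 n')" if s: "s * a \<in> ideal2 ?M (?N * ?h)" for s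
    proof -
      obtain u w where "s * a = ?M * u + ?N * ?h * w" using s by (rule ideal2_E)
      then have "?M * (u - s * p) = linprod 3 4 [n] * (s * a1 - ?h * w)"
        unfolding a list.map prod_list.Cons prod_list.Nil by algebra
      then obtain z where "s * a1 - ?h * w = ?M * z"
        using lin_coprime[OF m, of "[n]"] n by auto
      then have "s * a1 = ?M * z + ?h * w" by algebra
      then show ?thesis using n'(2) ideal2_I by metis
    qed
    then show ?thesis unfolding h using n'(1) by auto
  qed
qed

text \<open>The same descent along the first product. Outside \<open>(?M, ?h)\<close> the preceding
  lemma applies; inside, \<open>?M\<close> is cancelled modulo \<open>?h\<close>.\<close>

lemma colon_prod_prod:
  assumes ms: "\<forall>m\<in>set ms. m \<noteq> (0, 0)" and ns: "\<forall>n\<in>set ns. n \<noteq> (0, 0)"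
    and a: "a \<notin> ideal2 (linprod 1 2 ms) (linprod 3 4 ns)"
  shows "\<exists>m\<in>set ms. \<exists>n\<in>set ns. \<forall>s.
    s * a \<in> ideal2 (linprod 1 2 ms) (linprod 3 4 ns) \<longrightarrow>
    s \<in> ideal2 (lin 1 2 m) (lin 3 4 n)"
  using ms a
proof (induction ms arbitrary: a)
  case Nil
  then show ?case using ideal2_mult[OF ideal2_gens(1)[where g = 1 and h = "linprod 3 4 ns"], where y = a] by simp
next
  case (Cons m ms)
  let ?M = "lin 1 2 m" and ?g = "linprod 1 2 ms" and ?h = "linprod 3 4 ns"
  have g: "linprod 1 2 (m # ms) = ?M * ?g" by simp
  have m: "m \<noteq> (0, 0)" using Cons.prems by simp
  show ?case
  proof (cases "a \<in> ideal2 ?M ?h")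
    case False
    obtain n where n: "n \<in> set ns" "\<And>s. s * a \<in> ideal2 ?M ?h \<Longrightarrow> s \<in> ideal2 ?M (lin 3 4 n)"
      using colon_lin_prod[OF m ns False] by blast
    have "s \<in> ideal2 ?M (lin 3 4 n)" if s: "s * a \<in> ideal2 (?M * ?g) ?h" for s
    proof -
      have "s * a \<in> ideal2 ?M ?h" using s by (elim ideal2_E) (simp only: mult.assoc ideal2_I)
      then show ?thesis by (rule n(2))
    qed
    then show ?thesis unfolding g using n(1) by auto
  next
    case True
    then obtain a1 c where a: "a = ?M * a1 + ?h * c" by (rule ideal2_E)
    have a1: "a1 \<notin> ideal2 ?g ?h"
    proof
      assume "a1 \<in> ideal2 ?g ?h"
      then obtain p q where b: "a1 = ?g * p + ?h * q" by (rule ideal2_E)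
      have "a = (?M * ?g) * p + ?h * (?M * q + c)" unfolding a b by algebra
      then show False using Cons.prems(2) unfolding g by (metis ideal2_I)
    qed
    have "\<forall>m\<in>set ms. m \<noteq> (0, 0)" using Cons.prems by simp
    then obtain m' n where n: "m' \<in> set ms" "n \<in> set ns"
      "\<And>s. s * a1 \<in> ideal2 ?g ?h \<Longrightarrow> s \<in> ideal2 (lin 1 2 m') (lin 3 4 n)"
      using Cons.IH[OF _ a1] by blast
    have "s \<in> ideal2 (lin 1 2 m') (lin 3 4 n)" if s: "s * a \<in> ideal2 (?M * ?g) ?h" for s
    proof -
      obtain u w where "s * a = ?M * ?g * u + ?h * w" using s by (rule ideal2_E)
      then have "?M * (s * a1 - ?g * u) = ?h * (w - s * c)" unfolding a by algebra
      moreover from this obtain z where z: "w - s * c = ?M * z" using lin_coprime[OF m ns] by blast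
      ultimately have "?M * (s * a1 - ?g * u) = ?M * (?h * z)" by algebra
      then have "s * a1 - ?g * u = ?h * z" using lin_nonzero[of 1 2 m] m by simp
      then have "s * a1 = ?g * u + ?h * z" by algebra
      then show ?thesis using n(3) ideal2_I by metis
    qed
    then show ?thesis unfolding g using n(1,2) by auto
  qed
qed

section \<open>The free case\<close>

context tame_surface
begin

lemma rho_independent_eq:
  assumes "p *s \<rho>1 + q *s \<rho>2 = p' *s \<rho>1 + q' *s \<rho>2"
  shows "p = p' \<and> q = q'"
proof -
  have "(p - p') *s \<rho>1 + (q - q') *s \<rho>2 = (p *s \<rho>1 + q *s \<rho>2) - (p' *s \<rho>1 + q' *s \<rho>2)"
    unfolding SnM.scale_left_diff_distrib by (simp only: algebra_simps)
  also have "\<dots> = 0" using assms by simp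
  finally have "p - p' = 0 \<and> q - q' = 0" by (rule rho_independent)
  then show ?thesis by simp
qed

lemma lin_prod_in_I:
  assumes bd: "\<And>k. K \<le> k \<Longrightarrow> hilbert_quotient I k \<le> N" and ij: "i \<noteq> j"
  obtains ms where "\<forall>m\<in>set ms. m \<noteq> (0, 0)" "linprod i j ms \<in> I"
proof -
  obtain k p where p: "bform i j k p \<in> I" "degree p \<le> k" "p \<noteq> 0"
    using bform_in_ideal[OF subspace_I ij bd] by metis
  obtain c ms where c: "c \<noteq> 0" "\<forall>m\<in>set ms. m \<noteq> (0, 0)" "bform i j k p = Const c * linprod i j ms"
    using bform_factorization[OF p(2,3)] by metis
  have "Const (1 / c) * Const c = 1" using c(1) by (simp add: Const_inverse)
  then have "linprod i j ms = Const (1 / c) * bform i j k p" unfolding c(3) by algebra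
  then have "linprod i j ms \<in> I" using I_mult[OF p(1)] by simp
  then show ?thesis using that c(2) by blast
qed

text \<open>The module \<open>AR(f)\<close> is an extension of \<open>I\<close> by a free module. If \<open>S / I\<close> has dimension at most
  one, this extension splits over the complete intersection \<open>(g, h)\<close>, so that some syzygy
  maps to \<open>1\<close>.\<close>

lemma one_in_I_if_bounded:
  assumes bd: "\<And>k. K \<le> k \<Longrightarrow> hilbert_quotient I k \<le> N"
  shows "1 \<in> I"
proof -
  have ne: "(1::4) \<noteq> 2" "(3::4) \<noteq> 4" by simp_all
  obtain ms where ms: "\<forall>m\<in>set ms. m \<noteq> (0, 0)" "linprod 1 2 ms \<in> I"
    using lin_prod_in_I[OF bd ne(1)] by metis
  obtain ns where ns: "\<forall>m\<in>set ns. m \<noteq> (0, 0)" "linprod 3 4 ns \<in> I"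
    using lin_prod_in_I[OF bd ne(2)] by metis
  define g h where gh: "g = linprod 1 2 ms" "h = linprod 3 4 ns"
  obtain \<rho>g where rg: "\<rho>g \<in> AR f" "cross \<rho>1 \<rho>2 \<rho>g = g *s F" using ms(2) unfolding gh I_def by blast
  obtain \<rho>h where rh: "\<rho>h \<in> AR f" "cross \<rho>1 \<rho>2 \<rho>h = h *s F" using ns(2) unfolding gh I_def by blast
  \<comment> \<open>The cocycle of the extension: cross multiples of two lifts differ by an element
    of the free submodule.\<close>
  have pair: "\<exists>p q. y *s \<rho>x - x *s \<rho>y = p *s \<rho>1 + q *s \<rho>2"
    if "\<rho>x \<in> AR f" "cross \<rho>1 \<rho>2 \<rho>x = x *s F" "\<rho>y \<in> AR f" "cross \<rho>1 \<rho>2 \<rho>y = y *s F" for x y \<rho>x \<rho>y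
  proof -
    have "cross \<rho>1 \<rho>2 (y *s \<rho>x - x *s \<rho>y) = 0"
      by (simp only: cross_simps that SnM.scale_scale mult.commute[of x y] diff_self)
    then show ?thesis using kernel_cross[OF AR_diff[OF AR_smult AR_smult]] that by blast
  qed
  obtain p q where pq: "g *s \<rho>h - h *s \<rho>g = p *s \<rho>1 + q *s \<rho>2" using pair[OF rh rg] by blast
  \<comment> \<open>The cocycle identity for \<open>g, h, s\<close>: the value at
    \<open>(g, h)\<close> times \<open>s\<close> is \<open>g\<close> times the value at
    \<open>(s, h)\<close> minus \<open>h\<close> times the value at \<open>(s, g)\<close>.\<close>
  have colon: "s * p \<in> ideal2 g h \<and> s * q \<in> ideal2 g h" if s: "s \<in> I" for s
  proof -
    obtain \<rho>s where rs: "\<rho>s \<in> AR f" "cross \<rho>1 \<rho>2 \<rho>s = s *s F" using s unfolding I_def by blast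
    obtain p1 q1 where 1: "s *s \<rho>h - h *s \<rho>s = p1 *s \<rho>1 + q1 *s \<rho>2" using pair[OF rh rs] by blast
    obtain p2 q2 where 2: "s *s \<rho>g - g *s \<rho>s = p2 *s \<rho>1 + q2 *s \<rho>2" using pair[OF rg rs] by blast
    have "(s * p) *s \<rho>1 + (s * q) *s \<rho>2 = (g * p1 + h * - p2) *s \<rho>1 + (g * q1 + h * - q2) *s \<rho>2"
    proof (unfold vec_eq_iff vector_add_component vector_smult_component, rule allI)
      fix i
      have "g * \<rho>h $ i - h * \<rho>g $ i = p * \<rho>1 $ i + q * \<rho>2 $ i"
        "s * \<rho>h $ i - h * \<rho>s $ i = p1 * \<rho>1 $ i + q1 * \<rho>2 $ i"
        "s * \<rho>g $ i - g * \<rho>s $ i = p2 * \<rho>1 $ i + q2 * \<rho>2 $ i"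
        using arg_cong[OF pq, of "\<lambda>v. v $ i"] arg_cong[OF 1, of "\<lambda>v. v $ i"] arg_cong[OF 2, of "\<lambda>v. v $ i"]
        by simp_all
      then show "s * p * \<rho>1 $ i + s * q * \<rho>2 $ i = (g * p1 + h * - p2) * \<rho>1 $ i + (g * q1 + h * - q2) * \<rho>2 $ i"
        by algebra
    qed
    then have "s * p = g * p1 + h * - p2" "s * q = g * q1 + h * - q2" using rho_independent_eq by blast+
    then show ?thesis by (metis ideal2_I)
  qed
  \<comment> \<open>Otherwise \<open>I\<close> would lie in the ideal of a line, while it contains a
    nonzero binary form in the two variables that survive on this line.\<close>
  have mem: "x \<in> ideal2 g h" if x: "\<And>s. s \<in> I \<Longrightarrow> s * x \<in> ideal2 g h" for x
  proof (rule ccontr)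
    assume "x \<notin> ideal2 g h"
    then obtain m n where mn: "m \<noteq> (0, 0)" "n \<noteq> (0, 0)"
      "\<And>s. s * x \<in> ideal2 g h \<Longrightarrow> s \<in> ideal2 (lin 1 2 m) (lin 3 4 n)"
      using colon_prod_prod[OF ms(1) ns(1), of x] ms(1) ns(1) unfolding gh by metis
    obtain \<sigma> :: "S \<Rightarrow> S" and i j :: 4 where \<sigma>: "rhom \<sigma>" "\<And>c. \<sigma> (Const c) = Const c" "\<sigma> (Var i) = Var i"
      "\<sigma> (Var j) = Var j" "i \<noteq> j" "\<And>x. x \<in> ideal2 (lin 1 2 m) (lin 3 4 n) \<longleftrightarrow> \<sigma> x = 0"
      by (rule ideal2_lin_kernel[OF mn(1,2)]) blast
    obtain k b where b: "bform i j k b \<in> I" "degree b \<le> k" "b \<noteq> 0"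
      using bform_in_ideal[OF subspace_I \<sigma>(5) bd] by metis
    have "\<sigma> (bform i j k b) = bform i j k b"
      unfolding bform_def rhom_sum[OF \<sigma>(1)] rhom_simps(4,7)[OF \<sigma>(1)] \<sigma>(2-4) ..
    moreover have "\<sigma> (bform i j k b) = 0" using mn(3) x b(1) \<sigma>(6) by blast
    ultimately show False using bform_nonzero[OF \<sigma>(5) b(2,3)] by simp
  qed
  obtain p1 p2 where p: "p = g * p1 + h * p2" using mem colon ideal2_E by metis
  obtain q1 q2 where q: "q = g * q1 + h * q2" using mem colon ideal2_E by metis
  \<comment> \<open>As \<open>p\<close> and \<open>q\<close> lie in \<open>(g, h)\<close>, the
    cocycle is a coboundary: the corrected lifts satisfy
    \<open>g * \<sigma>h = h * \<sigma>g\<close>. By coprimality \<open>g\<close> divides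
    \<open>\<sigma>g\<close>, and the quotient is a lift of \<open>1\<close>.\<close>
  define \<sigma>h where "\<sigma>h = \<rho>h - (p1 *s \<rho>1 + q1 *s \<rho>2)"
  define \<sigma>g where "\<sigma>g = \<rho>g + (p2 *s \<rho>1 + q2 *s \<rho>2)"
  have eq: "g * \<sigma>h $ i = h * \<sigma>g $ i" for i
  proof -
    have "g * \<rho>h $ i - h * \<rho>g $ i = p * \<rho>1 $ i + q * \<rho>2 $ i"
      using arg_cong[OF pq, of "\<lambda>v. v $ i"] by simp
    then show ?thesis
      unfolding \<sigma>h_def \<sigma>g_def p q vector_add_component vector_minus_component vector_smult_component by algebra
  qed
  have "\<exists>u. \<sigma>g $ i = g * u" for i
    using prod_lin_coprime[OF ms(1) ns(1)] eq unfolding gh by blast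
  then obtain u where u: "\<And>i. \<sigma>g $ i = g * u i" by metis
  define \<theta> :: "S^4" where "\<theta> = (\<chi> i. u i)"
  have t: "\<sigma>g = g *s \<theta>" by (simp add: vec_eq_iff u \<theta>_def)
  have g0: "g \<noteq> 0" unfolding gh using ms(1) by (induction ms) (simp_all add: lin_nonzero)
  have "\<sigma>g \<in> AR f" unfolding \<sigma>g_def by (intro AR_add rg(1) span_rho_AR)
  then have AR: "\<theta> \<in> AR f" using AR_smult_cancel g0 unfolding t by blast
  have "cross \<rho>1 \<rho>2 \<sigma>g = g *s F"
    unfolding \<sigma>g_def using rg(2) by (simp add: cross_simps cross_self)
  then have "g *s cross \<rho>1 \<rho>2 \<theta> = g *s F" by (simp only: t cross_simps)
  then have "cross \<rho>1 \<rho>2 \<theta> = 1 *s F" using g0 by (simp add: vec_eq_iff)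
  then show ?thesis by (rule I_I[OF AR])
qed

text \<open>A homogeneous lift of \<open>1\<close> has degree \<open>e3\<close>, splits the
  extension and completes \<open>\<rho>1, \<rho>2\<close> to a basis.\<close>

lemma free_if_one_in_I:
  assumes one: "1 \<in> I" and e: "0 < e1" "e1 \<le> e2" "e2 \<le> e3"
  shows "free_surface f"
proof -
  obtain \<rho>3 where r3: "\<rho>3 \<in> AR_grade f (0 + e3)" "cross \<rho>1 \<rho>2 \<rho>3 = 1 *s F"
    using I_lift[OF one one_grade] by metis
  define R :: "3 \<Rightarrow> S^4" where "R j = (if j = 1 then \<rho>1 else if j = 2 then \<rho>2 else \<rho>3)" for j
  have c: "comb R v = (v $ 1 *s \<rho>1 + v $ 2 *s \<rho>2) + v $ 3 *s \<rho>3" for v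
    by (simp add: comb_def sum_3 R_def)
  have gr: "graded_hom (\<lambda>j. - exps e1 e2 e3 j) (\<lambda>_. 0) (comb R)"
    by (rule graded_hom_comb)
      (use r3(1) in \<open>auto simp: R_def exps_def rho1_grade rho2_grade AR_grade_def\<close>)
  then have hom: "module_hom (*s) (*s) (comb R)" by (simp add: graded_hom_def)
  have AR3: "\<rho>3 \<in> AR f" using r3(1) by (simp add: AR_grade_def)
  have cr: "cross \<rho>1 \<rho>2 (comb R v) = v $ 3 *s F" for v
    by (simp add: c cross_simps cross_self r3(2))
  have inj: "inj (comb R)"
  proof (rule injI)
    fix v w assume vw: "comb R v = comb R w"
    then have 3: "v $ 3 = w $ 3" using cr smult_F_cancel by metis
    then have "v $ 1 = w $ 1 \<and> v $ 2 = w $ 2" using vw unfolding c by (intro rho_independent_eq) simp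
    then show "v = w" using 3 by (simp add: vec_eq_iff forall_3)
  qed
  have range: "range (comb R) = AR f"
  proof (intro equalityI subsetI)
    fix x assume "x \<in> range (comb R)"
    then show "x \<in> AR f" by (auto simp: c intro!: AR_add AR_smult rho1_AR rho2_AR AR3)
  next
    fix x assume x: "x \<in> AR f"
    then obtain h where h: "cross \<rho>1 \<rho>2 x = h *s F" by (rule cross_AR)
    have "cross \<rho>1 \<rho>2 (x - h *s \<rho>3) = 0" by (simp add: cross_simps h r3(2))
    then obtain p q where "x - h *s \<rho>3 = p *s \<rho>1 + q *s \<rho>2"
      using kernel_cross[OF AR_diff[OF x AR_smult[OF AR3]]] by blast
    then have "x = comb R (vector [p, q, h])" by (simp add: c diff_eq_eq)
    then show "x \<in> range (comb R)" by blast
  qed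
  have "comb R ` twisted_grade (\<lambda>j. - exps e1 e2 e3 j) q = AR_grade f q" for q
    unfolding graded_hom_image[OF gr] range using AR_grade_iff by blast
  moreover have "bij_betw (comb R) UNIV (AR f)" using inj range by (simp add: bij_betw_def)
  ultimately show ?thesis unfolding free_surface_def using e hom by blast
qed

lemma e1_nonneg: "0 \<le> e1"
proof (rule ccontr)
  assume "\<not> 0 \<le> e1"
  then have "\<rho>1 $ i = 0" for i using grade_neg[OF rho1_grade] by simp
  then show False using rho1_nonzero by (simp add: vec_eq_iff)
qed

lemma e1_pos:
  assumes "\<not> cone_over_plane_curve f"
  shows "0 < e1"
proof (rule ccontr)
  assume "\<not> 0 < e1"
  then have e: "e1 = 0" using e1_nonneg by simp
  define c :: "complex^4" where "c = (\<chi> i. look (\<rho>1 $ i) 0)"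
  have c: "\<rho>1 $ i = Const (c $ i)" for i
    using grade_zero_Const rho1_grade[of i] unfolding e c_def by simp
  have "c \<noteq> 0"
  proof
    assume "c = 0"
    then have "\<rho>1 $ i = 0" for i by (simp add: c Const_simps(1))
    then show False using rho1_nonzero by (simp add: vec_eq_iff)
  qed
  moreover have "(\<Sum>i\<in>UNIV. Const (c $ i) * partial i f) = 0"
    using rho1_AR by (simp add: AR_def jac_map_def c)
  ultimately show False using cone_if_constant_syzygy assms by blast
qed

lemma e1_le_e2: "e1 \<le> e2"
proof -
  have "\<rho>2 \<noteq> 0" using rho2_not_multiple[of 0] by simp
  then show ?thesis using rho1 rho2 unfolding first_syzygy_def second_syzygy_def by blast
qed

text \<open>The slope of \<open>S / I\<close> is a difference of two consecutive values, hence an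
  integer. Below \<open>1\<close> it is at most \<open>0\<close>, so the Hilbert function is bounded
  and the splitting makes the surface free.\<close>

lemma degree_bound:
  assumes nf: "\<not> free_surface f" and e: "0 < e1" "e2 \<le> e3"
  shows "a \<le> of_int ((e1 + e2 + e3)\<^sup>2 - (e1 * e2 + e1 * e3 + e2 * e3) - 1)"
proof (rule ccontr)
  assume no: "\<not> ?thesis"
  define M where "M = (e1 + e2 + e3)\<^sup>2 - (e1 * e2 + e1 * e3 + e2 * e3)"
  obtain b K where bK: "\<And>k. K \<le> k \<Longrightarrow> of_nat (hilbert_quotient I k) = (of_int M - a) * of_int k + b"
    using hilbert_quotient_I_linear unfolding M_def by metis
  have "of_nat (hilbert_quotient I (K + 1)) - of_nat (hilbert_quotient I K) = of_int M - a"
    using bK[of K] bK[of "K + 1"] by (simp add: algebra_simps)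
  then have s: "of_int M - a = of_int (int (hilbert_quotient I (K + 1)) - int (hilbert_quotient I K))" by simp
  moreover have "of_int M - a < 1" using no by (simp add: M_def)
  ultimately have "int (hilbert_quotient I (K + 1)) - int (hilbert_quotient I K) < 1" by linarith
  then have "of_int M - a \<le> 0" unfolding s by simp
  have "hilbert_quotient I k \<le> hilbert_quotient I K" if "K \<le> k" for k
  proof -
    have "(of_int M - a) * of_int k \<le> (of_int M - a) * of_int K"
      using \<open>of_int M - a \<le> 0\<close> that by (intro mult_left_mono_neg) auto
    then have "(of_nat (hilbert_quotient I k) :: rat) \<le> of_nat (hilbert_quotient I K)"
      using bK[OF that] bK[of K] by simp
    then show ?thesis by simp
  qed
  then have "1 \<in> I" by (rule one_in_I_if_bounded)
  then show False using free_if_one_in_I e e1_le_e2 nf by blast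
qed

end

section \<open>Homogeneous ideals with two generators\<close>

lemma rhom_lookup_0: "rhom (\<lambda>p::S. look p 0)"
proof -
  have i: "rhom (\<lambda>c::complex. c)" by (simp add: rhom_def)
  have "look p 0 = ev (\<lambda>c. c) (\<lambda>_. 0) p" for p
  proof -
    have "look p m * (\<Prod>i\<in>UNIV. 0 ^ look m i) = (if m = 0 then look p 0 else 0)" for m
    proof (cases "m = 0")
      case False
      then obtain i where "look m i \<noteq> 0" by (metis poly_mapping_eqI lookup_zero)
      then have "(\<Prod>i\<in>UNIV. 0 ^ look m i) = (0 :: complex)" by (intro prod_zero) auto
      then show ?thesis using False by simp
    qed simp
    then show ?thesis unfolding ev_def by (simp add: in_keys_iff)
  qed
  then have "(\<lambda>p::S. look p 0) = ev (\<lambda>c. c) (\<lambda>_. 0)" by (rule ext)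
  then show ?thesis using rhom_ev[OF i] by simp
qed

lemmas lookup_0_simps = rhom_simps[OF rhom_lookup_0]

lemma lookup_0_Const: "look (Const c) 0 = c"
  by (simp add: Const_def)

lemma lookup_0_grade: "p \<in> grade k \<Longrightarrow> 0 < k \<Longrightarrow> look p 0 = 0"
  using irrelevant_grade by (simp add: irrelevant_ideal_def)

text \<open>This expresses polynomials without constant term by the generators of the irrelevant
  ideal, as the Nakayama argument requires.\<close>

lemma constant_term_decomposition: "\<exists>B. p = Const (look p 0) + (\<Sum>i\<in>UNIV. Var i * B i)"
proof (induction p rule: S_induct)
  case (Const c)
  then show ?case by (intro exI[of _ "\<lambda>_. 0"]) (simp add: lookup_0_Const)
next
  case (Var j)
  have "look (Var j) 0 = 0" by (rule lookup_0_grade[OF Var_grade]) simp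
  moreover have "(\<Sum>i\<in>UNIV. Var i * (if i = j then 1 else 0)) = (\<Sum>i\<in>UNIV. if i = j then Var j else 0)"
    by (rule sum.cong) auto
  ultimately show ?case by (intro exI[of _ "\<lambda>i. if i = j then 1 else 0"]) (simp add: Const_simps(1))
next
  case (add p q)
  then obtain B B' where B: "p = Const (look p 0) + (\<Sum>i\<in>UNIV. Var i * B i)"
    "q = Const (look q 0) + (\<Sum>i\<in>UNIV. Var i * B' i)" by blast
  have "p + q = Const (look (p + q) 0) + (\<Sum>i\<in>UNIV. Var i * (B i + B' i))"
    unfolding distrib_left sum.distrib lookup_0_simps(3) Const_simps(3) using B by algebra
  then show ?case by (rule exI[of _ "\<lambda>i. B i + B' i"])
next
  case (mult p q)
  then obtain B B' where B: "p = Const (look p 0) + (\<Sum>i\<in>UNIV. Var i * B i)"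
    "q = Const (look q 0) + (\<Sum>i\<in>UNIV. Var i * B' i)" by blast
  have s: "(\<Sum>i\<in>UNIV. Var i * (Const (look p 0) * B' i + B i * q)) =
      Const (look p 0) * (\<Sum>i\<in>UNIV. Var i * B' i) + (\<Sum>i\<in>UNIV. Var i * B i) * q"
    unfolding distrib_left sum.distrib sum_distrib_left sum_distrib_right by (simp only: ac_simps)
  have "p * q = Const (look (p * q) 0) + (\<Sum>i\<in>UNIV. Var i * (Const (look p 0) * B' i + B i * q))"
    unfolding s lookup_0_simps(4) Const_simps(4) using B by algebra
  then show ?case by (rule exI[of _ "\<lambda>i. Const (look p 0) * B' i + B i * q"])
qed

lemma hc_0_Const: "hc 0 u = Const (look u 0)"
  using grade_zero_Const[OF hc_grade[of 0 u]] by (simp add: lookup_hc mdeg_def)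

lemma ideal2_sum: "(\<And>i. i \<in> A \<Longrightarrow> x i \<in> ideal2 g h) \<Longrightarrow> sum x A \<in> ideal2 g h"
  by (induction A rule: infinite_finite_induct) (auto intro: ideal2_gens ideal2_add)

lemma ideal2_uminus: "x \<in> ideal2 g h \<Longrightarrow> - x \<in> ideal2 g h"
  using ideal2_mult[of x g h "- 1"] by simp

lemma ideal2_diff: "x \<in> ideal2 g h \<Longrightarrow> y \<in> ideal2 g h \<Longrightarrow> x - y \<in> ideal2 g h"
  using ideal2_add[OF _ ideal2_uminus, of x g h y] by simp

lemma ideal2_components:
  assumes "\<And>k. hc k x \<in> ideal2 g h"
  shows "x \<in> ideal2 g h"
proof -
  have "(\<Sum>k\<in>degs x. hc k x) \<in> ideal2 g h" by (rule ideal2_sum) (rule assms)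
  then show ?thesis by (simp add: sum_hc)
qed

lemma ideal2_zero: "ideal2 g 0 = range ((*) g)"
  by (auto simp: ideal2_def)

text \<open>The new generators are a nonzero form \<open>p\<close> of least degree in
  \<open>X\<close> and a form \<open>q\<close> of least degree outside \<open>(p)\<close>. Both
  exist by \<open>big\<close>, and \<open>one\<close> makes their degrees positive.\<close>

lemma two_homogeneous_generators:
  assumes X: "X = ideal2 h3 h4" and hcX: "\<And>x k. x \<in> X \<Longrightarrow> hc k x \<in> X" and one: "1 \<notin> X"
    and big: "\<And>g c. g \<in> grade c \<Longrightarrow> 0 < c \<Longrightarrow> \<not> X \<subseteq> range ((*) g)"
  obtains p q m n where "p \<in> grade m" "q \<in> grade n" "0 < m" "0 < n" "X = ideal2 p q"
proof -
  have Xmult: "y * x \<in> X" if "x \<in> X" for x y using that ideal2_mult X by blast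
  have unit: "c = 0" if "Const c \<in> X" for c
  proof (rule ccontr)
    assume "c \<noteq> 0"
    then have "Const (1 / c) * Const c = 1" by (simp add: Const_inverse)
    then show False using Xmult[OF that, of "Const (1 / c)"] one by simp
  qed
  have nonneg: "0 \<le> k" if "x \<in> grade k" "x \<noteq> 0" for x k using grade_neg that not_less by blast
  define P where "P k = (\<exists>p\<in>X. p \<in> grade (int k) \<and> p \<noteq> 0)" for k
  have "\<exists>k. P k"
  proof -
    obtain x where x: "x \<in> X" "x \<notin> range ((*) (Var 1))" using big[OF Var_grade[of 1]] by auto
    then have "x \<noteq> 0" by (metis mult_zero_right rangeI)
    then obtain k where k: "hc k x \<noteq> 0" using degs_eq_empty_iff[of x] hc_eq_0_iff by blast
    then have "0 \<le> k" using nonneg hc_grade by blast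
    then have "P (nat k)" unfolding P_def using hcX[OF x(1), of k] hc_grade[of k x] k by auto
    then show ?thesis ..
  qed
  then have "P (LEAST k. P k)" by (rule LeastI_ex)
  then obtain p m where p: "p \<in> X" "p \<in> grade (int m)" "p \<noteq> 0" and m: "m = (LEAST k. P k)"
    unfolding P_def by blast
  have p_min: "x = 0" if x: "x \<in> X" "x \<in> grade j" "j < int m" for x j
  proof (rule ccontr)
    assume "x \<noteq> 0"
    then have "0 \<le> j" using nonneg x by blast
    then have "P (nat j)" unfolding P_def using x \<open>x \<noteq> 0\<close> by auto
    then have "m \<le> nat j" unfolding m by (rule Least_le)
    then show False using x(3) \<open>0 \<le> j\<close> by linarith
  qed
  have m0: "0 < m"
  proof (rule ccontr)
    assume "\<not> 0 < m"
    then have "p = Const (look p 0)" using grade_zero_Const p(2) by simp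
    then show False using unit p by (metis Const_simps(1))
  qed
  define Q where "Q k = (\<exists>q\<in>X. q \<in> grade (int k) \<and> q \<notin> ideal2 p 0)" for k
  have "\<exists>k. Q k"
  proof -
    obtain x where x: "x \<in> X" "x \<notin> ideal2 p 0" using big[OF p(2)] m0 ideal2_zero by auto
    then obtain k where k: "hc k x \<notin> ideal2 p 0" using ideal2_components by blast
    then have "hc k x \<noteq> 0" using ideal2_gens(3) by metis
    then have "0 \<le> k" using nonneg hc_grade by blast
    then have "Q (nat k)" unfolding Q_def using hcX[OF x(1), of k] hc_grade[of k x] k by auto
    then show ?thesis ..
  qed
  then have "Q (LEAST k. Q k)" by (rule LeastI_ex)
  then obtain q n where q: "q \<in> X" "q \<in> grade (int n)" "q \<notin> ideal2 p 0" and n: "n = (LEAST k. Q k)"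
    unfolding Q_def by blast
  have q_min: "x \<in> ideal2 p 0" if x: "x \<in> X" "x \<in> grade j" "j < int n" for x j
  proof (rule ccontr)
    assume "x \<notin> ideal2 p 0"
    then have "0 \<le> j" using nonneg[OF x(2)] ideal2_gens(3) by metis
    then have "Q (nat j)" unfolding Q_def using x \<open>x \<notin> ideal2 p 0\<close> by auto
    then have "n \<le> nat j" unfolding n by (rule Least_le)
    then show False using x(3) \<open>0 \<le> j\<close> by linarith
  qed
  have n0: "0 < n"
  proof (rule ccontr)
    assume "\<not> 0 < n"
    then have "q = Const (look q 0)" using grade_zero_Const q(2) by simp
    then have "q = 0" using unit q(1) by (metis Const_simps(1))
    then show False using q(3) ideal2_gens(3) by metis
  qed
  obtain \<alpha> \<beta> where pe: "p = h3 * \<alpha> + h4 * \<beta>" using p(1) unfolding X by (rule ideal2_E)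
  obtain \<gamma> \<delta> where qe: "q = h3 * \<gamma> + h4 * \<delta>" using q(1) unfolding X by (rule ideal2_E)
  txt \<open>By the graded Nakayama lemma \<open>p\<close> and \<open>q\<close> generate \<open>X\<close>, as their classes are independent
    modulo the irrelevant ideal times \<open>X\<close>. Since \<open>h3, h4\<close> need not be homogeneous, this is
    expressed by the matrix of constant terms.\<close>
  have indep: "l = 0 \<and> \<mu> = 0"
    if z: "l * look \<alpha> 0 + \<mu> * look \<gamma> 0 = 0" "l * look \<beta> 0 + \<mu> * look \<delta> 0 = 0" for l \<mu>
  proof -
    define A B where AB: "A = Const l * \<alpha> + Const \<mu> * \<gamma>" "B = Const l * \<beta> + Const \<mu> * \<delta>"
    have "look A 0 = 0" "look B 0 = 0" using z by (simp_all add: AB lookup_0_simps lookup_0_Const)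
    then obtain A' B' where A': "A = (\<Sum>i\<in>UNIV. Var i * A' i)" and B': "B = (\<Sum>i\<in>UNIV. Var i * B' i)"
      using constant_term_decomposition[of A] constant_term_decomposition[of B]
      by (auto simp: Const_simps(1))
    define r where "r i = h3 * A' i + h4 * B' i" for i
    have rX: "hc k (r i) \<in> X" for i k by (rule hcX) (simp add: r_def X ideal2_I)
    have "Const l * p + Const \<mu> * q = h3 * A + h4 * B" unfolding AB pe qe by algebra
    also have "\<dots> = (\<Sum>i\<in>UNIV. Var i * r i)"
      unfolding A' B' r_def sum_distrib_left distrib_left sum.distrib by (simp only: ac_simps)
    finally have eq: "Const l * p + Const \<mu> * q = (\<Sum>i\<in>UNIV. Var i * r i)" .
    have comp: "Const l * hc k p + Const \<mu> * hc k q = (\<Sum>i\<in>UNIV. Var i * hc (k - 1) (r i))" for k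
      using arg_cong[OF eq, of "hc k"]
      by (simp only: hc_add hc_Const_mult hc_sum hc_mult_grade[OF Var_grade])
    \<comment> \<open>Below degree \<open>n\<close> all forms of \<open>X\<close> are multiples of
      \<open>p\<close>, so the component of degree \<open>n\<close> of the relation puts
      \<open>\<mu> * q\<close> into \<open>(p)\<close>.\<close>
    have "(\<Sum>i\<in>UNIV. Var i * hc (int n - 1) (r i)) \<in> ideal2 p 0"
      by (intro ideal2_sum ideal2_mult q_min[OF rX hc_grade]) simp
    then have 1: "Const l * hc (int n) p + Const \<mu> * q \<in> ideal2 p 0"
      using comp[of "int n"] q(2) by (simp add: grade_hc_iff)
    have "Const l * hc (int n) p \<in> ideal2 p 0"
      by (rule ideal2_mult) (simp add: hc_of_grade[OF p(2)] ideal2_gens)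
    then have "(Const l * hc (int n) p + Const \<mu> * q) - Const l * hc (int n) p \<in> ideal2 p 0"
      using 1 by (intro ideal2_diff)
    then have 2: "Const \<mu> * q \<in> ideal2 p 0" by simp
    have \<mu>: "\<mu> = 0"
    proof (rule ccontr)
      assume "\<mu> \<noteq> 0"
      then have "Const (1 / \<mu>) * Const \<mu> = 1" by (simp add: Const_inverse)
      then have "Const (1 / \<mu>) * (Const \<mu> * q) = q" by algebra
      then show False using ideal2_mult[OF 2, of "Const (1 / \<mu>)"] q(3) by (simp only:)
    qed
    \<comment> \<open>Below degree \<open>m\<close> there are no nonzero forms of \<open>X\<close>,
      so the component of degree \<open>m\<close> leaves \<open>l * p = 0\<close>.\<close>
    have "hc (int m - 1) (r i) = 0" for i by (rule p_min[OF rX hc_grade]) simp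
    then have "Const l * p = 0"
      using comp[of "int m"] p(2) by (simp add: grade_hc_iff \<mu> Const_simps(1))
    then show ?thesis using \<mu> p(3) by simp
  qed
  \<comment> \<open>The determinant of the change of generators. By Cramer's rule \<open>u\<close>
    carries \<open>X\<close> into \<open>(p, q)\<close>; on a form of degree \<open>k\<close>, the
    component of degree \<open>k\<close> of this multiple involves only the constant term of
    \<open>u\<close>.\<close>
  define u where "u = \<alpha> * \<delta> - \<beta> * \<gamma>"
  have u0: "look u 0 \<noteq> 0"
  proof
    assume "look u 0 = 0"
    then have d: "look \<alpha> 0 * look \<delta> 0 = look \<beta> 0 * look \<gamma> 0" by (simp add: u_def lookup_0_simps)
    \<comment> \<open>If the determinant vanished, the rows of the adjugate matrix would be
      relations, so all constant terms would be zero.\<close>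
    have "look \<gamma> 0 = 0 \<and> - look \<alpha> 0 = 0" by (rule indep) (use d in \<open>simp_all add: mult.commute\<close>)
    moreover have "look \<delta> 0 = 0 \<and> - look \<beta> 0 = 0" by (rule indep) (use d in \<open>simp_all add: mult.commute\<close>)
    ultimately show False using indep[of 1 0] by simp
  qed
  have "X = ideal2 p q"
  proof (intro equalityI subsetI)
    fix x assume "x \<in> ideal2 p q"
    then obtain y z where "x = p * y + q * z" by (rule ideal2_E)
    then have "x = y * p + z * q" by (simp only: mult.commute)
    then show "x \<in> X" using ideal2_add[of "y * p" h3 h4 "z * q"] Xmult[OF p(1)] Xmult[OF q(1)]
      unfolding X by simp
  next
    fix x assume x: "x \<in> X"
    show "x \<in> ideal2 p q"
    proof (rule ideal2_components)
      fix k
      obtain c e where ce: "hc k x = h3 * c + h4 * e" using hcX[OF x, of k] unfolding X by (rule ideal2_E)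
      have "u * hc k x = p * (\<delta> * c - \<gamma> * e) + q * (\<alpha> * e - \<beta> * c)"
        unfolding ce u_def pe qe by algebra
      then have "hc k (u * hc k x) = p * hc (k - int m) (\<delta> * c - \<gamma> * e) + q * hc (k - int n) (\<alpha> * e - \<beta> * c)"
        by (simp only: hc_add hc_mult_grade[OF p(2)] hc_mult_grade[OF q(2)])
      moreover have "hc k (u * hc k x) = Const (look u 0) * hc k x"
        using hc_mult_grade_right[OF hc_grade[of k x], of k u] by (simp add: hc_0_Const)
      ultimately have "Const (look u 0) * hc k x \<in> ideal2 p q" using ideal2_I by simp
      then have "Const (1 / look u 0) * (Const (look u 0) * hc k x) \<in> ideal2 p q" by (rule ideal2_mult)
      moreover have "Const (1 / look u 0) * Const (look u 0) = 1" using u0 by (simp add: Const_inverse)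
      then have "Const (1 / look u 0) * (Const (look u 0) * hc k x) = hc k x" by algebra
      ultimately show "hc k x \<in> ideal2 p q" by (simp only:)
    qed
  qed
  then show ?thesis using that[of p "int m" q "int n"] p(2) q(2) m0 n0 by simp
qed

text \<open>A common factor of positive degree is excluded by \<open>big\<close>, so the gcd of
  \<open>p\<close> and \<open>q\<close> is a unit and every syzygy is a multiple of the Koszul
  one.\<close>

lemma regular_pair:
  assumes p: "p \<in> grade m" and q: "q \<in> grade n" "0 < n"
    and big: "\<And>g c. g \<in> grade c \<Longrightarrow> 0 < c \<Longrightarrow> \<not> ideal2 p q \<subseteq> range ((*) g)"
  shows "p \<noteq> 0" "p * a + q * b = 0 \<longleftrightarrow> (\<exists>s. a = s * q \<and> b = s * - p)"
proof -
  show p0: "p \<noteq> 0"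
  proof
    assume "p = 0"
    then have "ideal2 p q \<subseteq> range ((*) q)" by (auto simp: ideal2_def)
    then show False using big[OF q] by blast
  qed
  show "p * a + q * b = 0 \<longleftrightarrow> (\<exists>s. a = s * q \<and> b = s * - p)"
  proof
    assume ab: "p * a + q * b = 0"
    obtain g p' q' where g: "p = g * p'" "q = g * q'"
      and syz: "\<And>a b. a * q' = b * p' \<Longrightarrow> \<exists>s. a = s * p' \<and> b = s * q'"
      using S_gcd_pair[OF disjI1[OF p0], of q] by metis
    have nz: "g \<noteq> 0" "p' \<noteq> 0" using p0 g by auto
    have "g * p' \<in> grade m" using p g by simp
    then obtain c where c: "g \<in> grade c" using grade_factor nz by blast
    have "ideal2 p q \<subseteq> range ((*) g)"
    proof
      fix x assume "x \<in> ideal2 p q"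
      then obtain y z where "x = p * y + q * z" by (rule ideal2_E)
      then have "x = g * (p' * y + q' * z)" unfolding g by algebra
      then show "x \<in> range ((*) g)" by blast
    qed
    then have "\<not> 0 < c" using big[OF c] by blast
    then obtain r where inv: "r * g = 1" using homogeneous_unit[OF c nz(1)] by blast
    have "g * (b * q') = g * (- a * p')" using ab unfolding g by algebra
    then have "b * q' = - a * p'" by (rule iffD1[OF mult_left_cancel[OF nz(1)]])
    then obtain s where s: "b = s * p'" "- a = s * q'" using syz by blast
    have "a = (- s * r) * q" "b = (- s * r) * - p"
      using s inv unfolding g by algebra+
    then show "\<exists>s. a = s * q \<and> b = s * - p" by blast
  next
    assume "\<exists>s. a = s * q \<and> b = s * - p"
    then obtain s where "a = s * q" "b = s * - p" by blast
    then show "p * a + q * b = 0" by algebra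
  qed
qed

text \<open>Dimension count in the Koszul complex: \<open>T\<close> is the syzygy
  \<open>(q, - p)\<close>, placed in degree \<open>m + n\<close>. The ideal is viewed inside
  \<open>S^1\<close> so that the count for maps of free modules applies.\<close>

lemma dim_complete_intersection:
  assumes p: "p \<in> grade m" "p \<noteq> 0" and q: "q \<in> grade n"
    and reg: "\<And>a b. p * a + q * b = 0 \<longleftrightarrow> (\<exists>s. a = s * q \<and> b = s * - p)"
  shows "SV.dim (grade k \<inter> ideal2 p q) + hS (k - m - n) = hS (k - m) + hS (k - n)"
proof -
  let ?s = "\<lambda>j::2. if j = 1 then - m else - n" and ?t = "\<lambda>_::1. 0 :: int" and ?r = "\<lambda>_::1. - m - n"
  define R :: "2 \<Rightarrow> S^1" where "R j = (\<chi> _. if j = 1 then p else q)" for j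
  define T :: "1 \<Rightarrow> S^2" where "T j = vector [q, - p]" for j
  have c: "comb R v $ i = p * v $ 1 + q * v $ 2" for v i
    by (simp add: comb_nth sum_2 R_def mult.commute)
  have d: "comb T v = v $ 1 *s vector [q, - p]" for v by (simp add: comb_def T_def)
  have gR: "graded_hom ?s ?t (comb R)"
    by (rule graded_hom_comb) (use p q in \<open>auto simp: R_def\<close>)
  have "T j $ i \<in> grade (?s i - ?r j)" for i j
    using exhaust_2[of i] p q by (auto simp: T_def intro: grade_uminus)
  then have gT: "graded_hom ?r ?s (comb T)" by (rule graded_hom_comb)
  have "v = 0" if "comb T v = 0" for v
  proof -
    have "v $ 1 * p = 0" using arg_cong[OF that, of "\<lambda>w. w $ 2"] by (simp add: d)
    then show ?thesis using p(2) by (simp add: vec_eq_iff forall_1)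
  qed
  moreover have "comb T 0 = 0" "0 \<in> twisted_grade ?r k" by (simp_all add: d twisted_grade_def)
  ultimately have "{v \<in> twisted_grade ?r k. comb T v = 0} = {0}" by blast
  then have "hS (k + (- m - n)) = SnV.dim (twisted_grade ?s k \<inter> range (comb T))"
    using dim_graded_hom[OF gT, of k] by (simp add: SnV.dim_zero)
  moreover have "k + (- m - n) = k - m - n" by simp
  ultimately have 1: "hS (k - m - n) = SnV.dim (twisted_grade ?s k \<inter> range (comb T))" by (simp only:)
  have "comb R v = 0 \<longleftrightarrow> v \<in> range (comb T)" for v
  proof -
    have "comb R v = 0 \<longleftrightarrow> p * v $ 1 + q * v $ 2 = 0" unfolding vec_eq_iff c by simp
    also have "\<dots> \<longleftrightarrow> (\<exists>s. v = comb T (\<chi> _. s))" unfolding reg by (simp add: d vec_eq_iff forall_2)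
    also have "\<dots> \<longleftrightarrow> v \<in> range (comb T)"
    proof
      assume "v \<in> range (comb T)"
      then obtain w where "v = comb T w" by blast
      then have "v = comb T (\<chi> _. w $ 1)" by (simp add: d)
      then show "\<exists>s. v = comb T (\<chi> _. s)" by blast
    qed blast
    finally show ?thesis .
  qed
  then have 2: "{v \<in> twisted_grade ?s k. comb R v = 0} = twisted_grade ?s k \<inter> range (comb T)" by blast
  have "twisted_grade ?t k \<inter> range (comb R) = (\<lambda>h. h *s 1) ` (grade k \<inter> ideal2 p q)"
  proof (intro equalityI subsetI)
    fix x assume x: "x \<in> twisted_grade ?t k \<inter> range (comb R)"
    then obtain v where "x = comb R v" by blast
    then have "x $ 1 \<in> ideal2 p q" by (simp only: c ideal2_I)
    moreover have "x $ 1 \<in> grade k" using x by (simp add: twisted_grade_def)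
    moreover have "x = x $ 1 *s 1" by (simp add: vec_eq_iff forall_1)
    ultimately show "x \<in> (\<lambda>h. h *s 1) ` (grade k \<inter> ideal2 p q)" by blast
  next
    fix x :: "S^1" assume "x \<in> (\<lambda>h. h *s 1) ` (grade k \<inter> ideal2 p q)"
    then obtain h where h: "x = h *s 1" "h \<in> grade k" "h \<in> ideal2 p q" by blast
    obtain a b where "h = p * a + q * b" using h(3) by (rule ideal2_E)
    then have "x = comb R (vector [a, b])" unfolding vec_eq_iff c by (simp add: h(1))
    moreover have "x \<in> twisted_grade ?t k" by (simp add: h(1,2) twisted_grade_def)
    ultimately show "x \<in> twisted_grade ?t k \<inter> range (comb R)" by blast
  qed
  moreover have "SnV.dim ((\<lambda>h. h *s (1::S^1)) ` (grade k \<inter> ideal2 p q)) = SV.dim (grade k \<inter> ideal2 p q)"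
    by (rule dim_smult_image)
      (auto simp: SV.subspace_def vec_eq_iff intro: grade_add grade_Const_mult ideal2_gens ideal2_add ideal2_mult)
  ultimately show ?thesis using dim_graded_hom[OF gR, of k] 1 2 by (simp add: UNIV_2)
qed

definition vec4 :: "S \<Rightarrow> S \<Rightarrow> S \<Rightarrow> S \<Rightarrow> S^4" where
  "vec4 a b c e = (\<chi> i. if i = 1 then a else if i = 2 then b else if i = 3 then c else e)"

lemma vec4_nth: "vec4 a b c e $ 1 = a" "vec4 a b c e $ 2 = b" "vec4 a b c e $ 3 = c" "vec4 a b c e $ 4 = e"
  by (simp_all add: vec4_def)

context tame_surface
begin

lemma I_not_in_principal:
  assumes "g \<in> grade c" "0 < c"
  shows "\<not> I \<subseteq> range ((*) g)"
proof -
  obtain b K where "\<And>k. K \<le> k \<Longrightarrow> of_nat (hilbert_quotient I k) =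
      (of_int ((e1 + e2 + e3)\<^sup>2 - (e1 * e2 + e1 * e3 + e2 * e3)) - a) * of_int k + b"
    using hilbert_quotient_I_linear by metis
  then show ?thesis using not_in_principal[OF hilbert_quotient _ assms] by blast
qed

text \<open>Lifts of \<open>p\<close> and \<open>q\<close> have degree \<open>e3 + 1\<close>. The
  Koszul relation between \<open>p\<close> and \<open>q\<close> lifts to one relation among four
  syzygies, with correction terms in \<open>\<rho>1\<close> and \<open>\<rho>2\<close>. It generates
  all relations because the Koszul relation does and \<open>\<rho>1, \<rho>2\<close> are
  independent.\<close>

lemma nearly_free_if_linear_generators:
  assumes I: "I = ideal2 p q" and p: "p \<in> grade 1" and q: "q \<in> grade 1"
    and reg: "p \<noteq> 0" "\<And>a b. p * a + q * b = 0 \<longleftrightarrow> (\<exists>s. a = s * q \<and> b = s * - p)"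
    and e: "0 < e1" "e2 \<le> e3"
  shows "nearly_free f d e1 e2 (e3 + 1)"
proof -
  have e': "e1 \<le> e2" by (rule e1_le_e2)
  have pI: "p \<in> I" "q \<in> I" unfolding I by (rule ideal2_gens)+
  obtain \<rho>3 where r3: "\<rho>3 \<in> AR_grade f (1 + e3)" "cross \<rho>1 \<rho>2 \<rho>3 = p *s F" using I_lift[OF pI(1) p] by metis
  obtain \<rho>4 where r4: "\<rho>4 \<in> AR_grade f (1 + e3)" "cross \<rho>1 \<rho>2 \<rho>4 = q *s F" using I_lift[OF pI(2) q] by metis
  have AR3: "\<rho>3 \<in> AR f" and AR4: "\<rho>4 \<in> AR f" using r3 r4 by (simp_all add: AR_grade_def)
  have g3: "\<rho>3 $ i \<in> grade (1 + e3)" and g4: "\<rho>4 $ i \<in> grade (1 + e3)" for i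
    using r3 r4 by (simp_all add: AR_grade_def)
  let ?x = "q *s \<rho>3 - p *s \<rho>4"
  have "cross \<rho>1 \<rho>2 ?x = 0"
    by (simp only: cross_simps r3(2) r4(2) SnM.scale_scale mult.commute[of q p] diff_self)
  then obtain A' B' where AB': "?x = A' *s \<rho>1 + B' *s \<rho>2"
    using kernel_cross[OF AR_diff[OF AR_smult[OF AR3] AR_smult[OF AR4]]] by blast
  \<comment> \<open>The coefficients found need not be homogeneous. Their components in these
    degrees satisfy the same relation, as its left-hand side has degree
    \<open>e3 + 2\<close>.\<close>
  define A B where AB: "A = hc (e3 + 2 - e1) A'" "B = hc (e3 + 2 - e2) B'"
  have "?x \<in> twisted_grade (\<lambda>_. 0) (e3 + 2)"
  proof -
    have "q * \<rho>3 $ i - p * \<rho>4 $ i \<in> grade (1 + (1 + e3))" for i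
      by (intro grade_diff grade_mult p q g3 g4)
    then show ?thesis by (simp add: twisted_grade_def add.commute)
  qed
  then have "?x = hcv (\<lambda>_. 0) (e3 + 2) ?x" by (simp only: twisted_grade_hcv_iff)
  also have "\<dots> = A *s \<rho>1 + B *s \<rho>2"
  proof -
    have "\<rho>1 \<in> twisted_grade (\<lambda>_. 0) e1" "\<rho>2 \<in> twisted_grade (\<lambda>_. 0) e2"
      by (simp_all add: twisted_grade_def rho1_grade rho2_grade)
    then show ?thesis unfolding AB' hcv_add AB by (simp only: hcv_smult)
  qed
  finally have rel: "?x = A *s \<rho>1 + B *s \<rho>2" .
  define R :: "4 \<Rightarrow> S^4" where "R j = (if j = 1 then \<rho>1 else if j = 2 then \<rho>2 else if j = 3 then \<rho>3 else \<rho>4)" for j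
  define \<kappa> where "\<kappa> = vec4 (- A) (- B) q (- p)"
  define T :: "1 \<Rightarrow> S^4" where "T j = \<kappa>" for j
  let ?s = "\<lambda>j::4. - d - exps e1 e2 (e3 + 1) j + 1"
  have c: "comb R v = (v $ 1 *s \<rho>1 + v $ 2 *s \<rho>2) + (v $ 3 *s \<rho>3 + v $ 4 *s \<rho>4)" for v
    by (simp add: comb_def sum_4 R_def add.assoc)
  have t: "comb T v = v $ 1 *s \<kappa>" for v by (simp add: comb_def T_def)
  have k: "\<kappa> $ 1 = - A" "\<kappa> $ 2 = - B" "\<kappa> $ 3 = q" "\<kappa> $ 4 = - p" by (simp_all add: \<kappa>_def vec4_nth)
  have kg: "\<kappa> $ j \<in> grade (e3 + 2 - exps e1 e2 (e3 + 1) j)" for j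
    using exhaust_4[of j] p q hc_grade
    by (elim disjE) (simp_all add: k exps_def AB grade_uminus)
  have Rg: "R j $ i \<in> grade (exps e1 e2 (e3 + 1) j)" for i j
    using exhaust_4[of j] rho1_grade rho2_grade g3 g4
    by (elim disjE) (simp_all add: R_def exps_def add.commute)
  have gR: "graded_hom ?s (\<lambda>_. - d + 1) (comb R)"
    by (rule graded_hom_comb) (use Rg in simp)
  have gT: "graded_hom (\<lambda>_. - d - (e3 + 1)) ?s (comb T)"
    by (rule graded_hom_comb) (use kg in \<open>simp add: T_def algebra_simps\<close>)
  \<comment> \<open>Positive degree of all matrix entries is what minimality of the resolution
    amounts to. The Koszul entries have degree exactly \<open>1\<close>.\<close>
  have pos: "0 < exps e1 e2 (e3 + 1) j" "0 < e3 + 2 - exps e1 e2 (e3 + 1) j" for j :: 4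
    using e e' by (auto simp: exps_def)
  have injT: "inj (comb T)"
  proof (rule injI)
    fix v w assume vw: "comb T v = comb T w"
    have "v $ 1 * p = w $ 1 * p" using arg_cong[OF vw, of "\<lambda>x. x $ 4"] by (simp add: t k)
    then show "v = w" using reg(1) by (simp add: vec_eq_iff forall_1)
  qed
  have kernel: "comb R v = 0 \<longleftrightarrow> v \<in> range (comb T)" for v
  proof
    assume v: "comb R v = 0"
    then have "cross \<rho>1 \<rho>2 (comb R v) = 0" by (simp add: cross_simps)
    moreover have "cross \<rho>1 \<rho>2 (comb R v) = (v $ 3 * p + v $ 4 * q) *s F"
      by (simp add: c cross_simps cross_self r3(2) r4(2) SnM.scale_left_distrib)
    ultimately have "(v $ 3 * p + v $ 4 * q) *s F = 0 *s F" by (simp only: SnM.scale_zero_left)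
    then have "v $ 3 * p + v $ 4 * q = 0" by (simp only: smult_F_cancel)
    then have "p * v $ 3 + q * v $ 4 = 0" by (simp only: mult.commute)
    then obtain s where s: "v $ 3 = s * q" "v $ 4 = s * - p" using reg(2) by blast
    have "(v $ 1 + s * A) *s \<rho>1 + (v $ 2 + s * B) *s \<rho>2 = 0"
    proof (unfold vec_eq_iff vector_add_component vector_smult_component zero_index, rule allI)
      fix i
      have "q * \<rho>3 $ i - p * \<rho>4 $ i = A * \<rho>1 $ i + B * \<rho>2 $ i"
        "v $ 1 * \<rho>1 $ i + v $ 2 * \<rho>2 $ i + (s * q * \<rho>3 $ i + s * - p * \<rho>4 $ i) = 0"
        using arg_cong[OF rel, of "\<lambda>x. x $ i"] arg_cong[OF v, of "\<lambda>x. x $ i"] by (simp_all add: c s)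
      then show "(v $ 1 + s * A) * \<rho>1 $ i + (v $ 2 + s * B) * \<rho>2 $ i = 0" by algebra
    qed
    then have "v $ 1 + s * A = 0" "v $ 2 + s * B = 0" using rho_independent by blast+
    then have "v $ 1 = s * - A" "v $ 2 = s * - B" by algebra+
    then have "v = comb T (\<chi> _. s)" by (simp add: vec_eq_iff forall_4 t k s)
    then show "v \<in> range (comb T)" by blast
  next
    assume "v \<in> range (comb T)"
    then obtain w where w: "v = comb T w" by blast
    show "comb R v = 0"
    proof (unfold vec_eq_iff, rule allI)
      fix i
      have "q * \<rho>3 $ i - p * \<rho>4 $ i = A * \<rho>1 $ i + B * \<rho>2 $ i"
        using arg_cong[OF rel, of "\<lambda>x. x $ i"] by simp
      then have "(w $ 1 * - A) * \<rho>1 $ i + (w $ 1 * - B) * \<rho>2 $ i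
          + ((w $ 1 * q) * \<rho>3 $ i + (w $ 1 * - p) * \<rho>4 $ i) = 0" by algebra
      then show "comb R v $ i = 0 $ i" unfolding c w t by (simp only: k vector_add_component vector_smult_component zero_index)
    qed
  qed
  have range: "range (comb R) = AR f"
  proof (intro equalityI subsetI)
    fix x assume "x \<in> range (comb R)"
    then show "x \<in> AR f" by (auto simp: c intro!: AR_add AR_smult rho1_AR rho2_AR AR3 AR4)
  next
    fix x assume x: "x \<in> AR f"
    then obtain h where h: "cross \<rho>1 \<rho>2 x = h *s F" by (rule cross_AR)
    then have "h \<in> ideal2 p q" using I_I[OF x] I by blast
    then obtain y z where yz: "h = p * y + q * z" by (rule ideal2_E)
    let ?w = "y *s \<rho>3 + z *s \<rho>4"
    have "cross \<rho>1 \<rho>2 ?w = h *s F"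
      by (simp only: cross_simps r3(2) r4(2) SnM.scale_scale yz SnM.scale_left_distrib mult.commute)
    then have "cross \<rho>1 \<rho>2 (x - ?w) = 0" by (simp add: cross_simps h)
    then obtain g1 g2 where "x - ?w = g1 *s \<rho>1 + g2 *s \<rho>2"
      using kernel_cross[OF AR_diff[OF x AR_add[OF AR_smult[OF AR3] AR_smult[OF AR4]]]] by blast
    then have "x = comb R (vec4 g1 g2 y z)" by (simp add: c vec4_nth diff_eq_eq)
    then show "x \<in> range (comb R)" by blast
  qed
  have irr_sum: "sum g X \<in> irrelevant_ideal" if "\<And>j. j \<in> X \<Longrightarrow> g j \<in> irrelevant_ideal" for g :: "4 \<Rightarrow> S" and X
    using that by (simp add: irrelevant_ideal_def lookup_sum)
  have irr_mult: "u * v \<in> irrelevant_ideal" if "v \<in> irrelevant_ideal" for u v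
    using that by (simp add: irrelevant_ideal_def lookup_0_simps(4))
  have "comb T v $ i \<in> irrelevant_ideal" for v i
    unfolding t vector_smult_component by (intro irr_mult irrelevant_grade[OF kg pos(2)])
  moreover have "comb R v $ i \<in> irrelevant_ideal" for v i
    unfolding comb_nth by (intro irr_sum irr_mult irrelevant_grade[OF Rg pos(1)])
  moreover have "jac_map f v \<in> irrelevant_ideal" for v
    unfolding jac_map_def
    by (intro irr_sum irr_mult irrelevant_grade[OF partial_grade[OF f]]) (use e e' e3 in linarith)
  moreover have "range (comb T) = {v. comb R v = 0}" using kernel by blast
  moreover have "range (comb R) = {v. jac_map f v = 0}" using range by (simp add: AR_def)
  moreover have "1 \<le> e1" "e2 \<le> e3 + 1" using e by simp_all
  ultimately show ?thesis unfolding nearly_free_def using gR gT injT e' by blast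
qed

text \<open>The factors belonging to the two further generators generate \<open>I\<close>. Equality
  of degrees makes the slope of \<open>S / I\<close> equal to \<open>1\<close>, while a complete
  intersection of degrees \<open>m, n\<close> has slope \<open>m * n\<close>.\<close>

lemma nearly_free_if_equality:
  assumes a: "a = of_int ((e1 + e2 + e3)\<^sup>2 - (e1 * e2 + e1 * e3 + e2 * e3) - 1)"
    and gen: "\<rho>3 \<in> AR f" "\<rho>4 \<in> AR f" "AR f = module.span (*s) {\<rho>1, \<rho>2, \<rho>3, \<rho>4}"
    and e: "0 < e1" "e2 \<le> e3" and nf: "\<not> free_surface f"
  shows "nearly_free f d e1 e2 (e3 + 1)"
proof -
  obtain h3 where h3: "cross \<rho>1 \<rho>2 \<rho>3 = h3 *s F" using gen(1) by (rule cross_AR)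
  obtain h4 where h4: "cross \<rho>1 \<rho>2 \<rho>4 = h4 *s F" using gen(2) by (rule cross_AR)
  have X: "I = ideal2 h3 h4"
  proof (intro equalityI subsetI)
    fix h assume "h \<in> I"
    then obtain \<rho> where \<rho>: "\<rho> \<in> AR f" "cross \<rho>1 \<rho>2 \<rho> = h *s F" unfolding I_def by blast
    have "\<rho> \<in> SnM.span {\<rho>1, \<rho>2, \<rho>3, \<rho>4}" using \<rho>(1) gen(3) by simp
    then obtain c1 c2 c3 c4 where "\<rho> - c1 *s \<rho>1 - c2 *s \<rho>2 - c3 *s \<rho>3 = c4 *s \<rho>4"
      unfolding SnM.span_insert[of _ "insert _ _"] SnM.span_singleton by blast
    then have "\<rho> = c1 *s \<rho>1 + (c2 *s \<rho>2 + (c3 *s \<rho>3 + c4 *s \<rho>4))" by (simp add: algebra_simps)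
    then have "h *s F = (h3 * c3 + h4 * c4) *s F"
      unfolding \<rho>(2)[symmetric]
      by (simp add: cross_simps cross_self h3 h4 SnM.scale_left_distrib mult.commute)
    then show "h \<in> ideal2 h3 h4" by (simp only: smult_F_cancel ideal2_I)
  next
    fix h assume "h \<in> ideal2 h3 h4"
    then obtain x y where "h = h3 * x + h4 * y" by (rule ideal2_E)
    then have "h = x * h3 + y * h4" by algebra
    then show "h \<in> I" using I_add[OF I_mult[OF I_I[OF gen(1) h3]] I_mult[OF I_I[OF gen(2) h4]]] by simp
  qed
  have one: "1 \<notin> I" using free_if_one_in_I e e1_le_e2 nf by blast
  obtain p q m n where pq: "p \<in> grade m" "q \<in> grade n" "0 < m" "0 < n" "I = ideal2 p q"
    by (rule two_homogeneous_generators[OF X I_hc one I_not_in_principal]) blast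
  have big: "\<not> ideal2 p q \<subseteq> range ((*) g)" if "g \<in> grade c" "0 < c" for g c
    using I_not_in_principal[OF that] unfolding pq(5) .
  have reg: "p \<noteq> 0" "\<And>a b. p * a + q * b = 0 \<longleftrightarrow> (\<exists>s. a = s * q \<and> b = s * - p)"
    by (rule regular_pair[OF pq(1,2,4) big]; assumption)+
  have slope: "of_int ((e1 + e2 + e3)\<^sup>2 - (e1 * e2 + e1 * e3 + e2 * e3)) - a = 1" by (simp add: a)
  obtain b :: rat and K where bK: "\<And>k. K \<le> k \<Longrightarrow> of_nat (hilbert_quotient I k) = 1 * of_int k + b"
    using hilbert_quotient_I_linear unfolding slope by metis
  have "1 = (of_int m * of_int n :: rat)"
  proof (rule linear_unique)
    fix k assume k: "\<bar>K\<bar> + m + n \<le> k"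
    have "int (hilbert_quotient I k) = int (hS k) - int (hS (k - m)) - int (hS (k - n)) + int (hS (k - m - n))"
      using dim_complete_intersection[OF pq(1) reg(1) pq(2) reg(2), of k] hilbert_quotient[of I k] pq(5) by simp
    then have "of_int (int (hilbert_quotient I k)) =
        (of_int (int (hS k) - int (hS (k - m)) - int (hS (k - n)) + int (hS (k - m - n))) :: rat)" by (simp only:)
    then have "of_nat (hilbert_quotient I k) = hp (of_int k) - hp (of_int (k - m)) - hp (of_int (k - n)) + hp (of_int (k - m - n))"
      using k pq(3,4) by (simp add: hS_hp del: of_int_diff of_int_add) (simp add: hS_hp)
    then have "of_nat (hilbert_quotient I k) = of_int m * of_int n * of_int k
        + (hp 0 - hp (- of_int m) - hp (- of_int n) + hp (- of_int m - of_int n))"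
      unfolding hp_complete_intersection[symmetric] by simp
    then show "1 * of_int k + b = of_int m * of_int n * of_int k
        + (hp 0 - hp (- of_int m) - hp (- of_int n) + hp (- of_int m - of_int n))"
      using bK[of k] k pq(3,4) by simp
  qed
  then have "of_int (m * n) = (of_int 1 :: rat)" by simp
  then have "m * n = 1" by (simp only: of_int_eq_iff)
  then have "m = 1" "n = 1" using pq(3,4) zmult_eq_1_iff[of m n] by auto
  then show ?thesis using nearly_free_if_linear_generators[OF pq(5) _ _ reg e] pq(1,2) by simp
qed

end

theorem corollary5p3:
  fixes f :: S and \<rho>1 \<rho>2 :: "S^4" and d e1 e2 e3 s1 s2 :: int and deg_Sigma :: rat
  assumes degree: "1 \<le> d" "f \<in> grade d"
    and reduced: "squarefree f"
    and not_cone: "\<not> cone_over_plane_curve f"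
    and dim_Sigma: "sing_dim f = 1"
    and deg_of_Sigma: "has_sing_degree f deg_Sigma"
    and rho1: "first_syzygy f \<rho>1 e1"
    and rho2: "second_syzygy f \<rho>1 \<rho>2 e2"
    and is_tame: "tame f \<rho>1 \<rho>2"
    and e3: "e3 = d - 1 - e1 - e2"
    and s1: "s1 = e1 + e2 + e3"
    and s2: "s2 = e1 * e2 + e1 * e3 + e2 * e3"
    and e3_ge: "e3 \<ge> e2"
    and not_free: "\<not> free_surface f"
  shows "deg_Sigma \<le> of_int (s1\<^sup>2 - s2 - 1) \<and>
    (nearly_free f d e1 e2 (e3 + 1) \<longrightarrow> deg_Sigma = of_int (s1\<^sup>2 - s2 - 1)) \<and>
    (deg_Sigma = of_int (s1\<^sup>2 - s2 - 1) \<and>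
       (\<exists>\<rho>3\<in>AR f. \<exists>\<rho>4\<in>AR f. AR f = module.span (*s) {\<rho>1, \<rho>2, \<rho>3, \<rho>4}) \<longrightarrow>
     nearly_free f d e1 e2 (e3 + 1))"
proof -
  interpret tame_surface f \<rho>1 \<rho>2 d e1 e2 e3 deg_Sigma
    by unfold_locales (fact degree(2) deg_of_Sigma rho1 rho2 is_tame e3)+
  have e1: "0 < e1" by (rule e1_pos[OF not_cone])
  have D: "d - 1 = e1 + e2 + e3" using e3 by simp
  show ?thesis
    unfolding s1 s2
    using degree_bound[OF not_free e1 e3_ge] nearly_free_degree[OF degree(2) deg_of_Sigma D]
      nearly_free_if_equality[OF _ _ _ _ e1 e3_ge not_free]
    by blast
qed

end
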